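(* Let $F$ be a number field with ring of integers $\mathcal{O}$, and suppose there is a prime $\mathfrak{q} \subset \mathcal{O}$ with $v_{\mathfrak{q}}(2)$ odd. Let $n \geq 2$, fix $m \in \mathcal{O}$, let $f_0(x) = x^2 + m$, and choose $s \in \mathcal{O}$ to be a square such that $s - (f_0^{n-1}(0))^2 \not\equiv 0 \pmod{\mathfrak{q}}$ and $-(s - (f_0^{n-1}(0))^2)$ is not a square in $F$. Put $\gamma = s - f_0^n(0)$ and $f(x) = (x-\gamma)^2 + \gamma + m$. Then for any $i \geq n$, $f^i$ is irreducible over $F$ and $\overline{f^i} \in (\mathcal{O}/\mathfrak{p})[x]$ is reducible for all primes $\mathfrak{p} \subset \mathcal{O}$.
   Context: For a polynomial $g$, $g^n$ denotes its $n$-th iterate (the $n$-fold composition), not its $n$-th power; $f_0^n(0)$ is the value at $0$ of the $n$-th iterate of $f_0$. $v_{\mathfrak{q}}$ denotes the (normalized) $\mathfrak{q}$-adic valuation for a nonzero prime ideal $\mathfrak{q}$ of $\mathcal{O}$. $\overline{g}$ denotes coefficient-wise reduction of $g \in \mathcal{O}[x]$ modulo a nonzero prime ideal $\mathfrak{p}$ of $\mathcal{O}$. *)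

theory Defs
  imports
    "HOL-Algebra.Ideal_Product"
    "HOL-Algebra.QuotRing"
    "HOL-Algebra.UnivPoly"
    "HOL-Computational_Algebra.Polynomial"
    "HOL-Computational_Algebra.Factorial_Ring"
begin

definition number_field :: "'a::field_char_0 itself \<Rightarrow> bool" where
  "number_field _ \<longleftrightarrow>
     (\<exists>B. finite_dimensional_vector_space (\<lambda>(q::rat) (x::'a). of_rat q * x) B)"

definition ring_of_integers :: "'a::field_char_0 ring" where
  "ring_of_integers =
     \<lparr>carrier = {x. algebraic_int x}, monoid.mult = (*), one = 1, zero = 0, add = (+)\<rparr>"

(* "Prime of R" in the sense of algebraic number theory: the zero ideal is excluded. *)
definition nonzero_prime :: "('b, 'c) ring_scheme \<Rightarrow> 'b set \<Rightarrow> bool" where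
  "nonzero_prime R P \<longleftrightarrow> primeideal P R \<and> P \<noteq> {\<zero>\<^bsub>R\<^esub>}"

(* For R Dedekind, P a nonzero prime and x a nonzero element of R, this is the exponent of P in
   the factorization of the ideal (x).  The value at x = 0, where the valuation is infinite,
   is unspecified. *)
definition prime_valuation :: "('b, 'c) ring_scheme \<Rightarrow> 'b set \<Rightarrow> 'b \<Rightarrow> nat" where
  "prime_valuation R P x = (GREATEST k. x \<in> P [^]\<^bsub>ideals_set R\<^esub> k)"

definition poly_iterate :: "'a::comm_semiring_1 poly \<Rightarrow> nat \<Rightarrow> 'a poly" where
  "poly_iterate g n = (pcompose g ^^ n) [:0, 1:]"

(* Coefficient-wise reduction, as an element of UP (ring_of_integers Quot P); meaningful
   when all coefficients of g are algebraic integers. *)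
definition reduce_poly :: "'a::field_char_0 set \<Rightarrow> 'a poly \<Rightarrow> nat \<Rightarrow> 'a set" where
  "reduce_poly P g = (\<lambda>k. P +>\<^bsub>ring_of_integers\<^esub> Polynomial.coeff g k)"

definition reducible_in :: "('b, 'c) ring_scheme \<Rightarrow> 'b \<Rightarrow> bool" where
  "reducible_in R a \<longleftrightarrow> a \<in> carrier R \<and> a \<noteq> \<zero>\<^bsub>R\<^esub> \<and>
     (\<exists>b \<in> carrier R - Units R. \<exists>c \<in> carrier R - Units R. a = b \<otimes>\<^bsub>R\<^esub> c)"

end

theory Submission
  imports Defs
begin

text \<open>
  Write $f_0^k$ for the iterates of $f_0 = x^2 + m$ and $a_k = f_0^k(0)$.  The polynomial $f$ is the
  conjugate of $f_0$ by a translation, $f^i(x) = G_i(x - \<gamma>)$ with $G_i = f_0^i + \<gamma>$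
  (lemma \<open>poly_iterate_conjugate\<close>).  The choice of $\<gamma>$ makes $G_n(0) = s$ a square, and
  $G_1 = x^2 + u$ with $u = m + \<gamma> = s - a_{n-1}^2$.

  Irreducibility over the number field: $G_1$ is irreducible since $-u$ is not a square.  One can write
  $G_{i+1} = P(x^2)$ where $P$ is a translate of $G_i$.  If $P$ is irreducible and $P(x^2)$ is not, then
  $P = A^2 - y B^2$ for polynomials $A$ and $B$ (lemma \<open>norm_form_of_reducible\<close>).  On the other hand,
  $P = H^2 + u$ with a monic integral $H$, because an iterate of $f_0$ is a square plus $m$.  At a
  place where $u$ is a unit and the valuation of 2 is odd, the equation $H^2 + u = A^2 - y B^2$ is
  impossible (lemma \<open>no_norm_form_square_plus_unit\<close>): modulo 2 the square $(A - H)^2$ has only even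
  powers of $y$, the polynomial $y B^2$ only odd ones, and the odd valuation of 2 allows passing one
  step beyond the precision 2, where the term $2 H$ becomes visible.  Induction on $i$ gives
  \<open>irreducible_quad_iter_plus\<close>.

  The valuation is built from the given prime ideal.  Its residue rings are finite
  (\<open>residue_system_exists\<close>), which yields by pigeonhole arguments both that the algebraic integers
  are completely integrally closed and that the prime ideal is locally principal
  (\<open>local_uniformizer\<close>); so its localization is a discrete valuation ring.

  Reducibility modulo primes: it suffices to treat $f^n$, hence $G_n$, since a factorization of $f^n$
  yields one of $f^i = f^n \<circ> f^{i-n}$.  Suppose that $G_n$ is irreducible over a residue field with $q$
  elements, and adjoin a root $x$ of $G_n$.  In the resulting tower of quadratic extensions, generated
  by the iterates $z_k = f_0^k(x)$, powers of the Frobenius map change the signs of the $z_k$.  So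
  $a_{k+1} - z_{k+1} = (a_k - z_k)(a_k + z_k)$ is a norm, and the norm of $-x^2$ down to the
  residue field is $a_n - z_n = s = t^2$.  This makes $\<plusminus>t$ a power of $x$ with an exponent for which
  $x$ would have to be fixed by the Frobenius power that maps it to $-x$
  (\<open>square_value_imp_frobenius_fixed\<close>).  Counting roots shows that $x$ is not fixed
  (\<open>frobenius_not_fixed\<close>).
\<close>

section \<open>Norm forms and valuations with odd value at 2\<close>

locale discrete_valuation =
  fixes v :: "'a::field_char_0 \<Rightarrow> int"
  assumes v_mult: "\<lbrakk>x \<noteq> 0; y \<noteq> 0\<rbrakk> \<Longrightarrow> v (x * y) = v x + v y"
    and v_add: "\<lbrakk>x \<noteq> 0; y \<noteq> 0; x + y \<noteq> 0\<rbrakk> \<Longrightarrow> min (v x) (v y) \<le> v (x + y)"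
begin

text \<open>The predicate "$v(x) \<ge> k$" with the convention $v(0) = \<infinity>$.  Working with it instead of the
  integer-valued \<open>v\<close> removes the case distinctions on vanishing sums.\<close>

definition vge :: "int \<Rightarrow> 'a \<Rightarrow> bool" where
  "vge k x \<longleftrightarrow> x = 0 \<or> k \<le> v x"

definition vge_poly :: "int \<Rightarrow> 'a poly \<Rightarrow> bool" where
  "vge_poly k p \<longleftrightarrow> (\<forall>i. vge k (coeff p i))"

lemma v_one: "v 1 = 0"
  using v_mult[of 1 1] by simp

lemma v_minus_one: "v (-1) = 0"
  using v_mult[of "-1" "-1"] v_one by simp

lemma v_square: "x \<noteq> 0 \<Longrightarrow> v (x\<^sup>2) = 2 * v x"
  by (simp add: power2_eq_square v_mult)

lemma vge_0 [simp]: "vge k 0"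
  by (simp add: vge_def)

lemma vge_mono: "vge k x \<Longrightarrow> l \<le> k \<Longrightarrow> vge l x"
  by (auto simp: vge_def)

lemma vge_mult: "vge k x \<Longrightarrow> vge l y \<Longrightarrow> vge (k + l) (x * y)"
  by (cases "x = 0 \<or> y = 0") (auto simp: vge_def v_mult)

lemma vge_add: "vge k x \<Longrightarrow> vge k y \<Longrightarrow> vge k (x + y)"
  by (cases "x = 0 \<or> y = 0 \<or> x + y = 0") (use v_add[of x y] in \<open>auto simp: vge_def\<close>)

lemma vge_uminus: "vge k x \<Longrightarrow> vge k (-x)"
  using vge_mult[of 0 "-1" k x] by (simp add: vge_def v_minus_one)

lemma vge_diff: "vge k x \<Longrightarrow> vge k y \<Longrightarrow> vge k (x - y)"
  using vge_add[of k x "-y"] vge_uminus[of k y] by simp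

lemma vge_sum: "(\<And>i. i \<in> S \<Longrightarrow> vge k (g i)) \<Longrightarrow> vge k (sum g S)"
  by (induction S rule: infinite_finite_induct) (auto intro: vge_add)

lemma vge_of_square: "vge k (x\<^sup>2) \<Longrightarrow> 2 * l \<le> k + 1 \<Longrightarrow> vge l x"
  by (cases "x = 0") (auto simp: vge_def v_square)

lemma vge_poly_coeff: "vge_poly k p \<Longrightarrow> vge k (coeff p i)"
  by (simp add: vge_poly_def)

lemma vge_poly_mono: "vge_poly k p \<Longrightarrow> l \<le> k \<Longrightarrow> vge_poly l p"
  by (auto simp: vge_poly_def intro: vge_mono)

lemma vge_poly_add: "vge_poly k p \<Longrightarrow> vge_poly k r \<Longrightarrow> vge_poly k (p + r)"
  by (simp add: vge_poly_def vge_add)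

lemma vge_poly_diff: "vge_poly k p \<Longrightarrow> vge_poly k r \<Longrightarrow> vge_poly k (p - r)"
  by (simp add: vge_poly_def vge_diff)

lemma vge_poly_mult: "vge_poly k p \<Longrightarrow> vge_poly l r \<Longrightarrow> vge_poly (k + l) (p * r)"
  by (simp add: vge_poly_def coeff_mult vge_sum vge_mult)

lemma vge_poly_const: "vge k c \<Longrightarrow> vge_poly k [:c:]"
  by (simp add: vge_poly_def coeff_pCons split: nat.split)

lemma vge_poly_pCons: "vge k c \<Longrightarrow> vge_poly k p \<Longrightarrow> vge_poly k (pCons c p)"
  by (simp add: vge_poly_def coeff_pCons split: nat.split)

lemma vge_poly_smult: "vge k c \<Longrightarrow> vge_poly l p \<Longrightarrow> vge_poly (k + l) (smult c p)"
  by (simp add: vge_poly_def vge_mult)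

lemma vge_poly_pcompose:
  "vge_poly 0 p \<Longrightarrow> vge_poly 0 r \<Longrightarrow> vge_poly 0 (pcompose p r)"
proof (induction p)
  case 0 thus ?case by simp
next
  case (pCons a p)
  have "vge 0 a" using vge_poly_coeff[OF pCons.prems(1), of 0] by simp
  moreover have "vge_poly 0 p"
    using vge_poly_coeff[OF pCons.prems(1), of "Suc _"] by (simp add: vge_poly_def)
  ultimately show ?case
    using vge_poly_mult[of 0 r 0 "pcompose p r"] pCons
    by (simp add: pcompose_pCons vge_poly_add vge_poly_const vge_poly_pCons del: add_pCons)
qed

end

lemma sum_symmetric_even:
  fixes g :: "nat \<Rightarrow> 'b::comm_ring_1"
  assumes "\<And>i. i \<le> 2 * l \<Longrightarrow> g (2 * l - i) = g i"
  shows "sum g {..2 * l} = g l + 2 * sum g {..<l}"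
proof -
  have "sum g {..2 * l} = sum g ({..l} \<union> {l<..2 * l})"
    by (rule arg_cong[of _ _ "sum g"]) auto
  also have "\<dots> = sum g {..l} + sum g {l<..2 * l}"
    by (rule sum.union_disjoint) auto
  also have "sum g {..l} = sum g {..<l} + g l"
    by (simp add: lessThan_Suc_atMost[symmetric])
  also have "sum g {l<..2 * l} = sum g {..<l}"
    by (rule sum.reindex_bij_witness[of _ "\<lambda>i. 2 * l - i" "\<lambda>i. 2 * l - i"]) (use assms in auto)
  finally show ?thesis by simp
qed

lemma sum_symmetric_odd:
  fixes g :: "nat \<Rightarrow> 'b::comm_ring_1"
  assumes "\<And>i. i \<le> 2 * l + 1 \<Longrightarrow> g (2 * l + 1 - i) = g i"
  shows "sum g {..2 * l + 1} = 2 * sum g {..l}"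
proof -
  have "sum g {..2 * l + 1} = sum g ({..l} \<union> {l<..2 * l + 1})"
    by (rule arg_cong[of _ _ "sum g"]) auto
  also have "\<dots> = sum g {..l} + sum g {l<..2 * l + 1}"
    by (rule sum.union_disjoint) auto
  also have "sum g {l<..2 * l + 1} = sum g {..l}"
    by (rule sum.reindex_bij_witness[of _ "\<lambda>i. 2 * l + 1 - i" "\<lambda>i. 2 * l + 1 - i"])
       (use assms in auto)
  finally show ?thesis by simp
qed

lemma smult_2: "smult 2 p = p + (p :: 'a::comm_ring_1 poly)"
  by (metis one_add_one smult_1_left smult_add_left)

context discrete_valuation begin

text \<open>Squaring is additive modulo 2: in a coefficient of $p^2$ the products of coefficients of $p$ pair
  up, except for the square in the middle, which exists for even indices only.\<close>

lemma square_coeff_even: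
  assumes "vge_poly j p"
  shows "vge (v 2 + 2 * j) (coeff (p\<^sup>2) (2 * l) - (coeff p l)\<^sup>2)"
proof -
  let ?g = "\<lambda>i. coeff p i * coeff p (2 * l - i)"
  have "coeff (p\<^sup>2) (2 * l) = sum ?g {..2 * l}"
    by (simp add: power2_eq_square coeff_mult)
  also have "\<dots> = ?g l + 2 * sum ?g {..<l}"
    by (rule sum_symmetric_even) simp
  finally have "coeff (p\<^sup>2) (2 * l) - (coeff p l)\<^sup>2 = 2 * sum ?g {..<l}"
    by (simp add: power2_eq_square)
  moreover have "vge (j + j) (sum ?g {..<l})"
    using assms by (intro vge_sum vge_mult) (auto simp: vge_poly_def)
  hence "vge (v 2 + (j + j)) (2 * sum ?g {..<l})"
    by (intro vge_mult) (simp_all add: vge_def)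
  ultimately show ?thesis by simp
qed

lemma square_coeff_odd:
  assumes "vge_poly j p"
  shows "vge (v 2 + 2 * j) (coeff (p\<^sup>2) (2 * l + 1))"
proof -
  let ?g = "\<lambda>i. coeff p i * coeff p (2 * l + 1 - i)"
  have "coeff (p\<^sup>2) (2 * l + 1) = sum ?g {..2 * l + 1}"
    by (simp only: power2_eq_square coeff_mult)
  also have "\<dots> = 2 * sum ?g {..l}"
    by (rule sum_symmetric_odd) simp
  finally have "coeff (p\<^sup>2) (2 * l + 1) = 2 * sum ?g {..l}" .
  moreover have "vge (j + j) (sum ?g {..l})"
    using assms by (intro vge_sum vge_mult) (auto simp: vge_poly_def)
  hence "vge (v 2 + (j + j)) (2 * sum ?g {..l})"
    by (intro vge_mult) (simp_all add: vge_def)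
  ultimately show ?thesis by simp
qed

lemma vge_poly_exists: "\<exists>j. vge_poly j p"
proof -
  let ?S = "insert 0 ((\<lambda>i. v (coeff p i)) ` {..degree p})"
  have "vge (Min ?S) (coeff p i)" for i
  proof (cases "i \<le> degree p")
    case True
    hence "Min ?S \<le> v (coeff p i)" by (intro Min_le) auto
    thus ?thesis by (simp add: vge_def)
  next
    case False thus ?thesis by (simp add: coeff_eq_0)
  qed
  thus ?thesis by (auto simp: vge_poly_def)
qed

text \<open>Gauss's lemma for $p^2 - y r^2$, the norm of $p + r \<surd>y$.  If the lowest valuation occurring in
  $p$ and $r$ were negative, the squares of the coefficients of $p$ (in even degree) and of $r$ (in
  odd degree) would survive in $p^2 - y r^2$, because these degrees have different parity and all
  other terms carry a factor 2.\<close>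

lemma norm_form_integral:
  assumes e: "v 2 > 0" and P: "vge_poly 0 (p\<^sup>2 - [:0, 1:] * r\<^sup>2)"
  shows "vge_poly 0 p \<and> vge_poly 0 r"
proof -
  obtain j1 j2 where "vge_poly j1 p" "vge_poly j2 r" using vge_poly_exists by meson
  hence start: "vge_poly (- int (nat (- min j1 j2))) p" "vge_poly (- int (nat (- min j1 j2))) r"
    by (auto elim!: vge_poly_mono)
  \<comment> \<open>Induction on a common pole order \<open>k\<close> of the two polynomials.\<close>
  have "vge_poly (- int k) p \<Longrightarrow> vge_poly (- int k) r \<Longrightarrow> ?thesis" for k
  proof (induction k)
    case 0 thus ?case by simp
  next
    case (Suc k)
    let ?j = "- int (Suc k)"
    have low: "2 * ?j + 1 \<le> v 2 + 2 * ?j" using e by simp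
    have Pj: "vge (2 * ?j + 1) (coeff (p\<^sup>2 - [:0, 1:] * r\<^sup>2) i)" for i
      using vge_poly_coeff[OF P] by (rule vge_mono) simp
    have "vge (?j + 1) (coeff p l)" for l
    proof -
      have 1: "vge (v 2 + 2 * ?j) (coeff ([:0, 1:] * r\<^sup>2) (2 * l))"
      proof (cases l)
        case (Suc l')
        thus ?thesis using square_coeff_odd[OF Suc.prems(2), of l'] by simp
      qed simp
      have 2: "vge (v 2 + 2 * ?j) (coeff (p\<^sup>2) (2 * l) - (coeff p l)\<^sup>2)"
        by (rule square_coeff_even[OF Suc.prems(1)])
      from vge_diff[OF vge_add[OF Pj[of "2 * l"] vge_mono[OF 1 low]] vge_mono[OF 2 low]]
      have "vge (2 * ?j + 1) ((coeff p l)\<^sup>2)" by simp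
      thus ?thesis by (rule vge_of_square) simp
    qed
    moreover have "vge (?j + 1) (coeff r l)" for l
    proof -
      have 1: "vge (v 2 + 2 * ?j) (coeff (p\<^sup>2) (2 * l + 1))"
        by (rule square_coeff_odd[OF Suc.prems(1)])
      have 2: "vge (v 2 + 2 * ?j) (coeff (r\<^sup>2) (2 * l) - (coeff r l)\<^sup>2)"
        by (rule square_coeff_even[OF Suc.prems(2)])
      from vge_diff[OF vge_diff[OF vge_mono[OF 1 low] Pj[of "2 * l + 1"]] vge_mono[OF 2 low]]
      have "vge (2 * ?j + 1) ((coeff r l)\<^sup>2)" by simp
      thus ?thesis by (rule vge_of_square) simp
    qed
    ultimately show ?case
      by (intro Suc.IH) (auto simp: vge_poly_def)
  qed
  thus ?thesis using start by blast
qed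

text \<open>The heart of the irreducibility proof.  Put $e = v(2) = 2a + 1$ and $d = p - h$, so that
  $d^2 + 2hd = y r^2 + u$.  In odd degree the left-hand side vanishes modulo 2, so the squares of the
  coefficients of $r$ do too, and as $e$ is odd this gains half a step: $v(r) \<ge> a + 1$.  Then
  $d^2 + 2hd \<equiv> u$ modulo valuation $e + 1$.  The even degrees show in the same way that all
  coefficients of $d$ but the constant one, $d_0$, have valuation at least $a + 1$, and that $d_0$ is
  a unit.  What remains modulo valuation $e + 1$ is $d_0^2 + 2 d_0 h \<equiv> u$, which is impossible in the
  leading coefficient of $h$, because $v(2 d_0) = e$.\<close>

lemma no_norm_form_square_plus_unit:
  assumes e: "v 2 > 0" "odd (v 2)"
    and u: "u \<noteq> 0" "v u = 0"
    and h: "vge_poly 0 h" "lead_coeff h = 1" "degree h > 0"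
  shows "h\<^sup>2 + [:u:] \<noteq> p\<^sup>2 - [:0, 1:] * r\<^sup>2"
proof
  assume eq: "h\<^sup>2 + [:u:] = p\<^sup>2 - [:0, 1:] * r\<^sup>2"
  define e where "e = v 2"
  obtain a where a: "e = 2 * a + 1" using e by (auto simp: e_def elim: oddE)
  have a0: "a \<ge> 0" using a e by (simp add: e_def)
  have vge2: "vge e 2" by (simp add: vge_def e_def)
  have "vge_poly 0 (p\<^sup>2 - [:0, 1:] * r\<^sup>2)"
    using vge_poly_mult[OF h(1) h(1)] u unfolding eq[symmetric]
    by (auto simp: power2_eq_square vge_def intro!: vge_poly_add vge_poly_const)
  from norm_form_integral[OF _ this] e
  have int: "vge_poly 0 p" "vge_poly 0 r" by auto
  define d where "d = p - h"
  have d_int: "vge_poly 0 d" unfolding d_def by (intro vge_poly_diff int h)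
  have eq': "d\<^sup>2 + smult 2 (h * d) = [:0, 1:] * r\<^sup>2 + [:u:]"
    using eq unfolding d_def smult_2
    by (simp add: algebra_simps power2_eq_square del: mult_pCons_left mult_pCons_right add_pCons)
  have hd: "vge_poly e (smult 2 (h * d))"
    using vge_poly_smult[OF vge2 vge_poly_mult[OF h(1) d_int]] by simp
  \<comment> \<open>Odd degrees improve the lower bound for the valuation of \<open>r\<close> one by one, up to \<open>a + 1\<close>.\<close>
  have r_step: "vge_poly (int k + 1) r" if "vge_poly (int k) r" "2 * int k < e" for k
  proof -
    have "vge (int k + 1) (coeff r l)" for l
    proof -
      have low: "2 * int k + 1 \<le> e" using that(2) by simp
      have 1: "vge e (coeff (d\<^sup>2) (2 * l + 1))"
        using square_coeff_odd[OF d_int, of l] by (simp add: e_def)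
      have 2: "vge (2 * int k + 1) (coeff (r\<^sup>2) (2 * l) - (coeff r l)\<^sup>2)"
        using square_coeff_even[OF that(1), of l] by (rule vge_mono) (use e in simp)
      have "vge (2 * int k + 1)
          ((coeff (d\<^sup>2) (2 * l + 1) + coeff (smult 2 (h * d)) (2 * l + 1))
            - (coeff (r\<^sup>2) (2 * l) - (coeff r l)\<^sup>2))"
        by (rule vge_diff[OF vge_add[OF vge_mono[OF 1 low] vge_mono[OF vge_poly_coeff[OF hd] low]] 2])
      also have "coeff (d\<^sup>2) (2 * l + 1) + coeff (smult 2 (h * d)) (2 * l + 1) = coeff (r\<^sup>2) (2 * l)"
        using arg_cong[OF eq', of "\<lambda>s. coeff s (2 * l + 1)"] by simp
      finally have "vge (2 * int k + 1) ((coeff r l)\<^sup>2)" by simp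
      thus ?thesis by (rule vge_of_square) simp
    qed
    thus ?thesis by (simp add: vge_poly_def)
  qed
  have "k \<le> nat (a + 1) \<Longrightarrow> vge_poly (int k) r" for k
  proof (induction k)
    case (Suc k) thus ?case using r_step[of k] a by (auto simp: add.commute[of _ 1])
  qed (use int in simp)
  from this[of "nat (a + 1)"] have r_high: "vge_poly (a + 1) r" using a0 by simp
  have yr: "vge_poly (e + 1) ([:0, 1:] * r\<^sup>2)"
    using vge_poly_pCons[OF vge_0 vge_poly_mult[OF r_high r_high]] a
    by (simp add: power2_eq_square add.commute)
  have d_sq: "vge e (coeff (d\<^sup>2) (2 * l) - (coeff d l)\<^sup>2)" for l
    using square_coeff_even[OF d_int, of l] by (simp add: e_def)
  define d0 where "d0 = coeff d 0"
  define d1 where "d1 = d - [:d0:]"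
  have d_split: "d = [:d0:] + d1" by (simp add: d1_def)
  have d0: "d0 \<noteq> 0" "v d0 = 0"
  proof -
    have "vge e (coeff ([:0, 1:] * r\<^sup>2) 0 - coeff (smult 2 (h * d)) 0 - (coeff (d\<^sup>2) 0 - (coeff d 0)\<^sup>2))"
      by (rule vge_diff[OF vge_diff[OF vge_poly_coeff[OF vge_poly_mono[OF yr]] vge_poly_coeff[OF hd]] d_sq[of 0, simplified]]) simp
    also have "coeff ([:0, 1:] * r\<^sup>2) 0 - coeff (smult 2 (h * d)) 0 - (coeff (d\<^sup>2) 0 - (coeff d 0)\<^sup>2)
        = d0\<^sup>2 - u"
      using arg_cong[OF eq', of "\<lambda>s. coeff s 0"]
      by (simp add: d0_def eq_neg_iff_add_eq_0 algebra_simps)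
    finally have du: "vge 1 (d0\<^sup>2 - u)" by (rule vge_mono) (use e in \<open>simp add: e_def\<close>)
    have nu: "\<not> vge 1 u" using u by (simp add: vge_def)
    have "\<not> vge 1 (d0\<^sup>2)" using vge_diff[OF _ du, of "d0\<^sup>2"] nu by auto
    hence "\<not> vge 1 d0" using vge_mult[of 1 d0 0 d0] vge_poly_coeff[OF d_int, of 0]
      by (simp add: power2_eq_square d0_def) blast
    thus "d0 \<noteq> 0" "v d0 = 0"
      using vge_poly_coeff[OF d_int, of 0] by (auto simp: vge_def d0_def)
  qed
  have d1: "vge_poly (a + 1) d1"
  proof -
    have "vge (a + 1) (coeff d1 l)" for l
    proof (cases "l = 0")
      case True thus ?thesis by (simp add: d1_def d0_def)
    next
      case False
      have "vge e (coeff ([:0, 1:] * r\<^sup>2) (2 * l) - coeff (smult 2 (h * d)) (2 * l)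
          - (coeff (d\<^sup>2) (2 * l) - (coeff d l)\<^sup>2))"
        by (rule vge_diff[OF vge_diff[OF vge_poly_coeff[OF vge_poly_mono[OF yr]] vge_poly_coeff[OF hd]] d_sq]) simp
      also have "coeff ([:0, 1:] * r\<^sup>2) (2 * l) - coeff (smult 2 (h * d)) (2 * l)
          - (coeff (d\<^sup>2) (2 * l) - (coeff d l)\<^sup>2) = (coeff d l)\<^sup>2"
        using arg_cong[OF eq', of "\<lambda>s. coeff s (2 * l)"] False
        by (cases "2 * l") (simp_all add: algebra_simps eq_neg_iff_add_eq_0)
      finally have "vge (a + 1) (coeff d l)" by (rule vge_of_square) (use a in simp)
      thus ?thesis using False by (cases l) (simp_all add: d1_def)
    qed
    thus ?thesis by (simp add: vge_poly_def)
  qed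
  have "vge_poly (e + 1) (smult (2 * d0) d1)"
    by (rule vge_poly_mono[OF vge_poly_smult[OF vge_mult[OF vge2, of 0 d0] d1]])
       (use d0 a0 in \<open>simp_all add: vge_def\<close>)
  moreover have "vge_poly (e + 1) (d1\<^sup>2)"
    by (rule vge_poly_mono[OF vge_poly_mult[OF d1 d1, folded power2_eq_square]]) (use a in simp)
  moreover have "vge_poly (e + 1) (smult 2 (h * d1))"
    by (rule vge_poly_mono[OF vge_poly_smult[OF vge2 vge_poly_mult[OF h(1) d1]]]) (use a0 in simp)
  ultimately have "vge_poly (e + 1)
      ([:0, 1:] * r\<^sup>2 - (smult (2 * d0) d1 + d1\<^sup>2 + smult 2 (h * d1)))"
    by (intro vge_poly_add vge_poly_diff yr)
  also have "[:0, 1:] * r\<^sup>2 - (smult (2 * d0) d1 + d1\<^sup>2 + smult 2 (h * d1))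
      = [:d0\<^sup>2 - u:] + smult (2 * d0) h"
  proof -
    have c: "[:d0:] * s = smult d0 s" for s by simp
    have c2: "smult (2 * d0) s = smult d0 s + smult d0 s" for s
      by (simp add: smult_add_left[symmetric])
    note c3 = smult_2
    have "[:0, 1:] * r\<^sup>2 = d\<^sup>2 + smult 2 (h * d) - [:u:]"
      using eq' by (simp add: algebra_simps)
    also have "d\<^sup>2 = [:d0:] * [:d0:] + ([:d0:] * d1 + [:d0:] * d1) + d1\<^sup>2"
      unfolding d_split power2_eq_square by (simp only: algebra_simps)
    also have "\<dots> = [:d0\<^sup>2:] + smult (2 * d0) d1 + d1\<^sup>2"
      by (simp only: c c2) (simp add: power2_eq_square)
    also have "h * d = smult d0 h + h * d1"
      unfolding d_split by (simp only: distrib_left mult.commute[of h "[:d0:]"] c)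
    finally have yr2: "[:0, 1:] * r\<^sup>2 = [:d0\<^sup>2:] + smult (2 * d0) d1 + d1\<^sup>2
        + smult 2 (smult d0 h + h * d1) - [:u:]" .
    have du: "[:d0\<^sup>2 - u:] = [:d0\<^sup>2:] - [:u:]" by simp
    show ?thesis unfolding yr2 du c2 c3 by (simp only: algebra_simps)
  qed
  finally have "vge (e + 1) (coeff ([:d0\<^sup>2 - u:] + smult (2 * d0) h) (degree h))"
    by (rule vge_poly_coeff)
  hence "vge (e + 1) (2 * d0)" using h by (simp add: coeff_pCons split: nat.splits)
  thus False using d0 by (simp add: vge_def v_mult e_def)
qed

end

lemma even_odd_parts:
  fixes g :: "'a::comm_ring_1 poly"
  shows "\<exists>p r. g = pcompose p [:0, 0, 1:] + [:0, 1:] * pcompose r [:0, 0, 1:]"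
proof (induction g)
  case 0 show ?case by (rule exI[of _ 0], rule exI[of _ 0]) simp
next
  case (pCons c g)
  then obtain p r where *: "g = pcompose p [:0, 0, 1:] + [:0, 1:] * pcompose r [:0, 0, 1:]" by blast
  have "pCons c g = pcompose (pCons c r) [:0, 0, 1:] + [:0, 1:] * pcompose p [:0, 0, 1:]"
    by (subst *) (simp add: pcompose_pCons algebra_simps)
  thus ?case by blast
qed

lemma irreducible_field_polyI:
  fixes p :: "'a::field poly"
  assumes "degree p > 0" "\<And>a b. p = a * b \<Longrightarrow> degree a > 0 \<Longrightarrow> degree b > 0 \<Longrightarrow> False"
  shows "Factorial_Ring.irreducible p"
proof (rule Factorial_Ring.irreducibleI)
  show "p \<noteq> 0" "\<not> p dvd 1" using assms(1) by (auto simp: is_unit_poly_iff)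
next
  fix a b assume ab: "p = a * b"
  hence "a \<noteq> 0" "b \<noteq> 0" using assms(1) by auto
  thus "a dvd 1 \<or> b dvd 1" using assms(2)[OF ab] by (auto simp: is_unit_iff_degree)
qed

text \<open>If $g(x) = p(x^2) + x r(x^2)$ is a proper factor of $P(x^2)$, then $g(x) g(-x) = N(x^2)$ with
  $N = p^2 - y r^2$.  The polynomials $q$ for which $g(x)$ divides $q(x^2)$ form a proper ideal
  containing $P$ and $N$, so the irreducible $P$ divides $N$; comparing degrees and leading
  coefficients gives $P = N$ if $g$ is chosen monic of degree at most \<open>degree P\<close>.\<close>

lemma norm_form_of_reducible:
  fixes P :: "'a::field poly"
  assumes irr: "Factorial_Ring.irreducible P" and lc: "lead_coeff P = 1" and ev: "even (degree P)"
    and red: "\<not> Factorial_Ring.irreducible (pcompose P [:0, 0, 1:])"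
  shows "\<exists>p r. P = p\<^sup>2 - [:0, 1:] * r\<^sup>2"
proof -
  let ?X2 = "[:0, 0, 1:] :: 'a poly"
  have P0: "P \<noteq> 0" "degree P > 0"
    using irr by (auto simp: is_unit_iff_degree Factorial_Ring.irreducible_def)
  have degP: "degree (pcompose P ?X2) = 2 * degree P" by (simp add: degree_pcompose)
  obtain g1 g2 where g12: "pcompose P ?X2 = g1 * g2" "degree g1 > 0" "degree g2 > 0"
    using red irreducible_field_polyI[of "pcompose P ?X2"] degP P0 by auto
  have "degree g1 + degree g2 = 2 * degree P"
    using g12 degP degree_mult_eq[of g1 g2] by fastforce
  then obtain g' where g': "g' dvd pcompose P ?X2" "degree g' > 0" "degree g' \<le> degree P"
    using g12 that[of g1] that[of g2] by (cases "degree g1 \<le> degree P") auto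
  define g where "g = smult (inverse (lead_coeff g')) g'"
  have "g' \<noteq> 0" using g' by auto
  hence g: "g dvd pcompose P ?X2" "degree g > 0" "degree g \<le> degree P" "lead_coeff g = 1"
    using g' by (auto simp: g_def smult_dvd)
  obtain p r where pr: "g = pcompose p ?X2 + [:0, 1:] * pcompose r ?X2"
    using even_odd_parts by blast
  define N where "N = p\<^sup>2 - [:0, 1:] * r\<^sup>2"
  define g_neg where "g_neg = pcompose g [:0, -1:]"
  have "g_neg = pcompose p ?X2 - [:0, 1:] * pcompose r ?X2"
    unfolding g_neg_def pr pcompose_add pcompose_mult pcompose_assoc[symmetric]
    by (simp add: pcompose_pCons)
  moreover have "pcompose N ?X2 = (pcompose p ?X2)\<^sup>2 - ([:0, 1:] * pcompose r ?X2)\<^sup>2"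
    by (simp add: N_def pcompose_diff pcompose_mult power2_eq_square pcompose_pCons)
  ultimately have N: "pcompose N ?X2 = g * g_neg"
    unfolding pr by (simp only: power2_eq_square) (simp only: algebra_simps)
  \<comment> \<open>A generator \<open>q\<close> of this ideal is an element of least degree.\<close>
  define I where "I = {q. g dvd pcompose q ?X2}"
  have I_diff: "a - b \<in> I" if "a \<in> I" "b \<in> I" for a b
    using that by (auto simp: I_def pcompose_diff)
  have I_mult: "a * b \<in> I" if "a \<in> I" for a b
    using that by (auto simp: I_def pcompose_mult)
  have PI: "P \<in> I" using g by (simp add: I_def)
  have NI: "N \<in> I" by (simp add: I_def N)
  define q where "q = arg_min degree (\<lambda>q. q \<in> I \<and> q \<noteq> 0)"
  have q: "q \<in> I" "q \<noteq> 0" and q_min: "\<And>s. s \<in> I \<Longrightarrow> s \<noteq> 0 \<Longrightarrow> degree q \<le> degree s"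
    using arg_min_natI[of "\<lambda>q. q \<in> I \<and> q \<noteq> 0" P degree] PI P0
      arg_min_nat_le[of "\<lambda>q. q \<in> I \<and> q \<noteq> 0" _ degree] unfolding q_def by auto
  have q_dvd: "q dvd s" if "s \<in> I" for s
  proof -
    have "s mod q = s - q * (s div q)" by (simp add: minus_mult_div_eq_mod)
    hence "s mod q \<in> I" using I_diff I_mult q that by simp
    hence "s mod q = 0" using q_min[of "s mod q"] degree_mod_less[OF q(2), of s] by fastforce
    thus ?thesis by (simp add: dvd_eq_mod_eq_0)
  qed
  have "\<not> is_unit q"
  proof
    assume "is_unit q"
    then obtain c where "q = [:c:]" by (auto simp: is_unit_poly_iff)
    hence "c \<noteq> 0" using q by auto
    have "g dvd [:c:]" using q \<open>q = [:c:]\<close> by (simp add: I_def)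
    thus False using g \<open>c \<noteq> 0\<close> dvd_imp_degree_le[of g "[:c:]"] by simp
  qed
  hence "P dvd q" using irr q_dvd[OF PI] by (metis irreducible_altdef)
  hence "P dvd N" using q_dvd[OF NI] dvd_trans by blast
  then obtain c where c: "N = P * c" by blast
  have "g \<noteq> 0" using g by auto
  have dneg: "degree g_neg = degree g" by (simp add: g_neg_def degree_pcompose)
  hence "g_neg \<noteq> 0" using g by auto
  hence "degree (pcompose N ?X2) = 2 * degree g" using N dneg \<open>g \<noteq> 0\<close> by (simp add: degree_mult_eq)
  hence degN: "degree N = degree g" by (simp add: degree_pcompose)
  have "N \<noteq> 0" using degN g by auto
  hence "degree N = degree P + degree c" using c by (auto simp: degree_mult_eq)
  hence "degree c = 0" and gP: "degree g = degree P" using degN g by auto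
  then obtain c0 where c0: "c = [:c0:]" by (meson degree_eq_zeroE)
  have "lead_coeff (pcompose N ?X2) = lead_coeff N"
    by (subst lead_coeff_comp) simp_all
  moreover have "lead_coeff g_neg = 1"
    unfolding g_neg_def using g(4) gP ev by (subst lead_coeff_comp) simp_all
  ultimately have "lead_coeff N = 1"
    using N g(4) by (simp add: lead_coeff_mult)
  hence "c0 = 1" using c c0 lc \<open>N \<noteq> 0\<close> by (cases "c0 = 0") auto
  hence "N = P" using c c0 by simp
  thus ?thesis unfolding N_def by metis
qed

lemma irreducible_pcompose_shift:
  fixes p :: "'a::field poly"
  assumes "Factorial_Ring.irreducible p"
  shows "Factorial_Ring.irreducible (pcompose p [:c, 1:])"
proof (rule irreducible_field_polyI)
  have dp: "degree p > 0"
    using assms by (auto simp: is_unit_iff_degree Factorial_Ring.irreducible_def)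
  thus "degree (pcompose p [:c, 1:]) > 0" by (simp add: degree_pcompose)
  fix a b assume ab: "pcompose p [:c, 1:] = a * b" "degree a > 0" "degree b > 0"
  have "p = pcompose (pcompose p [:c, 1:]) [:- c, 1:]"
    by (simp add: pcompose_assoc[symmetric] pcompose_pCons)
  also have "\<dots> = pcompose a [:- c, 1:] * pcompose b [:- c, 1:]"
    by (simp add: ab pcompose_mult)
  finally have "pcompose a [:- c, 1:] dvd 1 \<or> pcompose b [:- c, 1:] dvd 1"
    by (rule Factorial_Ring.irreducibleD[OF assms])
  hence "degree (pcompose a [:- c, 1:]) = 0 \<or> degree (pcompose b [:- c, 1:]) = 0"
    by (auto simp: is_unit_poly_iff)
  thus False using ab by (simp add: degree_pcompose)
qed

section \<open>Irreducibility of shifted iterates\<close>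

lemma poly_iterate_0 [simp]: "poly_iterate g 0 = [:0, 1:]"
  by (simp add: poly_iterate_def)

lemma poly_iterate_Suc: "poly_iterate g (Suc k) = pcompose g (poly_iterate g k)"
  by (simp add: poly_iterate_def)

lemma poly_iterate_add:
  "poly_iterate g (i + j) = pcompose (poly_iterate g i) (poly_iterate g j)"
  by (induction i) (simp_all add: poly_iterate_Suc pcompose_assoc pcompose_pCons)

abbreviation quad_iter :: "'a::comm_ring_1 \<Rightarrow> nat \<Rightarrow> 'a poly" where
  "quad_iter m \<equiv> poly_iterate [:m, 0, 1:]"

lemma quad_iter_Suc: "quad_iter m (Suc k) = (quad_iter m k)\<^sup>2 + [:m:]"
  by (simp add: poly_iterate_Suc pcompose_pCons power2_eq_square)

lemma quad_iter_Suc_inner: "quad_iter m (Suc k) = pcompose (quad_iter m k) [:m, 0, 1:]"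
  using poly_iterate_add[of "[:m, 0, 1:]" k 1]
  by (simp add: poly_iterate_def)

lemma degree_lead_quad_iter:
  "degree (quad_iter m k) = 2 ^ k \<and> lead_coeff (quad_iter (m::'a::idom) k) = 1"
proof (induction k)
  case (Suc k)
  have "degree (quad_iter m (Suc k)) = 2 ^ Suc k"
    using Suc unfolding quad_iter_Suc_inner by (simp add: degree_pcompose)
  moreover have "lead_coeff (quad_iter m (Suc k)) = 1"
    using Suc unfolding quad_iter_Suc_inner by (subst lead_coeff_comp) auto
  ultimately show ?case by blast
qed simp

lemma irreducible_quadratic:
  fixes u :: "'a::field"
  assumes "\<nexists>z. - u = z\<^sup>2"
  shows "Factorial_Ring.irreducible [:u, 0, 1:]"
proof (rule irreducible_field_polyI)
  fix a b assume ab: "[:u, 0, 1:] = a * b" "degree a > 0" "degree b > 0"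
  have "degree (a * b) = degree a + degree b" using ab by (intro degree_mult_eq) auto
  moreover have "degree (a * b) = 2" unfolding ab(1)[symmetric] by simp
  ultimately have "degree a = 1" using ab(2,3) by linarith
  then obtain c d where a: "a = [:c, d:]" "d \<noteq> 0" by (metis degree1_coeffs)
  have "poly [:u, 0, 1:] (- c / d) = 0" unfolding ab a by (simp add: a)
  hence "- u = (c / d)\<^sup>2" by (simp add: power2_eq_square eq_neg_iff_add_eq_0 neg_eq_iff_add_eq_0)
  thus False using assms by blast
qed simp

text \<open>Induction on the number of iterations.  With $f_0 = x^2 + m$ and
  $P(y) = f_0^{i+1}(y + m) + \<gamma>$, the polynomial $f_0^{i+2} + \<gamma>$ is $P(x^2)$.  Here $P$ is a
  translate of the previous polynomial, and $P = h^2 + u$ for $h(y) = f_0^i(y + m)$; so a factorization of $P(x^2)$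
  would make $h^2 + u$ a norm form.\<close>

theorem (in discrete_valuation) irreducible_quad_iter_plus:
  assumes e: "v 2 > 0" "odd (v 2)"
    and m: "vge 0 m" and u: "u \<noteq> 0" "v u = 0" "u = m + \<gamma>" and ns: "\<nexists>z. - u = z\<^sup>2"
  shows "Factorial_Ring.irreducible (quad_iter m (Suc i) + [:\<gamma>:])"
proof (induction i)
  case 0
  show ?case using irreducible_quadratic[OF ns] u by (simp add: poly_iterate_Suc add.commute pcompose_pCons)
next
  case (Suc i)
  let ?X2 = "[:0, 0, 1:] :: 'a poly"
  define h where "h = pcompose (quad_iter m i) [:m, 1:]"
  define P where "P = pcompose (quad_iter m (Suc i) + [:\<gamma>:]) [:m, 1:]"
  have Ph: "P = h\<^sup>2 + [:u:]"
    by (simp add: P_def h_def quad_iter_Suc pcompose_add power2_eq_square pcompose_mult u)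
  have hdeg: "degree h = 2 ^ i" "lead_coeff h = 1"
    using degree_lead_quad_iter[of m i] unfolding h_def
    by (simp add: degree_pcompose, subst lead_coeff_comp) auto
  have "vge_poly 0 (quad_iter m i)" for i
  proof (induction i)
    case 0 show ?case
      by (auto simp: vge_def v_one vge_poly_def coeff_pCons split: nat.split)
  next
    case (Suc i)
    show ?case using vge_poly_mult[OF Suc Suc] m unfolding quad_iter_Suc
      by (intro vge_poly_add vge_poly_const) (simp_all add: power2_eq_square)
  qed
  hence hint: "vge_poly 0 h" unfolding h_def
    by (intro vge_poly_pcompose vge_poly_pCons m) (auto simp: vge_def v_one vge_poly_def coeff_pCons split: nat.split)
  have Pirr: "Factorial_Ring.irreducible P"
    unfolding P_def by (rule irreducible_pcompose_shift[OF Suc.IH])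
  have "degree (quad_iter m (Suc i) + [:\<gamma>:]) = 2 ^ Suc i"
    using degree_lead_quad_iter[of m "Suc i"] by (subst degree_add_eq_left) auto
  hence Pdeg: "degree P = 2 ^ Suc i" by (simp add: P_def degree_pcompose)
  have "coeff (quad_iter m (Suc i) + [:\<gamma>:]) (2 ^ Suc i) = 1"
    using degree_lead_quad_iter[of m "Suc i"] by (auto simp: coeff_pCons split: nat.split)
  hence Plc: "lead_coeff P = 1"
    unfolding P_def using \<open>degree (quad_iter m (Suc i) + [:\<gamma>:]) = 2 ^ Suc i\<close>
    by (subst lead_coeff_comp) auto
  have eq: "quad_iter m (Suc (Suc i)) + [:\<gamma>:] = pcompose P ?X2"
    unfolding P_def pcompose_assoc[symmetric] pcompose_add
    by (subst quad_iter_Suc_inner) (simp add: pcompose_pCons)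
  show ?case
  proof (rule ccontr)
    assume "\<not> ?case"
    hence "\<not> Factorial_Ring.irreducible (pcompose P ?X2)" unfolding eq .
    then obtain p r where "P = p\<^sup>2 - [:0, 1:] * r\<^sup>2"
      using norm_form_of_reducible[OF Pirr Plc] Pdeg by auto
    thus False
      using no_norm_form_square_plus_unit[OF e u(1,2) hint hdeg(2)] hdeg(1) Ph by auto
  qed
qed

section \<open>Finiteness of residue rings\<close>

locale comm_subring =
  fixes A :: "'b::comm_ring_1 set"
  assumes one_closed: "1 \<in> A"
    and diff_closed: "x \<in> A \<Longrightarrow> y \<in> A \<Longrightarrow> x - y \<in> A"
    and mult_closed: "x \<in> A \<Longrightarrow> y \<in> A \<Longrightarrow> x * y \<in> A"
begin

lemma zero_closed: "0 \<in> A"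
  using diff_closed[OF one_closed one_closed] by simp

lemma uminus_closed: "x \<in> A \<Longrightarrow> - x \<in> A"
  using diff_closed[OF zero_closed] by fastforce

lemma add_closed: "x \<in> A \<Longrightarrow> y \<in> A \<Longrightarrow> x + y \<in> A"
  using diff_closed[of x "- y"] uminus_closed[of y] by simp

lemma sum_closed: "(\<And>i. i \<in> S \<Longrightarrow> g i \<in> A) \<Longrightarrow> sum g S \<in> A"
  by (induction S rule: infinite_finite_induct) (auto intro: zero_closed add_closed)

lemma prod_closed: "(\<And>i. i \<in> S \<Longrightarrow> g i \<in> A) \<Longrightarrow> prod g S \<in> A"
  by (induction S rule: infinite_finite_induct) (auto intro: one_closed mult_closed)

lemma power_closed: "x \<in> A \<Longrightarrow> x ^ k \<in> A"
  by (induction k) (auto intro: one_closed mult_closed)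

lemma of_nat_closed: "of_nat k \<in> A"
  by (induction k) (auto intro: zero_closed one_closed add_closed)

lemma of_int_closed: "of_int k \<in> A"
  by (cases k) (simp_all add: of_nat_closed uminus_closed add_closed one_closed diff_closed)

lemmas closed = zero_closed one_closed uminus_closed add_closed diff_closed mult_closed
  sum_closed prod_closed power_closed of_nat_closed of_int_closed

end

locale subring_ideal = comm_subring +
  fixes I :: "'b::comm_ring_1 set"
  assumes ideal_sub: "I \<subseteq> A"
    and ideal_zero: "0 \<in> I"
    and ideal_diff: "x \<in> I \<Longrightarrow> y \<in> I \<Longrightarrow> x - y \<in> I"
    and ideal_mult: "a \<in> A \<Longrightarrow> x \<in> I \<Longrightarrow> a * x \<in> I"
begin

lemma ideal_uminus: "x \<in> I \<Longrightarrow> - x \<in> I"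
  using ideal_diff[OF ideal_zero] by fastforce

lemma ideal_add: "x \<in> I \<Longrightarrow> y \<in> I \<Longrightarrow> x + y \<in> I"
  using ideal_diff[of x "- y"] ideal_uminus[of y] by simp

lemma ideal_mult_right: "a \<in> A \<Longrightarrow> x \<in> I \<Longrightarrow> x * a \<in> I"
  using ideal_mult[of a x] by (simp add: mult.commute)

lemma ideal_sum: "(\<And>i. i \<in> S \<Longrightarrow> g i \<in> I) \<Longrightarrow> sum g S \<in> I"
  by (induction S rule: infinite_finite_induct) (auto intro: ideal_zero ideal_add)

lemma ideal_in: "x \<in> I \<Longrightarrow> x \<in> A"
  using ideal_sub by blast

definition cong (infix "\<approx>" 50) where
  "x \<approx> y \<longleftrightarrow> x - y \<in> I"

lemma cong_refl [simp]: "x \<approx> x"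
  by (simp add: cong_def ideal_zero)

lemma cong_sym: "x \<approx> y \<Longrightarrow> y \<approx> x"
  using ideal_uminus[of "x - y"] by (simp add: cong_def)

lemma cong_trans [trans]: "x \<approx> y \<Longrightarrow> y \<approx> z \<Longrightarrow> x \<approx> z"
  using ideal_add[of "x - y" "y - z"] by (simp add: cong_def)

lemma cong_add: "x \<approx> y \<Longrightarrow> x' \<approx> y' \<Longrightarrow> x + x' \<approx> y + y'"
  using ideal_add[of "x - y" "x' - y'"] by (simp add: cong_def algebra_simps)

lemma cong_diff: "x \<approx> y \<Longrightarrow> x' \<approx> y' \<Longrightarrow> x - x' \<approx> y - y'"
  using ideal_diff[of "x - y" "x' - y'"] by (simp add: cong_def algebra_simps)

lemma cong_mult: "\<lbrakk>x \<approx> y; x' \<approx> y'; x \<in> A; y' \<in> A\<rbrakk> \<Longrightarrow> x * x' \<approx> y * y'"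
  using ideal_add[OF ideal_mult[of x "x' - y'"] ideal_mult[of y' "x - y"]]
  by (simp add: cong_def algebra_simps)

lemma cong_power: "\<lbrakk>x \<approx> y; x \<in> A; y \<in> A\<rbrakk> \<Longrightarrow> x ^ k \<approx> y ^ k"
  by (induction k) (auto intro!: cong_mult power_closed)

lemma cong_prod:
  "(\<And>i. i \<in> S \<Longrightarrow> g i \<approx> h i \<and> g i \<in> A \<and> h i \<in> A) \<Longrightarrow> prod g S \<approx> prod h S"
  by (induction S rule: infinite_finite_induct) (auto intro!: cong_mult prod_closed)

definition residue_system :: "'b set \<Rightarrow> bool" where
  "residue_system T \<longleftrightarrow> finite T \<and> T \<subseteq> A \<and> (\<forall>a\<in>A. \<exists>t\<in>T. a - t \<in> I) \<and>
     (\<forall>t\<in>T. \<forall>t'\<in>T. t - t' \<in> I \<longrightarrow> t = t')"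

lemma powers_recur:
  assumes "residue_system T" "\<And>k::nat. g k \<in> A"
  shows "\<exists>i j. i < j \<and> g i - g j \<in> I"
proof -
  have "\<forall>k. \<exists>t. t \<in> T \<and> g k - t \<in> I"
    using assms unfolding residue_system_def by blast
  then obtain r where r: "\<And>k. r k \<in> T" "\<And>k. g k - r k \<in> I" by metis
  have "finite (range r)"
    using r(1) assms(1) by (auto simp: residue_system_def intro: finite_subset)
  hence "\<not> inj r" using finite_imageD infinite_UNIV_nat by blast
  then obtain i j where "r i = r j" "i \<noteq> j" by (auto simp: inj_def)
  hence 1: "g i - g j \<in> I" using ideal_diff[OF r(2)[of i] r(2)[of j]] by simp
  hence "g j - g i \<in> I" using ideal_uminus by fastforce
  thus ?thesis using 1 \<open>i \<noteq> j\<close> by (metis linorder_neqE_nat)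
qed

text \<open>Linear independence over the integers modulo \<open>l\<close> of the images of \<open>B\<close> in \<open>A / I\<close>.\<close>

definition int_independent :: "nat \<Rightarrow> 'b set \<Rightarrow> bool" where
  "int_independent l B \<longleftrightarrow> finite B \<and> B \<subseteq> A \<and>
     (\<forall>c. (\<Sum>b\<in>B. of_int (c b) * b) \<in> I \<longrightarrow> (\<forall>b\<in>B. int l dvd c b))"

end

lemma common_denominator:
  fixes u :: "'b \<Rightarrow> rat"
  assumes "finite B"
  shows "\<exists>D::int. D > 0 \<and> (\<forall>b\<in>B. \<exists>k::int. of_int D * u b = of_int k)"
  using assms
proof induction
  case empty thus ?case by (auto intro: exI[of _ 1])
next
  case (insert x B)
  then obtain D where D: "D > 0" "\<forall>b\<in>B. \<exists>k::int. of_int D * u b = of_int k" by blast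
  obtain p d where pd: "quotient_of (u x) = (p, d)" by fastforce
  have d: "d > 0" "u x = of_int p / of_int d"
    using quotient_of_denom_pos[OF pd] quotient_of_div[OF pd] by auto
  have "\<exists>k::int. of_int (D * d) * u b = of_int k" if b: "b \<in> insert x B" for b
  proof (cases "b = x")
    case True
    have "of_int (D * d) * u b = of_int (D * p)" using True d by simp
    thus ?thesis by blast
  next
    case False
    then obtain k where "of_int D * u b = of_int k" using D b by blast
    hence "of_int (D * d) * u b = of_int (k * d)" by simp
    thus ?thesis by blast
  qed
  thus ?case using D d by (intro exI[of _ "D * d"]) auto
qed

text \<open>A rational linear relation can be scaled to an integral one.  By independence modulo $l$ all its
  coefficients are divisible by $l$; dividing by $l$ gives another relation, so the coefficients are
  divisible by all powers of $l$ and vanish.  Hence independence modulo $l$ implies independence over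
  the rationals.\<close>

lemma card_int_independent_le:
  fixes A I :: "'b::field_char_0 set"
  assumes "subring_ideal A I"
    and V: "finite_dimensional_vector_space (\<lambda>(q::rat) (x::'b). of_rat q * x) Basis"
    and l: "prime l" and B: "subring_ideal.int_independent A I l B"
  shows "card B \<le> card Basis"
proof (rule ccontr)
  interpret subring_ideal A I by fact
  interpret V: finite_dimensional_vector_space "\<lambda>(q::rat) (x::'b). of_rat q * x" Basis by fact
  have finB: "finite B" using B by (simp add: int_independent_def)
  assume "\<not> card B \<le> card Basis"
  hence "card B > V.dim B"
    using V.dim_subset_UNIV[of B] by (simp add: V.dimension_def)
  hence "V.dependent B" by (intro V.dependent_biggerset_general) simp
  then obtain u where u: "(\<Sum>b\<in>B. of_rat (u b) * b) = 0" "\<exists>b\<in>B. u b \<noteq> 0"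
    using V.dependent_finite[OF finB] by auto
  obtain D where D: "D > 0" "\<forall>b\<in>B. \<exists>k::int. of_int D * u b = of_int k"
    using common_denominator[OF finB] by blast
  then obtain c where c: "\<And>b. b \<in> B \<Longrightarrow> of_int D * u b = of_int (c b)" by metis
  have "(\<Sum>b\<in>B. of_int (c b) * b) = (\<Sum>b\<in>B. of_int D * (of_rat (u b) * b))"
  proof (rule sum.cong[OF refl])
    fix b assume "b \<in> B"
    have "(of_int (c b) :: 'b) = of_rat (of_int D * u b)" using c[OF \<open>b \<in> B\<close>] by simp
    also have "\<dots> = of_int D * of_rat (u b)" by (simp add: of_rat_mult)
    finally show "of_int (c b) * b = of_int D * (of_rat (u b) * b)" by simp
  qed
  also have "\<dots> = 0" by (simp add: u(1) flip: sum_distrib_left)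
  finally have c0: "(\<Sum>b\<in>B. of_int (c b) * b) = 0" .
  \<comment> \<open>The infinite descent.\<close>
  have desc: "\<forall>c. (\<Sum>b\<in>B. of_int (c b) * b) = 0 \<longrightarrow> (\<forall>b\<in>B. int l ^ k dvd c b)" for k
  proof (induction k)
    case 0 show ?case by simp
  next
    case (Suc k)
    show ?case
    proof (intro allI impI ballI)
      fix c b assume c: "(\<Sum>b\<in>B. of_int (c b) * b) = 0" and b: "b \<in> B"
      have "\<forall>b\<in>B. int l dvd c b"
        using B c ideal_zero by (simp add: int_independent_def)
      hence c': "c b = int l * (c b div int l)" if "b \<in> B" for b using that by simp
      have "of_nat l * (\<Sum>b\<in>B. of_int (c b div int l) * b) = (\<Sum>b\<in>B. of_int (c b) * b)"
        unfolding sum_distrib_left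
      proof (rule sum.cong[OF refl])
        fix b assume "b \<in> B"
        have "(of_int (c b) :: 'b) = of_int (int l * (c b div int l))"
          using c'[OF \<open>b \<in> B\<close>] by simp
        thus "of_nat l * (of_int (c b div int l) * b) = of_int (c b) * b" by simp
      qed
      hence "(\<Sum>b\<in>B. of_int (c b div int l) * b) = 0" using c l by auto
      hence "int l ^ k dvd c b div int l" 
        using Suc.IH[rule_format, of "\<lambda>b. c b div int l"] b by blast
      hence "int l * int l ^ k dvd int l * (c b div int l)" by (rule mult_dvd_mono[OF dvd_refl])
      thus "int l ^ Suc k dvd c b" using c'[OF b] by simp
    qed
  qed
  obtain b where b: "b \<in> B" "u b \<noteq> 0" using u by blast
  have "c b \<noteq> 0" using c[OF b(1)] b D by auto
  moreover have "int l ^ nat \<bar>c b\<bar> dvd c b" using desc c0 b by blast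
  ultimately have "\<bar>int l ^ nat \<bar>c b\<bar>\<bar> \<le> \<bar>c b\<bar>" by (rule dvd_imp_le_int)
  moreover have "int (nat \<bar>c b\<bar>) < int (l ^ nat \<bar>c b\<bar>)"
    unfolding of_nat_less_iff
    by (rule power_gt_expt) (use prime_gt_1_nat[OF l] in simp)
  ultimately show False by (simp add: power_abs)
qed

text \<open>A family of elements of $A$ of maximal size among those that are independent modulo $I$ generates
  $A/I$, and its size is bounded by the degree of the number field.  So $A/I$ is finite, and its
  order is a power of $l$.\<close>

theorem residue_system_exists:
  fixes A I :: "'b::field_char_0 set"
  assumes "subring_ideal A I" and nf: "number_field TYPE('b)"
    and l: "prime l" "of_nat l \<in> I"
  shows "\<exists>T r. subring_ideal.residue_system A I T \<and> card T = l ^ r"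
proof -
  interpret subring_ideal A I by fact
  obtain Basis where V: "finite_dimensional_vector_space (\<lambda>(q::rat) (x::'b). of_rat q * x) Basis"
    using nf by (auto simp: number_field_def)
  have lI: "of_int (int l * k) * b \<in> I" if "b \<in> A" for k b
    using ideal_mult[OF mult_closed[OF of_int_closed that] l(2), of k] by (simp add: mult_ac)
  have "int_independent l {}" by (simp add: int_independent_def)
  hence "\<exists>B. int_independent l B \<and> (\<forall>B'. int_independent l B' \<longrightarrow> card B' \<le> card B)"
    using card_int_independent_le[OF assms(1) V l(1)]
    by (intro ex_has_greatest_nat[where b = "Suc (card Basis)"]) (auto simp: less_Suc_eq_le)
  then obtain B where B: "int_independent l B"
    and B_max: "\<And>B'. int_independent l B' \<Longrightarrow> card B' \<le> card B" by blast
  have finB: "finite B" and BA: "B \<subseteq> A" using B by (auto simp: int_independent_def)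
  define comb where "comb c = (\<Sum>b\<in>B. of_int (c b) * b)" for c :: "'b \<Rightarrow> int"
  have comb_A: "comb c \<in> A" for c
    unfolding comb_def using BA by (intro closed) auto
  have spans: "\<exists>c. a - comb c \<in> I" if a: "a \<in> A" for a
  proof (cases "a \<in> B")
    case True
    have "comb (\<lambda>b. if b = a then 1 else 0) = (\<Sum>b\<in>B. if b = a then b else 0)"
      unfolding comb_def by (intro sum.cong) auto
    also have "\<dots> = a" using True finB by simp
    finally show ?thesis using ideal_zero by (metis diff_self)
  next
    case False
    hence "card (insert a B) > card B" using finB by simp
    hence "\<not> int_independent l (insert a B)" using B_max leD by blast
    then obtain c b where c: "(\<Sum>b\<in>insert a B. of_int (c b) * b) \<in> I"
        "b \<in> insert a B" "\<not> int l dvd c b"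
      using finB BA a unfolding int_independent_def by auto
    have sum: "of_int (c a) * a + comb c \<in> I"
      using c(1) False finB by (simp add: comb_def)
    have nd: "\<not> int l dvd c a"
    proof
      assume d: "int l dvd c a"
      then obtain k where "c a = int l * k" by blast
      hence "of_int (c a) * a \<in> I" using lI a by simp
      from ideal_diff[OF sum this] have "comb c \<in> I" by simp
      hence "\<forall>b\<in>B. int l dvd c b" using B by (simp add: int_independent_def comb_def)
      thus False using c d by auto
    qed
    have "coprime (c a) (int l)"
      using l nd by (simp add: prime_imp_coprime coprime_commute)
    then obtain s t where st: "s * c a + t * int l = 1"
      by (metis bezout_int coprime_imp_gcd_eq_1)
    have "comb (\<lambda>b. - s * c b) = - of_int s * comb c"
      by (simp add: comb_def sum_distrib_left mult.assoc sum_negf)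
    hence "a - comb (\<lambda>b. - s * c b) = of_int (s * c a + t * int l) * a + of_int s * comb c"
      unfolding st by simp
    also have "\<dots> = of_int s * (of_int (c a) * a + comb c) + of_int (int l * t) * a"
      by (simp add: algebra_simps)
    also have "\<dots> \<in> I"
      by (intro ideal_add ideal_mult of_int_closed sum lI a)
    finally show ?thesis by blast
  qed
  define C where "C = B \<rightarrow>\<^sub>E {0..<int l}"
  have finC: "finite C" unfolding C_def using finB by (intro finite_PiE) auto
  have uniq: "c = c'" if "c \<in> C" "c' \<in> C" "comb c - comb c' \<in> I" for c c'
  proof (rule PiE_ext)
    show "c \<in> B \<rightarrow>\<^sub>E {0..<int l}" "c' \<in> B \<rightarrow>\<^sub>E {0..<int l}" using that by (auto simp: C_def)
    fix b assume b: "b \<in> B"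
    have "comb c - comb c' = (\<Sum>b\<in>B. of_int (c b - c' b) * b)"
      by (simp add: comb_def sum_subtractf algebra_simps)
    hence "(\<Sum>b\<in>B. of_int (c b - c' b) * b) \<in> I" using that(3) by argo
    hence "int l dvd c b - c' b"
      using B[unfolded int_independent_def, THEN conjunct2, THEN conjunct2,
          rule_format, of "\<lambda>b. c b - c' b"] b by blast
    moreover have "c b \<in> {0..<int l}" "c' b \<in> {0..<int l}"
      using that(1,2) b by (auto simp: C_def dest!: PiE_mem)
    ultimately show "c b = c' b"
      by (metis atLeastLessThan_iff mod_eq_dvd_iff mod_pos_pos_trivial)
  qed
  have reach: "\<exists>c'\<in>C. comb c - comb c' \<in> I" for c
  proof -
    define c' where "c' = (\<lambda>b\<in>B. c b mod int l)"
    have "c' \<in> C" using prime_gt_0_nat[OF l(1)] by (auto simp: C_def c'_def)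
    moreover have eq: "comb c - comb c' = (\<Sum>b\<in>B. of_int (int l * (c b div int l)) * b)"
      unfolding comb_def sum_subtractf[symmetric]
    proof (rule sum.cong[OF refl])
      fix b assume "b \<in> B"
      hence "of_int (c b) - (of_int (c' b) :: 'b) = of_int (int l * (c b div int l))"
        unfolding c'_def by (simp only: restrict_apply' of_int_diff[symmetric] minus_mod_eq_mult_div)
      thus "of_int (c b) * b - of_int (c' b) * b = of_int (int l * (c b div int l)) * b"
        by (metis left_diff_distrib)
    qed
    have "comb c - comb c' \<in> I" unfolding eq using lI BA by (intro ideal_sum) blast
    ultimately show ?thesis by blast
  qed
  have "residue_system (comb ` C)"
    unfolding residue_system_def
  proof (intro conjI ballI impI)
    show "finite (comb ` C)" using finC by simp
    show "comb ` C \<subseteq> A" using comb_A by blast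
    fix a assume "a \<in> A"
    then obtain c c' where 1: "a - comb c \<in> I" "c' \<in> C" "comb c - comb c' \<in> I" using spans reach by blast
    from ideal_add[OF 1(1,3)] have "a - comb c' \<in> I" by simp
    thus "\<exists>t\<in>comb ` C. a - t \<in> I" using 1(2) by blast
  next
    fix t t' assume "t \<in> comb ` C" "t' \<in> comb ` C" "t - t' \<in> I"
    thus "t = t'" using uniq by blast
  qed
  moreover have "card (comb ` C) = l ^ card B"
  proof -
    have "inj_on comb C" using uniq ideal_zero by (auto intro!: inj_onI)
    hence "card (comb ` C) = card C" by (rule card_image)
    also have "\<dots> = l ^ card B" using finB by (simp add: C_def card_PiE)
    finally show ?thesis .
  qed
  ultimately show ?thesis by blast
qed

section \<open>Algebraic integers of a number field and locally principal primes\<close>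

locale subring_prime = subring_ideal +
  assumes one_notin: "1 \<notin> I"
    and prime: "x \<in> A \<Longrightarrow> y \<in> A \<Longrightarrow> x * y \<in> I \<Longrightarrow> x \<in> I \<or> y \<in> I"
begin

lemma power_in: "x \<in> A \<Longrightarrow> x ^ k \<in> I \<Longrightarrow> x \<in> I"
  by (induction k) (use one_notin prime power_closed in auto)

lemma ideal_power: "x \<in> I \<Longrightarrow> k > 0 \<Longrightarrow> x ^ k \<in> I"
  using ideal_mult_right[OF power_closed[OF ideal_in]] by (cases k) auto

lemma outside_mult: "x \<in> A - I \<Longrightarrow> y \<in> A - I \<Longrightarrow> x * y \<in> A - I"
  using prime mult_closed by blast

lemma outside_power: "x \<in> A - I \<Longrightarrow> x ^ k \<in> A - I"
  using power_in power_closed by blast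

lemma outside_add: "x \<in> A - I \<Longrightarrow> y \<in> I \<Longrightarrow> x + y \<in> A - I"
  using ideal_diff[of "x + y" y] add_closed ideal_in by auto

lemma outside_one_minus: "y \<in> I \<Longrightarrow> 1 - y \<in> A - I"
  using outside_add[of 1 "- y"] one_notin one_closed ideal_uminus by auto

end

abbreviation integers :: "'a::field_char_0 set" where
  "integers \<equiv> {x. algebraic_int x}"

lemma integer_ring_simps [simp]:
  "carrier ring_of_integers = integers"
  "x \<otimes>\<^bsub>ring_of_integers\<^esub> y = x * y" "x \<oplus>\<^bsub>ring_of_integers\<^esub> y = x + y"
  "\<one>\<^bsub>ring_of_integers\<^esub> = 1" "\<zero>\<^bsub>ring_of_integers\<^esub> = 0"
  by (simp_all add: ring_of_integers_def)

text \<open>The sum and the product of algebraic integers are algebraic integers; here this is contained in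
  the assumption that the record of algebraic integers is a ring, which is part of having an ideal.\<close>

lemma subring_ideal_of_ideal:
  fixes J :: "'a::field_char_0 set"
  assumes "ideal J ring_of_integers"
  shows "subring_ideal integers J"
proof -
  interpret ideal J "ring_of_integers :: 'a ring" by fact
  have l: "a * x \<in> J" if "algebraic_int a" "x \<in> J" for a x
    using I_l_closed[of x a] that by simp
  show ?thesis
  proof
    show "J \<subseteq> integers" using a_subset by simp
    show "0 \<in> J" using additive_subgroup.zero_closed[OF additive_subgroup_axioms] by simp
    fix x y :: 'a
    show "x * y \<in> integers" if "x \<in> integers" "y \<in> integers"
      using m_closed[of x y] that by simp
    show "x - y \<in> integers" if "x \<in> integers" "y \<in> integers"
      using add.m_closed[of x "- y"] that by simp
    assume "x \<in> J" "y \<in> J"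
    hence "x \<oplus>\<^bsub>ring_of_integers\<^esub> (- y) \<in> J" using l[of "-1" y]
      by (intro additive_subgroup.a_closed[OF additive_subgroup_axioms]) auto
    thus "x - y \<in> J" by simp
  qed (use l in auto)
qed

lemma nonzero_primeD:
  fixes P :: "'a::field_char_0 set"
  assumes "nonzero_prime ring_of_integers P"
  shows "cring (ring_of_integers :: 'a ring)" "primeideal P ring_of_integers"
    "subring_prime integers P" "\<exists>x\<in>P. x \<noteq> 0"
proof -
  interpret primeideal P "ring_of_integers :: 'a ring"
    using assms by (simp add: nonzero_prime_def)
  interpret S: subring_ideal integers P
    by (rule subring_ideal_of_ideal) (rule is_ideal)
  show "cring (ring_of_integers :: 'a ring)" "primeideal P ring_of_integers"
    by unfold_locales
  show "subring_prime integers P"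
  proof
    show "1 \<notin> P" using one_imp_carrier I_notcarr by auto
    show "x \<in> P \<or> y \<in> P" if "x \<in> integers" "y \<in> integers" "x * y \<in> P" for x y
      using I_prime[of x y] that by simp
  qed
  show "\<exists>x\<in>P. x \<noteq> 0"
    using assms S.ideal_zero by (auto simp: nonzero_prime_def)
qed

lemma (in comm_subring) poly_closed: "(\<And>i. coeff p i \<in> A) \<Longrightarrow> x \<in> A \<Longrightarrow> poly p x \<in> A"
  by (simp add: poly_altdef closed)

text \<open>Divide an integral equation for $y$ by powers of the unknown until its constant term is not zero;
  that term is then a multiple of $y$.\<close>

lemma integer_divides_int:
  fixes y :: "'a::field_char_0"
  assumes "comm_subring (integers :: 'a set)" "y \<in> integers" "y \<noteq> 0"
  shows "\<exists>N::int. N \<noteq> 0 \<and> (\<exists>z\<in>integers. of_int N = z * y)"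
proof -
  interpret comm_subring "integers :: 'a set" by fact
  have "p \<noteq> 0 \<Longrightarrow> poly (map_poly of_int p) y = 0 \<Longrightarrow> ?thesis" for p :: "int poly"
  proof (induction p)
    case (pCons c p)
    show ?case
    proof (cases "c = 0")
      case True
      thus ?thesis using pCons assms(3) by (auto simp: map_poly_pCons)
    next
      case False
      have "of_int c = (- poly (map_poly of_int p) y) * y"
        using pCons.prems by (simp add: map_poly_pCons eq_neg_iff_add_eq_0 mult.commute)
      moreover have "- poly (map_poly of_int p) y \<in> integers"
        by (intro uminus_closed poly_closed assms(2)) (simp add: coeff_map_poly)
      ultimately show ?thesis using False by blast
    qed
  qed simp
  moreover obtain p where "poly (map_poly of_int p) y = 0" "lead_coeff p = 1"
    using assms(2) by (auto simp: algebraic_int_altdef_ipoly)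
  moreover from this have "p \<noteq> 0" by auto
  ultimately show ?thesis by blast
qed

lemma degree_monom_diff:
  assumes "i < j"
  shows "degree (monom 1 j - monom 1 i :: 'a::comm_ring_1 poly) = j"
  unfolding diff_conv_add_uminus
  by (subst degree_add_eq_left) (use assms in \<open>simp_all add: degree_monom_eq\<close>)

lemma int_root_scaled:
  fixes z :: "'a::field_char_0"
  assumes "poly (map_poly of_int p) z = 0" "degree p = d" "d > 0"
  shows "algebraic_int (of_int (lead_coeff p) * z)"
proof -
  define N where "N = lead_coeff p"
  define b where "b i = (if i = d then 1 else coeff p i * N ^ (d - 1 - i))" for i
  define q where "q = (\<Sum>i\<le>d. monom (of_int (b i) :: 'a) i)"
  have coeff_q: "coeff q i = (if i \<le> d then of_int (b i) else 0)" for i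
    by (simp add: q_def coeff_sum)
  have "degree q \<le> d" by (intro degree_le) (simp add: coeff_q)
  moreover have "coeff q d = 1" by (simp add: coeff_q b_def)
  ultimately have "lead_coeff q = 1" by (metis le_antisym le_degree zero_neq_one)
  moreover have "\<forall>i. coeff q i \<in> \<int>" by (simp add: coeff_q)
  moreover have "poly q (of_int N * z) = 0"
  proof -
    have scaled: "of_int (b i) * (of_int N * z) ^ i = of_int N ^ (d - 1) * (of_int (coeff p i) * z ^ i)"
      if "i \<le> d" for i
    proof (cases "i = d")
      case True
      have "(of_int N :: 'a) ^ d = of_int N ^ (d - 1) * of_int N"
        using assms(3) by (metis Suc_diff_1 power_Suc2)
      thus ?thesis using True assms(2) by (simp add: b_def power_mult_distrib N_def)
    next
      case False
      hence "d - 1 = (d - 1 - i) + i" using that by simp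
      hence "(of_int N :: 'a) ^ (d - 1) = of_int N ^ (d - 1 - i) * of_int N ^ i"
        by (metis power_add)
      thus ?thesis using False by (simp add: b_def power_mult_distrib)
    qed
    have "poly q (of_int N * z) = (\<Sum>i\<le>d. of_int (b i) * (of_int N * z) ^ i)"
      by (simp add: q_def poly_sum poly_monom)
    also have "\<dots> = (\<Sum>i\<le>d. of_int N ^ (d - 1) * (of_int (coeff p i) * z ^ i))"
      by (intro sum.cong refl scaled) simp
    also have "\<dots> = of_int N ^ (d - 1) * poly (map_poly of_int p) z"
      by (simp add: poly_altdef sum_distrib_left coeff_map_poly degree_map_poly assms(2))
    finally show ?thesis using assms(1) by simp
  qed
  ultimately show ?thesis unfolding N_def by (blast intro: algebraic_int.intros)
qed

lemma number_field_integral_multiple: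
  fixes z :: "'a::field_char_0"
  assumes "number_field TYPE('a)"
  shows "\<exists>N::int. N \<noteq> 0 \<and> algebraic_int (of_int N * z)"
proof -
  obtain Basis where V: "finite_dimensional_vector_space (\<lambda>(q::rat) (x::'a). of_rat q * x) Basis"
    using assms by (auto simp: number_field_def)
  interpret V: finite_dimensional_vector_space "\<lambda>(q::rat) (x::'a). of_rat q * x" Basis by fact
  define D where "D = card Basis"
  have "\<exists>p::int poly. degree p > 0 \<and> poly (map_poly of_int p) z = 0"
  proof (cases "inj_on (\<lambda>i. z ^ i) {..D}")
    case False
    then obtain i j where ij: "z ^ i = z ^ j" "i < j"
      by (metis (no_types, lifting) inj_on_def linorder_neqE_nat)
    have "degree (monom 1 j - monom 1 i :: int poly) = j"
      using ij(2) by (simp add: degree_monom_diff)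
    moreover have "map_poly of_int (monom 1 j - monom 1 i :: int poly) = (monom 1 j - monom 1 i :: 'a poly)"
      by (rule poly_eqI) (simp add: coeff_map_poly)
    hence "poly (map_poly of_int (monom 1 j - monom 1 i :: int poly)) z = 0"
      using ij(1) by (simp add: poly_monom)
    ultimately show ?thesis using ij(2) by (metis gr_zeroI not_less0)
  next
    case True
    let ?B = "(\<lambda>i. z ^ i) ` {..D}"
    have "card ?B > V.dim ?B"
      using V.dim_subset_UNIV[of ?B] True by (simp add: V.dimension_def D_def card_image)
    hence "V.dependent ?B" by (intro V.dependent_biggerset_general) simp
    then obtain u where u: "(\<Sum>b\<in>?B. of_rat (u b) * b) = 0" "\<exists>b\<in>?B. u b \<noteq> 0"
      using V.dependent_finite[of ?B] by auto
    define r where "r i = u (z ^ i)" for i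
    have r: "(\<Sum>i\<le>D. of_rat (r i) * z ^ i) = 0" "\<exists>i\<le>D. r i \<noteq> 0"
      using u by (auto simp: r_def sum.reindex[OF True])
    obtain E where E: "E > 0" "\<forall>i\<in>{..D}. \<exists>k::int. of_int E * r i = of_int k"
      using common_denominator[of "{..D}" r] by blast
    then obtain c where c: "\<And>i. i \<le> D \<Longrightarrow> of_int E * r i = of_int (c i)" by (metis atMost_iff)
    define p where "p = (\<Sum>i\<le>D. monom (c i) i)"
    have coeff_p: "coeff p i = (if i \<le> D then c i else 0)" for i
      by (simp add: p_def coeff_sum)
    have "poly (map_poly of_int p) z = (\<Sum>i\<le>D. of_int (c i) * z ^ i)"
    proof -
      have "map_poly of_int p = (\<Sum>i\<le>D. monom (of_int (c i) :: 'a) i)"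
        by (rule poly_eqI) (simp add: coeff_map_poly coeff_p coeff_sum)
      thus ?thesis by (simp add: poly_sum poly_monom)
    qed
    also have "\<dots> = (\<Sum>i\<le>D. of_int E * (of_rat (r i) * z ^ i))"
    proof (rule sum.cong[OF refl])
      fix i assume "i \<in> {..D}"
      hence "(of_int (c i) :: 'a) = of_rat (of_int E * r i)" using c[of i] by simp
      also have "\<dots> = of_int E * of_rat (r i)" by (simp add: of_rat_mult)
      finally show "of_int (c i) * z ^ i = of_int E * (of_rat (r i) * z ^ i)" by simp
    qed
    also have "\<dots> = 0" using r(1) by (simp flip: sum_distrib_left)
    finally have root: "poly (map_poly of_int p) z = 0" .
    obtain i where i: "i \<le> D" "r i \<noteq> 0" using r(2) by blast
    hence "coeff p i \<noteq> 0" using c[OF i(1)] E(1) by (auto simp: coeff_p)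
    hence "p \<noteq> 0" by auto
    moreover have "degree p \<noteq> 0"
    proof
      assume "degree p = 0"
      then obtain a where "p = [:a:]" by (metis degree_eq_zeroE)
      thus False using root \<open>p \<noteq> 0\<close> by (simp add: map_poly_pCons)
    qed
    ultimately show ?thesis using root by blast
  qed
  then obtain p :: "int poly" where p: "degree p > 0" "poly (map_poly of_int p) z = 0" by blast
  have "algebraic_int (of_int (lead_coeff p) * z)" by (rule int_root_scaled[OF p(2) refl p(1)])
  moreover have "lead_coeff p \<noteq> 0" using p(1) by auto
  ultimately show ?thesis by blast
qed

lemma subring_ideal_principal:
  assumes "comm_subring A" "N \<in> A"
  shows "subring_ideal A ((*) N ` A)"
proof -
  interpret comm_subring A by fact
  show ?thesis
  proof
    show "(*) N ` A \<subseteq> A" using assms(2) mult_closed by auto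
    show "0 \<in> (*) N ` A" using zero_closed by force
    show "x - y \<in> (*) N ` A" if "x \<in> (*) N ` A" "y \<in> (*) N ` A" for x y
      using that diff_closed by (auto simp flip: right_diff_distrib)
    show "a * x \<in> (*) N ` A" if "a \<in> A" "x \<in> (*) N ` A" for a x
      using that mult_closed[of a] by (auto simp: mult.left_commute[of a N])
  qed
qed

text \<open>Since $A/lA$ is finite, $l x^i \<equiv> l x^j$ modulo $lA$ for some $i < j$.  Then $x^j - x^i$ is an
  algebraic integer, which has the form $Q(x)$ for a monic integer polynomial $Q$; so $x$ is one too.\<close>

lemma completely_integrally_closed:
  fixes x :: "'a::field_char_0"
  assumes "comm_subring (integers :: 'a set)" "number_field TYPE('a)"
    and l: "prime l" "\<And>k. algebraic_int (of_nat l * x ^ k)"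
  shows "algebraic_int x"
proof -
  interpret subring_ideal integers "(*) (of_nat l :: 'a) ` integers"
    by (rule subring_ideal_principal) (use assms in auto)
  have "of_nat l \<in> (*) (of_nat l :: 'a) ` integers"
    by (rule image_eqI[of _ _ 1]) auto
  then obtain T where T: "residue_system T"
    using residue_system_exists[OF subring_ideal_axioms assms(2) l(1)] by blast
  obtain i j where ij: "i < j" "of_nat l * x ^ i - of_nat l * x ^ j \<in> (*) (of_nat l) ` integers"
    using powers_recur[OF T, of "\<lambda>k. of_nat l * x ^ k"] l(2) by auto
  then obtain w where w: "of_nat l * x ^ i - of_nat l * x ^ j = of_nat l * w" "algebraic_int w"
    by blast
  have "of_nat l * (x ^ i - x ^ j) = of_nat l * w" using w(1) by (simp add: algebra_simps)
  hence "x ^ i - x ^ j = w" using prime_gt_0_nat[OF l(1)] by simp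
  hence root: "poly (monom 1 j - monom 1 i) x = - w" by (auto simp: poly_monom)
  have deg: "degree (monom 1 j - monom 1 i :: 'a poly) = j"
    using ij(1) by (simp add: degree_monom_diff)
  show ?thesis
  proof (rule algebraic_int_root[OF _ root])
    show "algebraic_int (- w)" using w(2) by simp
    show "\<forall>k. coeff (monom 1 j - monom 1 i :: 'a poly) k \<in> \<int>" by simp
    show "lead_coeff (monom 1 j - monom 1 i :: 'a poly) = 1"
      unfolding deg using ij(1) by simp
    show "degree (monom 1 j - monom 1 i :: 'a poly) > 0" unfolding deg using ij(1) by simp
  qed
qed

text \<open>In the finite ring $A/NA$ every prime ideal annihilates a nonzero element.  The condition
  on \<open>b\<close> that is carried through the induction over finitely many elements of $I$ says that $b$ is
  not zero in the localization at $I$.  As a power of $y \<in> I$ recurs in the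
  finite ring, $y$ is nilpotent on the localization, and multiplying $b$ by the last power of $y$
  that does not kill it makes $y$ an annihilator.\<close>

lemma exists_annihilator:
  assumes "subring_prime A I" and N: "N \<in> I"
    and T: "subring_ideal.residue_system A ((*) N ` A) T"
  shows "\<exists>b\<in>A. b \<notin> (*) N ` A \<and> (\<forall>y\<in>I. b * y \<in> (*) N ` A)"
proof -
  interpret subring_prime A I by fact
  interpret N: subring_ideal A "(*) N ` A"
    using subring_ideal_principal ideal_in N comm_subring_axioms by blast
  have sub: "(*) N ` A \<subseteq> I" using N ideal_mult_right by auto
  have step: "\<exists>b\<in>A. (\<forall>z\<in>A. z * b \<in> (*) N ` A \<longrightarrow> z \<in> I) \<and> (\<forall>y\<in>Y. b * y \<in> (*) N ` A)"
    if "finite Y" "Y \<subseteq> I" for Y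
    using that
  proof (induction Y)
    case empty
    show ?case using one_closed sub by (intro bexI[of _ 1]) auto
  next
    case (insert y Y)
    then obtain b where b: "b \<in> A" "\<forall>z\<in>A. z * b \<in> (*) N ` A \<longrightarrow> z \<in> I"
        "\<forall>y\<in>Y. b * y \<in> (*) N ` A" by auto
    have y: "y \<in> I" "y \<in> A" using insert.prems ideal_in by auto
    define R where "R k \<longleftrightarrow> (\<exists>w\<in>A - I. b * w * y ^ k \<in> (*) N ` A)" for k
    have "\<exists>k. R k"
    proof -
      obtain i j where ij: "i < j" "b * y ^ i - b * y ^ j \<in> (*) N ` A"
        using N.powers_recur[OF T, of "\<lambda>k. b * y ^ k"] mult_closed[OF b(1) power_closed[OF y(2)]]
        by blast
      have "y ^ j = y ^ (j - i) * y ^ i" using ij(1) by (simp flip: power_add)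
      hence "b * y ^ i - b * y ^ j = b * (1 - y ^ (j - i)) * y ^ i"
        by (simp add: algebra_simps)
      moreover have "y ^ (j - i) \<in> I"
        using ij(1) y(1) by (intro ideal_power) auto
      ultimately have "R i" using outside_one_minus ij(2) unfolding R_def by auto
      thus ?thesis by blast
    qed
    define k where "k = (LEAST k. R k)"
    have Rk: "R k" using \<open>\<exists>k. R k\<close> unfolding k_def by (rule LeastI_ex)
    have least: "k \<le> i" if "R i" for i unfolding k_def using that by (rule Least_le)
    obtain w where w: "w \<in> A - I" "b * w * y ^ k \<in> (*) N ` A" using Rk by (auto simp: R_def)
    have "k \<noteq> 0"
    proof
      assume "k = 0"
      hence "w * b \<in> (*) N ` A" using w by (simp add: mult.commute)
      thus False using b w by auto
    qed
    then obtain k' where k': "k = Suc k'" by (cases k) auto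
    let ?b = "b * w * y ^ k'"
    have bA: "?b \<in> A" using b w y by (intro closed) auto
    moreover have "z \<in> I" if z: "z \<in> A" "z * ?b \<in> (*) N ` A" for z
    proof (rule ccontr)
      assume "z \<notin> I"
      hence "z * w \<in> A - I" using w z outside_mult by auto
      moreover have "b * (z * w) * y ^ k' \<in> (*) N ` A" using z(2) by (simp add: mult_ac)
      ultimately have "R k'" unfolding R_def by blast
      thus False using least k' by fastforce
    qed
    moreover have "?b * y \<in> (*) N ` A" using w(2) k' by (simp add: mult_ac)
    moreover have "?b * y' \<in> (*) N ` A" if "y' \<in> Y" for y'
    proof -
      have "(w * y ^ k') * (b * y') \<in> (*) N ` A"
        by (rule N.ideal_mult) (use w(1) y(2) that b(3) mult_closed power_closed in auto)
      thus ?thesis by (simp add: mult_ac)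
    qed
    ultimately show ?case by blast
  qed
  have T': "finite T" "T \<subseteq> A" "\<And>a. a \<in> A \<Longrightarrow> \<exists>t\<in>T. a - t \<in> (*) N ` A"
    using T by (auto simp: N.residue_system_def)
  obtain b where b: "b \<in> A" "\<forall>z\<in>A. z * b \<in> (*) N ` A \<longrightarrow> z \<in> I"
      "\<forall>y\<in>T \<inter> I. b * y \<in> (*) N ` A" using step[of "T \<inter> I"] T'(1) by auto
  have "b * y \<in> (*) N ` A" if y: "y \<in> I" for y
  proof -
    obtain t where t: "t \<in> T" "y - t \<in> (*) N ` A" using T'(3) ideal_in y by blast
    hence "t \<in> I" using sub ideal_diff[OF y, of "y - t"] by auto
    hence "b * t + b * (y - t) \<in> (*) N ` A"
      using b(3) t(1) N.ideal_mult[OF b(1) t(2)] by (intro N.ideal_add) auto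
    thus ?thesis by (simp add: algebra_simps)
  qed
  moreover have "b \<notin> (*) N ` A" using b(2) one_closed one_notin by auto
  ultimately show ?thesis using b(1) by blast
qed

text \<open>With $b$ as in the previous lemma put $x = b/l$, so that $x \<notin> A$ but $x I \<subseteq> A$.  If $x I \<subseteq> I$,
  then $l x^k \<in> A$ for all $k$ and $x$ would be in $A$.  So $w = x \<pi> \<notin> I$ for some $\<pi> \<in> I$, and
  $w y = \<pi> (x y)$ shows that $\<pi>$ generates $I$ locally.\<close>

lemma local_uniformizer:
  fixes I :: "'a::field_char_0 set"
  assumes "subring_prime integers I" and nf: "number_field TYPE('a)"
    and l: "prime l" "of_nat l \<in> I"
  shows "\<exists>\<pi>\<in>I. \<exists>w\<in>integers - I. \<forall>y\<in>I. \<exists>c\<in>integers. w * y = \<pi> * c"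
proof -
  interpret subring_prime "integers :: 'a set" I by fact
  let ?l = "of_nat l :: 'a"
  have l0: "?l \<noteq> 0" using prime_gt_0_nat[OF l(1)] by simp
  have "subring_ideal integers ((*) ?l ` integers)"
    by (rule subring_ideal_principal[OF comm_subring_axioms]) auto
  moreover have "?l \<in> (*) ?l ` integers" by (rule image_eqI[of _ _ 1]) auto
  ultimately obtain T where T: "subring_ideal.residue_system integers ((*) ?l ` integers) T"
    using residue_system_exists[OF _ nf l(1)] by blast
  obtain b where b: "b \<in> integers" "b \<notin> (*) ?l ` integers" "\<forall>y\<in>I. b * y \<in> (*) ?l ` integers"
    using exists_annihilator[OF assms(1) l(2) T] by (elim bexE conjE) (rule that)
  define x where "x = b / ?l"
  have xI: "x * y \<in> integers" if y: "y \<in> I" for y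
  proof -
    obtain c where "b * y = ?l * c" "c \<in> integers"
      using b(3)[rule_format, OF y] by (rule imageE)
    have "x * y = b * y / ?l" by (simp add: x_def)
    also have "\<dots> = c" unfolding \<open>b * y = ?l * c\<close> using l0 by simp
    finally show ?thesis using \<open>c \<in> integers\<close> by simp
  qed
  have "\<exists>\<pi>\<in>I. x * \<pi> \<notin> I"
  proof (rule ccontr)
    assume "\<not> ?thesis"
    hence stable: "x * y \<in> I" if "y \<in> I" for y using that by blast
    have "?l * x ^ k \<in> I" for k
      by (induction k) (use l stable in \<open>auto simp: mult.left_commute\<close>)
    hence "algebraic_int (?l * x ^ k)" for k using ideal_in by blast
    hence "algebraic_int x"
      by (rule completely_integrally_closed[OF comm_subring_axioms nf l(1)])
    moreover have "b = ?l * x" using l0 by (simp add: x_def)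
    ultimately show False using b(2) by blast
  qed
  then obtain \<pi> where pi: "\<pi> \<in> I" "x * \<pi> \<notin> I" by blast
  show ?thesis
  proof (rule bexI[OF _ pi(1)], rule bexI[of _ "x * \<pi>"], rule ballI)
    show "x * \<pi> \<in> integers - I" using pi xI by blast
    fix y assume "y \<in> I"
    thus "\<exists>c\<in>integers. x * \<pi> * y = \<pi> * c" using xI by (intro bexI[of _ "x * y"]) auto
  qed
qed

section \<open>The valuation of a prime ideal\<close>

text \<open>A prime ideal \<open>I\<close> whose localization is a discrete valuation ring with fraction field \<open>'a\<close>: units
  of the localization appear as quotients of elements outside of \<open>I\<close>.\<close>

locale uniformized_prime = subring_prime A I
  for A I :: "'a::field_char_0 set" +
  fixes \<pi> w\<^sub>0 :: 'a
  assumes uniformizer: "\<pi> \<in> I" "\<pi> \<noteq> 0"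
    and w0: "w\<^sub>0 \<in> A - I"
    and divides: "y \<in> I \<Longrightarrow> \<exists>c\<in>A. w\<^sub>0 * y = \<pi> * c"
    and factors: "z \<noteq> 0 \<Longrightarrow> \<exists>k. \<exists>w\<in>A - I. \<exists>c\<in>A - I. w * z = \<pi> powi k * c"
begin

lemma exponent_le:
  assumes "z \<noteq> 0" "w \<in> A - I" "c \<in> A - I" "w * z = \<pi> powi k * c"
    and "w' \<in> A - I" "c' \<in> A" "w' * z = \<pi> powi l * c'"
  shows "l \<le> k"
proof (rule ccontr)
  assume "\<not> l \<le> k"
  hence "k < l" by simp
  then obtain n where n: "l = k + int (Suc n)" unfolding zless_iff_Suc_zadd by blast
  have "\<pi> powi k * (w' * c) = w * (w' * z)" using assms(4) by (simp add: mult_ac)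
  also have "\<dots> = \<pi> powi k * (\<pi> ^ Suc n * (w * c'))"
    unfolding assms(7) n using uniformizer(2)
    by (simp add: power_int_add mult_ac del: power_Suc of_nat_Suc)
  finally have "w' * c = \<pi> ^ Suc n * (w * c')" using uniformizer(2) by simp
  moreover have "\<pi> ^ Suc n * (w * c') \<in> I"
    using uniformizer(1) assms by (intro ideal_mult_right ideal_power mult_closed) auto
  ultimately show False using outside_mult[OF assms(5,3)] by simp
qed

definition v :: "'a \<Rightarrow> int" where
  "v z = (THE k. \<exists>w\<in>A - I. \<exists>c\<in>A - I. w * z = \<pi> powi k * c)"

lemma v_eq:
  assumes "z \<noteq> 0" "w \<in> A - I" "c \<in> A - I" "w * z = \<pi> powi k * c"
  shows "v z = k"
  unfolding v_def
proof (rule the_equality)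
  show "\<exists>w\<in>A - I. \<exists>c\<in>A - I. w * z = \<pi> powi k * c" using assms by blast
  fix l assume "\<exists>w\<in>A - I. \<exists>c\<in>A - I. w * z = \<pi> powi l * c"
  then obtain w' c' where "w' \<in> A - I" "c' \<in> A - I" "w' * z = \<pi> powi l * c'" by blast
  thus "l = k"
    using exponent_le[OF assms, of w' c' l] exponent_le[of z w' c' l w c k] assms by force
qed

lemma v_factor:
  assumes "z \<noteq> 0"
  obtains w c where "w \<in> A - I" "c \<in> A - I" "w * z = \<pi> powi v z * c"
  using factors[OF assms] v_eq[OF assms] by blast

lemma v_ge_iff:
  assumes "z \<noteq> 0"
  shows "l \<le> v z \<longleftrightarrow> (\<exists>w\<in>A - I. \<exists>c\<in>A. w * z = \<pi> powi l * c)"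
proof
  obtain w c where wc: "w \<in> A - I" "c \<in> A - I" "w * z = \<pi> powi v z * c"
    using v_factor[OF assms] .
  assume "l \<le> v z"
  hence "\<pi> powi v z = \<pi> powi l * \<pi> ^ nat (v z - l)"
    using uniformizer(2) power_int_add[of \<pi> l "int (nat (v z - l))"]
    by (simp del: of_nat_nat add: power_int_of_nat[symmetric])
  hence "w * z = \<pi> powi l * (\<pi> ^ nat (v z - l) * c)" using wc(3) by simp
  moreover have "\<pi> ^ nat (v z - l) * c \<in> A"
    using wc(2) ideal_in[OF uniformizer(1)] by (intro mult_closed power_closed) auto
  ultimately show "\<exists>w\<in>A - I. \<exists>c\<in>A. w * z = \<pi> powi l * c" using wc(1) by blast
next
  assume "\<exists>w\<in>A - I. \<exists>c\<in>A. w * z = \<pi> powi l * c"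
  thus "l \<le> v z" using exponent_le[OF assms] v_factor[OF assms] by metis
qed

sublocale discrete_valuation v
proof
  fix x y :: 'a assume xy: "x \<noteq> 0" "y \<noteq> 0"
  obtain w c where wc: "w \<in> A - I" "c \<in> A - I" "w * x = \<pi> powi v x * c"
    using v_factor[OF xy(1)] .
  obtain w' c' where wc': "w' \<in> A - I" "c' \<in> A - I" "w' * y = \<pi> powi v y * c'"
    using v_factor[OF xy(2)] .
  show "v (x * y) = v x + v y"
  proof (rule v_eq)
    show "w * w' \<in> A - I" "c * c' \<in> A - I" using wc wc' outside_mult by auto
    have "w * w' * (x * y) = (w * x) * (w' * y)" by (simp only: mult_ac)
    thus "w * w' * (x * y) = \<pi> powi (v x + v y) * (c * c')"
      unfolding wc(3) wc'(3) using uniformizer(2) by (simp add: power_int_add mult_ac)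
  qed (use xy in simp)
  assume nz: "x + y \<noteq> 0"
  let ?l = "min (v x) (v y)"
  obtain w c where wc: "w \<in> A - I" "c \<in> A" "w * x = \<pi> powi ?l * c"
    using v_ge_iff[OF xy(1), of ?l] by auto
  obtain w' c' where wc': "w' \<in> A - I" "c' \<in> A" "w' * y = \<pi> powi ?l * c'"
    using v_ge_iff[OF xy(2), of ?l] by auto
  have "w * w' * (x + y) = w' * (w * x) + w * (w' * y)" by (simp only: algebra_simps)
  also have "\<dots> = \<pi> powi ?l * (w' * c + w * c')"
    unfolding wc(3) wc'(3) by (simp only: algebra_simps)
  finally have "w * w' * (x + y) = \<pi> powi ?l * (w' * c + w * c')" .
  moreover have "w * w' \<in> A - I" using wc wc' outside_mult by auto
  moreover have "w' * c + w * c' \<in> A" using wc wc' add_closed mult_closed by auto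
  ultimately show "?l \<le> v (x + y)" using v_ge_iff[OF nz] by blast
qed

lemma vge_integral: "x \<in> A \<Longrightarrow> vge 0 x"
  using v_ge_iff[of x 0] one_closed one_notin by (force simp: vge_def)

lemma v_outside:
  assumes "x \<in> A - I"
  shows "v x = 0"
  by (rule v_eq[of _ 1 x]) (use assms one_closed one_notin ideal_zero in auto)

end

text \<open>Divide by $\<pi>$ as long as possible: a quotient that still lies in $I$ is locally divisible by $\<pi>$.\<close>

lemma (in subring_prime) power_of_uniformizer_factor:
  fixes \<pi> w\<^sub>0
  assumes pi: "\<pi> \<in> I" and w0: "w\<^sub>0 \<in> A - I"
    and divides: "\<And>y. y \<in> I \<Longrightarrow> \<exists>c\<in>A. w\<^sub>0 * y = \<pi> * c"
    and y: "y \<in> A" and bound: "\<not> (\<exists>w\<in>A - I. \<exists>c\<in>A. w * y = \<pi> ^ n * c)"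
  shows "\<exists>k<n. \<exists>w\<in>A - I. \<exists>c\<in>A - I. w * y = \<pi> ^ k * c"
proof -
  define R where "R k \<longleftrightarrow> (\<exists>w\<in>A - I. \<exists>c\<in>A. w * y = \<pi> ^ k * c)" for k
  define k where "k = (LEAST k. \<not> R k)"
  have nR: "\<not> R k" and kn: "k \<le> n"
    using bound LeastI[of "\<lambda>k. \<not> R k" n] Least_le[of "\<lambda>k. \<not> R k" n]
    unfolding k_def R_def by blast+
  have "R 0" using y one_closed one_notin by (auto simp: R_def intro!: bexI[of _ 1])
  hence "k \<noteq> 0" using nR by (cases k) auto
  then obtain k' where k': "k = Suc k'" by (cases k) auto
  have "R k'" using not_less_Least[of k' "\<lambda>k. \<not> R k"] k' unfolding k_def by auto
  then obtain w c where wc: "w \<in> A - I" "c \<in> A" "w * y = \<pi> ^ k' * c" by (auto simp: R_def)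
  have "c \<notin> I"
  proof
    assume "c \<in> I"
    then obtain d where d: "d \<in> A" "w\<^sub>0 * c = \<pi> * d" using divides by blast
    have "w\<^sub>0 * w * y = \<pi> ^ k' * (w\<^sub>0 * c)" using wc(3) by (simp add: mult_ac)
    also have "\<dots> = \<pi> ^ k * d" unfolding d(2) k' by (simp add: mult_ac)
    finally show False using nR outside_mult[OF w0 wc(1)] d(1) unfolding R_def by blast
  qed
  thus ?thesis using wc kn k' by (intro exI[of _ k']) auto
qed

text \<open>It has to be seen that no nonzero element is locally divisible by all powers of the uniformizer
  $\<pi>$.  For $l$ this holds because $\<pi>^i \<equiv> \<pi>^j$ modulo $l$ for some $i < j$, so that $l$ divides
  $\<pi>^i$ up to a local unit.  It extends to all integers, as these are products of powers of $l$
  with elements outside of the prime, to their divisors, the algebraic integers, and to quotients.\<close>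

theorem uniformized_prime_exists:
  fixes P :: "'a::field_char_0 set"
  assumes "subring_prime integers P" and nf: "number_field TYPE('a)"
    and l: "prime l" "of_nat l \<in> P"
  shows "\<exists>\<pi> w. uniformized_prime integers P \<pi> w"
proof -
  interpret subring_prime "integers :: 'a set" P by fact
  let ?l = "of_nat l :: 'a"
  have l0: "?l \<noteq> 0" using prime_gt_0_nat[OF l(1)] by simp
  obtain \<pi> w\<^sub>0 where pi: "\<pi> \<in> P" and w0: "w\<^sub>0 \<in> integers - P"
    and divides: "\<And>y. y \<in> P \<Longrightarrow> \<exists>c\<in>integers. w\<^sub>0 * y = \<pi> * c"
    using local_uniformizer[OF assms] by blast
  have w0_nz: "w\<^sub>0 \<noteq> 0" using w0 ideal_zero by blast
  have pi_nz: "\<pi> \<noteq> 0" using divides[OF l(2)] l0 w0_nz by auto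
  have bounded: "\<exists>n. \<not> (\<exists>w\<in>integers - P. \<exists>c\<in>integers. w * ?l = \<pi> ^ n * c)"
  proof -
    have L: "subring_ideal integers ((*) ?l ` integers)"
      by (rule subring_ideal_principal[OF comm_subring_axioms]) auto
    interpret L: subring_ideal integers "(*) ?l ` integers" by (rule L)
    have "?l \<in> (*) ?l ` integers" by (rule image_eqI[of _ _ 1]) auto
    then obtain T where T: "L.residue_system T"
      using residue_system_exists[OF L nf l(1)] by blast
    obtain i j where ij: "i < j" "\<pi> ^ i - \<pi> ^ j \<in> (*) ?l ` integers"
      using L.powers_recur[OF T, of "\<lambda>k. \<pi> ^ k"] power_closed[OF ideal_in[OF pi]] by blast
    then obtain d where d: "d \<in> integers" "\<pi> ^ i - \<pi> ^ j = ?l * d" by blast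
    have "\<pi> ^ j = \<pi> ^ i * \<pi> ^ (j - i)" using ij(1) by (simp flip: power_add)
    hence ld: "?l * d = \<pi> ^ i * (1 - \<pi> ^ (j - i))" using d(2) by (simp add: algebra_simps)
    have "w * ?l \<noteq> \<pi> ^ Suc i * c" if w: "w \<in> integers - P" and c: "c \<in> integers" for w c
    proof
      assume "w * ?l = \<pi> ^ Suc i * c"
      hence "w * (?l * d) = \<pi> ^ i * (\<pi> * (c * d))" by (simp add: mult_ac)
      hence "\<pi> ^ i * (w * (1 - \<pi> ^ (j - i))) = \<pi> ^ i * (\<pi> * (c * d))"
        unfolding ld by (simp only: mult_ac)
      hence "w * (1 - \<pi> ^ (j - i)) = \<pi> * (c * d)" using pi_nz by simp
      moreover have "\<pi> * (c * d) \<in> P" by (intro ideal_mult_right pi mult_closed c d)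
      moreover have "w * (1 - \<pi> ^ (j - i)) \<in> integers - P"
        using ij(1) by (intro outside_mult w outside_one_minus ideal_power pi) simp
      ultimately show False by simp
    qed
    thus ?thesis by blast
  qed
  have int_factor: "\<exists>k. \<exists>w\<in>integers - P. \<exists>c\<in>integers - P. w * of_nat N = \<pi> ^ k * c"
    if "N > 0" for N :: nat
    using that
  proof (induction N rule: less_induct)
    case (less N)
    show ?case
    proof (cases "l dvd N")
      case True
      then obtain M where M: "N = l * M" by blast
      have "0 < M" "M < N" using less.prems prime_gt_1_nat[OF l(1)] M by auto
      then obtain k w c where 1: "w \<in> integers - P" "c \<in> integers - P" "w * of_nat M = \<pi> ^ k * c"
        using less.IH by blast
      obtain k' w' c' where 2: "w' \<in> integers - P" "c' \<in> integers - P" "w' * ?l = \<pi> ^ k' * c'"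
        using bounded power_of_uniformizer_factor[OF pi w0 divides ideal_in[OF l(2)]] by blast
      have "(w * w') * of_nat N = (w * of_nat M) * (w' * ?l)" by (simp add: M mult_ac)
      also have "\<dots> = \<pi> ^ (k + k') * (c * c')" unfolding 1(3) 2(3) by (simp add: power_add mult_ac)
      finally show ?thesis using outside_mult 1 2 by blast
    next
      case False
      have "(of_nat N :: 'a) \<notin> P"
      proof
        assume N: "(of_nat N :: 'a) \<in> P"
        have "coprime (int l) (int N)" using False l(1) by (simp add: prime_imp_coprime)
        then obtain s t where "s * int l + t * int N = 1"
          by (metis bezout_int coprime_imp_gcd_eq_1)
        hence "(of_int s * ?l + of_int t * of_nat N :: 'a) = 1"
          by (metis of_int_1 of_int_add of_int_mult of_int_of_nat_eq)
        moreover have "of_int s * ?l + of_int t * of_nat N \<in> P"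
          using N l(2) by (intro ideal_add ideal_mult) auto
        ultimately show False using one_notin by simp
      qed
      hence "(1::'a) * of_nat N = \<pi> ^ 0 * of_nat N" "(of_nat N :: 'a) \<in> integers - P" by auto
      thus ?thesis using one_notin by blast
    qed
  qed
  have alg_factor: "\<exists>k. \<exists>w\<in>integers - P. \<exists>c\<in>integers - P. w * y = \<pi> ^ k * c"
    if y: "y \<in> integers" "y \<noteq> 0" for y
  proof -
    obtain N z where Nz: "N \<noteq> 0" "z \<in> integers" "of_int N = z * y"
      using integer_divides_int[OF comm_subring_axioms y] by blast
    define z' where "z' = of_int (sgn N) * z"
    have "of_nat (nat \<bar>N\<bar>) = (of_int \<bar>N\<bar> :: 'a)" by simp
    also have "\<dots> = of_int (sgn N) * of_int N"
      unfolding of_int_mult[symmetric] by (simp add: abs_sgn mult.commute)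
    finally have "of_nat (nat \<bar>N\<bar>) = of_int (sgn N) * (of_int N :: 'a)" .
    hence z': "of_nat (nat \<bar>N\<bar>) = z' * y" "z' \<in> integers"
      using Nz mult_closed[OF of_int_closed] unfolding z'_def by (simp_all add: mult.assoc)
    obtain k w c where 1: "w \<in> integers - P" "c \<in> integers - P"
        "w * of_nat (nat \<bar>N\<bar>) = \<pi> ^ k * c" using int_factor[of "nat \<bar>N\<bar>"] Nz(1) by auto
    have "\<not> (\<exists>w'\<in>integers - P. \<exists>c'\<in>integers. w' * y = \<pi> ^ Suc k * c')"
    proof
      assume "\<exists>w'\<in>integers - P. \<exists>c'\<in>integers. w' * y = \<pi> ^ Suc k * c'"
      then obtain w' c' where 2: "w' \<in> integers - P" "c' \<in> integers" "w' * y = \<pi> ^ Suc k * c'"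
        by blast
      have "\<pi> ^ k * (w' * c) = w' * (w * (z' * y))" unfolding z'(1)[symmetric] 1(3)
        by (simp only: mult_ac)
      also have "\<dots> = w * z' * (w' * y)" by (simp only: mult_ac)
      also have "\<dots> = \<pi> ^ k * (\<pi> * (w * z' * c'))" unfolding 2(3) by (simp add: mult_ac)
      finally have "w' * c = \<pi> * (w * z' * c')" using pi_nz by simp
      moreover have "\<pi> * (w * z' * c') \<in> P"
        by (rule ideal_mult_right[OF _ pi]) (use 1 2 z' mult_closed in auto)
      ultimately show False using outside_mult[OF 2(1) 1(2)] by simp
    qed
    from power_of_uniformizer_factor[OF pi w0 divides y(1) this] show ?thesis by blast
  qed
  have "uniformized_prime integers P \<pi> w\<^sub>0"
  proof
    show "\<pi> \<in> P" "\<pi> \<noteq> 0" "w\<^sub>0 \<in> integers - P" by fact+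
    show "\<exists>c\<in>integers. w\<^sub>0 * y = \<pi> * c" if "y \<in> P" for y using divides[OF that] .
    fix z :: 'a assume z: "z \<noteq> 0"
    obtain N :: int where N: "N \<noteq> 0" "algebraic_int (of_int N * z)"
      using number_field_integral_multiple[OF nf] by blast
    obtain k w c where 1: "w \<in> integers - P" "c \<in> integers - P"
        "w * (of_int N * z) = \<pi> ^ k * c" using alg_factor[of "of_int N * z"] N z by auto
    obtain k' w' c' where 2: "w' \<in> integers - P" "c' \<in> integers - P"
        "w' * of_int N = \<pi> ^ k' * c'" using alg_factor[of "of_int N"] N by auto
    have "\<pi> ^ k' * (w * c' * z) = w * (w' * of_int N) * z" unfolding 2(3) by (simp only: mult_ac)
    also have "\<dots> = w' * (w * (of_int N * z))" by (simp only: mult_ac)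
    also have "\<dots> = \<pi> ^ k * (w' * c)" unfolding 1(3) by (simp only: mult_ac)
    finally have "w * c' * z = \<pi> powi (int k - int k') * (w' * c)"
      using pi_nz by (simp add: power_int_diff field_simps)
    thus "\<exists>k. \<exists>w\<in>integers - P. \<exists>c\<in>integers - P. w * z = \<pi> powi k * c"
      using outside_mult 1 2 by blast
  qed
  thus ?thesis by blast
qed

lemma power_ideal_Suc:
  "P [^]\<^bsub>ideals_set R\<^esub> Suc k = ideal_prod R (P [^]\<^bsub>ideals_set R\<^esub> k) P"
  "P [^]\<^bsub>ideals_set R\<^esub> (0::nat) = carrier R"
  "I \<otimes>\<^bsub>ideals_set R\<^esub> J = ideal_prod R I J" "\<one>\<^bsub>ideals_set R\<^esub> = carrier R"
  by (simp_all add: nat_pow_def ideals_set_def)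

lemma (in ring) ideal_power_ideal:
  assumes "ideal P R"
  shows "ideal (P [^]\<^bsub>ideals_set R\<^esub> (k::nat)) R"
  by (induction k) (simp_all add: power_ideal_Suc oneideal ideal_prod_is_ideal assms)

text \<open>The powers of a maximal ideal are primary: if $w y \<in> P^k$ with $w \<notin> P$, then $1 = w z + c$ with
  $c \<in> P$, hence $y \<equiv> c^i y$ modulo $P^k$ for all $i$, and $c^k y \<in> P^k$.  So membership in $P^k$
  can be tested in the localization.\<close>

lemma mem_power_ideal_iff:
  fixes P :: "'a::field_char_0 set"
  assumes "uniformized_prime integers P \<pi> w\<^sub>0" "primeideal P ring_of_integers"
    and T: "subring_ideal.residue_system integers P T" and y: "y \<in> integers"
  shows "y \<in> P [^]\<^bsub>ideals_set ring_of_integers\<^esub> k \<longleftrightarrow>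
    (\<exists>w\<in>integers - P. \<exists>c\<in>integers. w * y = \<pi> ^ k * c)" (is "y \<in> ?J k \<longleftrightarrow> _")
proof
  interpret uniformized_prime integers P \<pi> w\<^sub>0 by fact
  interpret R: primeideal P "ring_of_integers :: 'a ring" by fact
  show "\<exists>w\<in>integers - P. \<exists>c\<in>integers. w * y = \<pi> ^ k * c" if "y \<in> ?J k"
    using that
  proof (induction k arbitrary: y)
    case 0
    thus ?case using one_notin by (auto simp: power_ideal_Suc intro!: bexI[of _ 1])
  next
    case (Suc k)
    from Suc.prems have "y \<in> ideal_prod ring_of_integers (?J k) P" by (simp add: power_ideal_Suc)
    thus ?case
    proof (induction rule: ideal_prod.induct)
      case (prod i j)
      obtain w c where 1: "w \<in> integers - P" "c \<in> integers" "w * i = \<pi> ^ k * c"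
        using Suc.IH[OF prod(1)] by blast
      obtain d where 2: "d \<in> integers" "w\<^sub>0 * j = \<pi> * d" using divides[OF prod(2)] by blast
      have "(w * w\<^sub>0) * (i * j) = (w * i) * (w\<^sub>0 * j)" by (simp only: mult_ac)
      also have "\<dots> = \<pi> ^ Suc k * (c * d)" unfolding 1(3) 2(2) by (simp add: mult_ac)
      finally show ?case using outside_mult[OF 1(1) w0] mult_closed[OF 1(2) 2(1)] by auto
    next
      case (sum s1 s2)
      then obtain w c w' c' where 1: "w \<in> integers - P" "c \<in> integers" "w * s1 = \<pi> ^ Suc k * c"
        and 2: "w' \<in> integers - P" "c' \<in> integers" "w' * s2 = \<pi> ^ Suc k * c'" by blast
      have "(w * w') * (s1 + s2) = w' * (w * s1) + w * (w' * s2)" by (simp only: algebra_simps)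
      also have "\<dots> = \<pi> ^ Suc k * (w' * c + w * c')"
        unfolding 1(3) 2(3) by (simp only: algebra_simps)
      finally have "(w * w') * (s1 + s2) = \<pi> ^ Suc k * (w' * c + w * c')" .
      moreover have "w' * c + w * c' \<in> integers"
        using 1 2 by (intro add_closed mult_closed) auto
      ultimately show ?case using outside_mult[OF 1(1) 2(1)] unfolding integer_ring_simps by blast
    qed
  qed
  interpret J: subring_ideal integers "?J k"
    by (rule subring_ideal_of_ideal, rule R.ideal_power_ideal) (rule R.is_ideal)
  have pow: "x ^ i \<in> ?J i" if "x \<in> P" for x and i :: nat
  proof (induction i)
    case 0 show ?case by (simp add: power_ideal_Suc)
  next
    case (Suc i)
    thus ?case using ideal_prod.prod[OF Suc that, of ring_of_integers]
      by (simp add: power_ideal_Suc mult.commute)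
  qed
  assume "\<exists>w\<in>integers - P. \<exists>c\<in>integers. w * y = \<pi> ^ k * c"
  then obtain w c where w: "w \<in> integers - P" "c \<in> integers" "w * y = \<pi> ^ k * c" by blast
  have wy: "w * y \<in> ?J k" unfolding w(3)
    by (rule J.ideal_mult_right[OF w(2) pow[OF uniformizer(1)]])
  obtain i j where ij: "i < j" "w ^ i - w ^ j \<in> P"
    using powers_recur[OF T, of "\<lambda>k. w ^ k"] power_closed[of w] w(1) by auto
  \<comment> \<open>Maximality of \<open>P\<close>: as the powers of \<open>w\<close> recur modulo \<open>P\<close>, one of them is inverse to \<open>w\<close>.\<close>
  define z where "z = w ^ (j - i - 1)"
  have z: "z \<in> integers" unfolding z_def using w(1) power_closed by auto
  have "w ^ j = w ^ i * (w * z)"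
    unfolding z_def using ij(1) by (simp flip: power_add power_Suc)
  hence "w ^ i * (1 - w * z) \<in> P" using ij(2) by (simp add: right_diff_distrib)
  hence c0: "1 - w * z \<in> P"
    using prime[of "w ^ i" "1 - w * z"] outside_power[OF w(1), of i] w(1) z closed by auto
  have "y - (1 - w * z) ^ i * y \<in> ?J k" for i
  proof (induction i)
    case 0 show ?case by (simp add: J.ideal_zero)
  next
    case (Suc i)
    have "(1 - w * z) ^ i * z * (w * y) \<in> ?J k"
      using z c0 ideal_in by (intro J.ideal_mult wy mult_closed power_closed) auto
    from J.ideal_add[OF Suc this] show ?case by (simp add: algebra_simps)
  qed
  from this[of k] have "y - (1 - w * z) ^ k * y \<in> ?J k" .
  moreover have "(1 - w * z) ^ k * y \<in> ?J k" by (rule J.ideal_mult_right[OF y pow[OF c0]])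
  ultimately show "y \<in> ?J k" using J.ideal_add by fastforce
qed

text \<open>By the description of the ideal powers, the largest \<open>k\<close> with $2 \<in> P^k$ is the valuation of 2 at
  $P$, provided that $2 \<in> P$.  Otherwise it is 0, which is not odd.\<close>

theorem odd_prime_valuation_imp_valuation:
  fixes P :: "'a::field_char_0 set"
  assumes nf: "number_field TYPE('a)" and P: "nonzero_prime ring_of_integers P"
    and odd: "odd (prime_valuation ring_of_integers P 2)"
  shows "\<exists>v. discrete_valuation v \<and> v 2 > 0 \<and> odd (v 2) \<and>
    (\<forall>x. algebraic_int x \<longrightarrow> discrete_valuation.vge v 0 x) \<and>
    (\<forall>x. algebraic_int x \<and> x \<notin> P \<longrightarrow> v x = 0)"
proof -
  interpret R: primeideal P "ring_of_integers :: 'a ring" using nonzero_primeD(2)[OF P] .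
  interpret subring_prime integers P using nonzero_primeD(3)[OF P] .
  have "2 \<in> P"
  proof (rule ccontr)
    assume 2: "2 \<notin> P"
    have "k = 0" if "2 \<in> P [^]\<^bsub>ideals_set ring_of_integers\<^esub> k" for k :: nat
    proof (cases k)
      case (Suc k')
      have "P [^]\<^bsub>ideals_set ring_of_integers\<^esub> k \<subseteq> P"
        using R.ideal_prod_inter[OF R.ideal_power_ideal[OF R.is_ideal] R.is_ideal]
        by (auto simp: Suc power_ideal_Suc)
      thus ?thesis using that 2 by blast
    qed
    moreover have "2 \<in> P [^]\<^bsub>ideals_set ring_of_integers\<^esub> (0::nat)"
      by (simp add: power_ideal_Suc)
    ultimately have "prime_valuation ring_of_integers P 2 = 0"
      unfolding prime_valuation_def by (intro Greatest_equality) auto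
    thus False using odd by simp
  qed
  hence l: "prime (2::nat)" "of_nat 2 \<in> P" by auto
  obtain \<pi> w\<^sub>0 where "uniformized_prime integers P \<pi> w\<^sub>0"
    using uniformized_prime_exists[OF subring_prime_axioms nf l] by blast
  then interpret U: uniformized_prime integers P \<pi> w\<^sub>0 .
  obtain T where T: "residue_system T"
    using residue_system_exists[OF subring_ideal_axioms nf l] by blast
  obtain c where c: "c \<in> integers" "w\<^sub>0 * 2 = \<pi> powi 1 * c" using U.divides[OF \<open>2 \<in> P\<close>] by auto
  have v2: "U.v 2 \<ge> 1" by (subst U.v_ge_iff) (use c U.w0 in auto)
  have mem: "2 \<in> P [^]\<^bsub>ideals_set ring_of_integers\<^esub> k \<longleftrightarrow> int k \<le> U.v 2" for k :: nat
    using mem_power_ideal_iff[OF U.uniformized_prime_axioms R.primeideal_axioms T, of 2 k]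
      U.v_ge_iff[of 2 "int k"] by simp
  have "prime_valuation ring_of_integers P 2 = nat (U.v 2)"
    unfolding prime_valuation_def mem using v2 by (intro Greatest_equality) auto
  hence "odd (U.v 2)" using odd v2 by (simp add: even_nat_iff)
  thus ?thesis
    using U.discrete_valuation_axioms v2 U.vge_integral U.v_outside by (intro exI[of _ U.v]) auto
qed

section \<open>Frobenius powers modulo a prime ideal\<close>

lemma (in subring_ideal) frobenius_add:
  assumes l: "prime l" "of_nat l \<in> I" and xy: "x \<in> A" "y \<in> A"
  shows "(x + y) ^ (l ^ k) \<approx> x ^ (l ^ k) + y ^ (l ^ k)"
proof (induction k)
  case 0 show ?case by simp
next
  case (Suc k)
  have base: "(u + w) ^ l \<approx> u ^ l + w ^ l" if uw: "u \<in> A" "w \<in> A" for u w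
  proof -
    let ?t = "\<lambda>i. of_nat (l choose i) * u ^ i * w ^ (l - i)"
    have "(u + w) ^ l = sum ?t {..l}" by (rule binomial_ring)
    also have "{..l} = insert 0 (insert l {0<..<l})" using prime_gt_0_nat[OF l(1)] by auto
    also have "sum ?t \<dots> = w ^ l + (u ^ l + sum ?t {0<..<l})"
      using prime_gt_0_nat[OF l(1)] by simp
    finally have "(u + w) ^ l - (u ^ l + w ^ l) = sum ?t {0<..<l}" by simp
    moreover have "sum ?t {0<..<l} \<in> I"
    proof (rule ideal_sum)
      fix i assume i: "i \<in> {0<..<l}"
      hence "l dvd l choose i" by (intro dvd_choose_prime l(1)) auto
      then obtain c where c: "l choose i = l * c" by blast
      have "of_nat c * u ^ i * w ^ (l - i) \<in> A"
        using uw by (intro mult_closed of_nat_closed power_closed)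
      from ideal_mult[OF this l(2)] show "?t i \<in> I" by (simp add: c mult_ac)
    qed
    ultimately show ?thesis by (simp add: cong_def)
  qed
  have "(x + y) ^ (l ^ Suc k) = ((x + y) ^ (l ^ k)) ^ l" by (simp add: mult.commute flip: power_mult)
  also have "\<dots> \<approx> (x ^ (l ^ k) + y ^ (l ^ k)) ^ l"
    using xy by (intro cong_power Suc add_closed power_closed)
  also have "\<dots> \<approx> (x ^ (l ^ k)) ^ l + (y ^ (l ^ k)) ^ l"
    using xy by (intro base power_closed)
  also have "\<dots> = x ^ (l ^ Suc k) + y ^ (l ^ Suc k)" by (simp add: mult.commute flip: power_mult)
  finally show ?case .
qed

context subring_prime begin

lemma cong_square_imp:
  assumes "x \<in> A" "y \<in> A" "x\<^sup>2 \<approx> y\<^sup>2"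
  shows "x \<approx> y \<or> x \<approx> - y"
proof -
  have "(x - y) * (x + y) \<in> I" using assms(3) by (simp add: cong_def power2_eq_square algebra_simps)
  thus ?thesis using prime[of "x - y" "x + y"] assms diff_closed add_closed
    by (auto simp: cong_def)
qed

lemma synthetic_div_closed:
  "(\<And>i. coeff p i \<in> A) \<Longrightarrow> c \<in> A \<Longrightarrow> coeff (synthetic_div p c) i \<in> A"
proof (induction p arbitrary: i)
  case 0 thus ?case by (simp add: zero_closed)
next
  case (pCons a p)
  have p: "\<And>i. coeff p i \<in> A" using pCons.prems(1)[of "Suc _"] by simp
  show ?case using pCons.IH[OF p pCons.prems(2)] poly_closed[OF p pCons.prems(2)]
    by (simp add: coeff_pCons split: nat.split)
qed

lemma card_roots_le:
  assumes "\<And>i. coeff p i \<in> A" "lead_coeff p = 1" "finite S" "S \<subseteq> A"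
    and "\<And>s. s \<in> S \<Longrightarrow> poly p s \<in> I"
    and "\<And>s t. s \<in> S \<Longrightarrow> t \<in> S \<Longrightarrow> s - t \<in> I \<Longrightarrow> s = t"
  shows "card S \<le> degree p"
  using assms
proof (induction "degree p" arbitrary: p S)
  case 0
  hence "p = 1" by (metis degree_eq_zeroE one_pCons coeff_pCons_0)
  hence "S = {}" using 0 one_notin by auto
  thus ?case by simp
next
  case (Suc N)
  show ?case
  proof (cases "S = {}")
    case False
    then obtain s where s: "s \<in> S" by blast
    define q where "q = synthetic_div p s"
    have pq: "p = [:- s, 1:] * q + [:poly p s:]"
      using synthetic_div_correct'[of s p] by (simp add: q_def)
    have dq: "degree q = N" using Suc.hyps(2) by (simp add: q_def degree_synthetic_div)
    have sA: "s \<in> A" using s Suc.prems by blast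
    have "lead_coeff q = 1"
    proof -
      have "coeff p (Suc N) = coeff q N - s * coeff q (Suc N)"
        by (subst pq) (simp add: coeff_pCons)
      thus ?thesis using Suc.prems(2) Suc.hyps(2) dq by (simp add: coeff_eq_0)
    qed
    moreover have "coeff q i \<in> A" for i
      unfolding q_def by (rule synthetic_div_closed) (use Suc.prems sA in auto)
    moreover have "poly q t \<in> I" if t: "t \<in> S - {s}" for t
    proof -
      have tA: "t \<in> A" using t Suc.prems by blast
      have "poly p t = (t - s) * poly q t + poly p s" by (subst pq) (simp add: algebra_simps)
      moreover have "poly p t \<in> I" "poly p s \<in> I" using Suc.prems(5) t s by auto
      ultimately have "(t - s) * poly q t \<in> I"
        using ideal_diff[of "poly p t" "poly p s"] by simp
      moreover have "t - s \<notin> I" using Suc.prems(6)[of t s] t s by blast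
      moreover have "poly q t \<in> A"
        by (intro poly_closed tA) (use \<open>\<And>i. coeff q i \<in> A\<close> in blast)
      ultimately show ?thesis using prime[of "t - s" "poly q t"] diff_closed[OF tA sA] by blast
    qed
    ultimately have "card (S - {s}) \<le> degree q"
      using Suc.prems(3,4,6) dq by (intro Suc.hyps(1)) auto
    thus ?thesis using s Suc.prems(3) Suc.hyps(2) dq by (simp add: card_Diff_singleton)
  qed simp
qed

lemma fixed_by_power:
  assumes "c \<in> A" "c ^ q \<approx> c"
  shows "c ^ (q ^ e) \<approx> c"
proof (induction e)
  case 0 show ?case by simp
next
  case (Suc e)
  have "c ^ (q ^ Suc e) = (c ^ (q ^ e)) ^ q" by (simp add: mult.commute flip: power_mult)
  also have "\<dots> \<approx> c ^ q" using assms by (intro cong_power Suc power_closed)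
  also have "\<dots> \<approx> c" by (rule assms(2))
  finally show ?case .
qed

lemma power_of_square_root:
  assumes y: "y \<in> A" "(y\<^sup>2) ^ Q \<approx> y\<^sup>2"
  shows "y ^ Q \<approx> y \<or> y ^ Q \<approx> - y"
proof -
  have "(y ^ Q)\<^sup>2 = (y\<^sup>2) ^ Q" by (simp add: mult.commute flip: power_mult)
  also have "\<dots> \<approx> y\<^sup>2" by (rule y(2))
  finally show ?thesis using y(1) by (intro cong_square_imp power_closed)
qed

lemma power_twice_of_square_root:
  assumes y: "y \<in> A" "y ^ Q \<approx> y \<or> y ^ Q \<approx> - y" and sign: "(- 1) ^ Q \<approx> - 1"
  shows "y ^ (Q * Q) \<approx> y"
proof -
  consider "y ^ Q \<approx> y" | "y ^ Q \<approx> - y" using y(2) by blast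
  hence "(y ^ Q) ^ Q \<approx> y"
  proof cases
    case 1
    have "(y ^ Q) ^ Q \<approx> y ^ Q" using 1 y(1) by (intro cong_power power_closed)
    also note 1
    finally show ?thesis .
  next
    case 2
    have "(y ^ Q) ^ Q \<approx> (- y) ^ Q" using 2 y(1) by (intro cong_power power_closed uminus_closed)
    also have "(- y) ^ Q = (- 1) ^ Q * y ^ Q" by (rule power_minus)
    also have "\<dots> \<approx> - 1 * - y"
      using 2 y(1) by (intro cong_mult sign power_closed uminus_closed one_closed)
    finally show ?thesis by simp
  qed
  thus ?thesis by (simp add: power_mult)
qed

text \<open>The finite field argument, in the domain \<open>A / I\<close>; the elements of \<open>C\<close> play the role of constants
  from the field with $q$ elements.  The $z_k$ are the iterates of $x^2 + m$ at $x$, with $z_n = -\<gamma>$, and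
  the $a_k$ its iterates at 0.  If $x$ is not fixed by the $2^{n-1}$-th power of the Frobenius map,
  then each step $z_k = \<surd>(z_{k+1} - m)$ is a proper quadratic extension, and for $k + j = n - 1$ the
  $2^j$-th power of Frobenius maps $z_k$ to $-z_k$ (fact \<open>neg\<close>).  Therefore
  $a_{k+1} - z_{k+1} = (a_k - z_k)(a_k + z_k) = (a_k - z_k)^{1 + q^{2^j}}$,
  which telescopes to $t^2 = a_n + \<gamma> = (-x^2)^e$ with
  $e = \<Prod>_{j < n-1} (1 + q^{2^j}) = (q^{2^{n-1}} - 1)/(q - 1)$.  The sign disappears as $1 + q$ divides $e$
  for $n \<ge> 2$, and $x^e = \<plusminus>t$ lies in the field with $q$ elements.  But $(x^e)^{q-1} = 1$ means
  that $x$ is fixed after all.\<close>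

theorem square_value_imp_frobenius_fixed:
  fixes q l r n :: nat
  assumes q: "q = l ^ r" and l: "prime l" "of_nat l \<in> I"
    and x: "x \<in> A"
    and C: "\<And>c. c \<in> C \<Longrightarrow> c \<in> A \<and> c ^ q \<approx> c" "m \<in> C" "- \<gamma> - m \<in> C" "t \<in> C" "- 1 \<in> C"
      "\<And>k. a k \<in> C"
    and z: "z 0 = x" "\<And>k. z (Suc k) = (z k)\<^sup>2 + m" "z n \<approx> - \<gamma>"
    and a: "a 0 = 0" "\<And>k. a (Suc k) = (a k)\<^sup>2 + m" "a n + \<gamma> \<approx> t\<^sup>2"
    and n: "n \<ge> 2"
  shows "x ^ (q ^ 2 ^ (n - 1)) \<approx> x"
proof (rule ccontr)
  assume not_fixed: "\<not> ?thesis"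
  have CA: "c \<in> A" if "c \<in> C" for c using C(1) that by blast
  have C_fixed: "c ^ (q ^ e) \<approx> c" if "c \<in> C" for c e using C(1)[OF that] fixed_by_power by blast
  have sign: "(- 1) ^ (q ^ e) \<approx> - 1" for e using C_fixed C(5) by blast
  have frob: "(u + w) ^ (q ^ e) \<approx> u ^ (q ^ e) + w ^ (q ^ e)" if "u \<in> A" "w \<in> A" for u w e
    using frobenius_add[OF l that, of "r * e"] by (simp add: q power_mult)
  have zA: "z k \<in> A" for k
    by (induction k) (use z x CA C in \<open>auto intro!: add_closed power_closed\<close>)
  have sq: "q ^ 2 ^ Suc j = q ^ 2 ^ j * q ^ 2 ^ j" for j
    by (simp add: mult_2 flip: power_add)

  have square_fixed: "((z k)\<^sup>2) ^ (q ^ e) \<approx> (z k)\<^sup>2" if "z (Suc k) ^ (q ^ e) \<approx> z (Suc k)" for k e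
  proof -
    have mm: "- m \<in> A" "(- m) ^ (q ^ e) \<approx> - m"
    proof -
      have "(- m) ^ (q ^ e) = (- 1) ^ (q ^ e) * m ^ (q ^ e)" by (rule power_minus)
      also have "\<dots> \<approx> - 1 * m"
        by (intro cong_mult sign C_fixed C power_closed uminus_closed one_closed CA)
      finally show "(- m) ^ (q ^ e) \<approx> - m" by simp
      show "- m \<in> A" using CA C uminus_closed by blast
    qed
    have zk: "(z k)\<^sup>2 = z (Suc k) + - m" by (simp add: z)
    have "((z k)\<^sup>2) ^ (q ^ e) \<approx> z (Suc k) ^ (q ^ e) + (- m) ^ (q ^ e)"
      unfolding zk by (intro frob zA mm)
    also have "\<dots> \<approx> z (Suc k) + - m" by (intro cong_add that mm)
    finally show ?thesis unfolding zk .
  qed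
  have step: "z k ^ (q ^ 2 ^ j) \<approx> z k \<or> z k ^ (q ^ 2 ^ j) \<approx> - z k"
    if "z (Suc k) ^ (q ^ 2 ^ j) \<approx> z (Suc k)" for k j
    using power_of_square_root[OF zA square_fixed[OF that]] .
  have twice: "z k ^ (q ^ 2 ^ Suc j) \<approx> z k"
    if "z k ^ (q ^ 2 ^ j) \<approx> z k \<or> z k ^ (q ^ 2 ^ j) \<approx> - z k" for k j
    unfolding sq by (rule power_twice_of_square_root[OF zA that sign])

  \<comment> \<open>If some \<open>z k\<close> were fixed, the square roots taken below it would stay fixed by the doubled powers,
    and so would \<open>z 0 = x\<close>.\<close>
  have not_fixed': "\<not> z k ^ (q ^ 2 ^ j) \<approx> z k" if "k + j = n - 1" for k j
    using that
  proof (induction k arbitrary: j)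
    case 0 thus ?case using not_fixed z by simp
  next
    case (Suc k)
    thus ?case using twice[OF step[of k j]] Suc.IH[of "Suc j"] by auto
  qed
  have neg: "z k ^ (q ^ 2 ^ j) \<approx> - z k" if "k + j = n - 1" for k j
    using that
  proof (induction j arbitrary: k)
    case 0
    hence k: "n = Suc k" using n by simp
    have "(z k)\<^sup>2 \<approx> - \<gamma> - m"
      using z(3) unfolding k z(2) by (simp add: cong_def algebra_simps)
    moreover have "(- \<gamma> - m) ^ (q ^ 2 ^ 0) \<approx> - \<gamma> - m" using C_fixed C(3) by blast
    ultimately have "((z k)\<^sup>2) ^ (q ^ 2 ^ 0) \<approx> (z k)\<^sup>2"
      by (meson CA C(3) cong_power cong_sym cong_trans power_closed zA)
    from power_of_square_root[OF zA this] show ?case using not_fixed' 0 by blast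
  next
    case (Suc j)
    hence "z (Suc k) ^ (q ^ 2 ^ j) \<approx> - z (Suc k)" by simp
    hence "z (Suc k) ^ (q ^ 2 ^ Suc j) \<approx> z (Suc k)" using twice by blast
    from step[OF this] show ?case using not_fixed' Suc.prems by blast
  qed

  \<comment> \<open>The norm from the field generated by \<open>z (n - i)\<close> down to that of the constants has exponent \<open>E i\<close>.\<close>
  define E where "E i = (\<Prod>j<i. 1 + q ^ 2 ^ j)" for i
  have norm: "a n - z n \<approx> (a (n - i) - z (n - i)) ^ E i" if "i < n" for i
    using that
  proof (induction i)
    case 0 show ?case by (simp add: E_def)
  next
    case (Suc i)
    define k where "k = n - Suc i"
    have k: "n - i = Suc k" "k + i = n - 1" using Suc.prems by (auto simp: k_def)
    let ?Q = "q ^ 2 ^ i"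
    have akA: "a k \<in> A" using CA C by blast
    have "(a k - z k) ^ ?Q \<approx> a k + z k"
    proof -
      have "(- z k) ^ ?Q = (- 1) ^ ?Q * z k ^ ?Q" by (rule power_minus)
      also have "\<dots> \<approx> - 1 * - z k"
        by (intro cong_mult sign neg k power_closed uminus_closed one_closed zA)
      finally have 1: "(- z k) ^ ?Q \<approx> z k" by simp
      have "(a k + - z k) ^ ?Q \<approx> a k ^ ?Q + (- z k) ^ ?Q"
        by (intro frob akA uminus_closed zA)
      also have "\<dots> \<approx> a k + z k" by (intro cong_add 1 C_fixed C)
      finally show ?thesis by simp
    qed
    hence "(a k - z k) * (a k + z k) \<approx> (a k - z k) * (a k - z k) ^ ?Q"
      by (intro cong_mult cong_refl) (auto intro: cong_sym diff_closed power_closed akA zA)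
    moreover have "a (Suc k) - z (Suc k) = (a k - z k) * (a k + z k)"
      by (simp add: a z power2_eq_square algebra_simps)
    ultimately have "a (Suc k) - z (Suc k) \<approx> (a k - z k) ^ (1 + ?Q)" by simp
    hence "(a (Suc k) - z (Suc k)) ^ E i \<approx> ((a k - z k) ^ (1 + ?Q)) ^ E i"
      by (intro cong_power power_closed diff_closed zA CA C)
    moreover have "E (Suc i) = (1 + ?Q) * E i" by (simp add: E_def mult.commute)
    hence "((a k - z k) ^ (1 + ?Q)) ^ E i = (a k - z k) ^ E (Suc i)"
      by (simp only: power_mult)
    moreover have "a n - z n \<approx> (a (Suc k) - z (Suc k)) ^ E i" using Suc k by simp
    ultimately show ?case unfolding k_def[symmetric] using cong_trans by simp
  qed
  define e where "e = E (n - 1)"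
  have "t\<^sup>2 \<approx> a n - z n"
  proof -
    have "a n - z n \<approx> a n - - \<gamma>" by (intro cong_diff cong_refl z(3))
    hence "a n - z n \<approx> a n + \<gamma>" by simp
    from cong_trans[OF this a(3)] show ?thesis by (rule cong_sym)
  qed
  also have "\<dots> \<approx> (a 1 - z 1) ^ e" using norm[of "n - 1"] n by (simp add: e_def)
  also have "a 1 - z 1 = - (x\<^sup>2)" by (simp add: a z)
  also have "(- (x\<^sup>2)) ^ e = (- 1) ^ e * (x ^ e)\<^sup>2"
    by (simp add: power_minus[of "x\<^sup>2"] mult.commute flip: power_mult)
  also have "\<dots> \<approx> 1 * (x ^ e)\<^sup>2"
  proof (intro cong_mult cong_refl power_closed x uminus_closed one_closed)
    have "(- 1 :: 'a) ^ (1 + q) = - 1 * (- 1) ^ q" by simp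
    also have "\<dots> \<approx> - 1 * - 1"
      using sign[of 1] by (intro cong_mult cong_refl uminus_closed one_closed) simp
    finally have "(- 1) ^ (1 + q) \<approx> 1" by simp
    moreover have "1 + q dvd e"
      unfolding e_def E_def using dvd_prodI[of "{..<n - 1}" 0 "\<lambda>j. 1 + q ^ 2 ^ j"] n by simp
    then obtain d where "e = (1 + q) * d" by blast
    hence "(- 1 :: 'a) ^ e = ((- 1) ^ (1 + q)) ^ d" by (simp only: power_mult)
    ultimately show "(- 1) ^ e \<approx> 1"
      using cong_power[of "(- 1) ^ (1 + q)" 1 d] by (metis one_closed power_closed power_one uminus_closed)
  qed
  finally have "t\<^sup>2 \<approx> (x ^ e)\<^sup>2" by simp
  hence "(x ^ e)\<^sup>2 \<approx> t\<^sup>2" by (rule cong_sym)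
  hence xt: "x ^ e \<approx> t \<or> x ^ e \<approx> - t" using x CA C by (intro cong_square_imp power_closed) auto
  have xe: "(x ^ e) ^ q \<approx> x ^ e"
  proof -
    have tA: "t \<in> A" using CA C by blast
    have tq: "t ^ q \<approx> t" using C by blast
    have mtq: "(- t) ^ q \<approx> - t"
    proof -
      have "(- t) ^ q = (- 1) ^ q * t ^ q" by (rule power_minus)
      also have "\<dots> \<approx> - 1 * t"
        using sign[of 1] by (intro cong_mult tq power_closed uminus_closed one_closed tA) simp
      finally show ?thesis by simp
    qed
    obtain t' where t': "x ^ e \<approx> t'" "t' ^ q \<approx> t'" "t' \<in> A"
      using xt tq mtq tA uminus_closed by blast
    have "(x ^ e) ^ q \<approx> t' ^ q" by (intro cong_power t' power_closed x)
    also note t'(2)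
    also have "t' \<approx> x ^ e" by (rule cong_sym[OF t'(1)])
    finally show ?thesis .
  qed
  let ?Q = "q ^ 2 ^ (n - 1)"
  have E_eq: "E i * q + 1 = q ^ 2 ^ i + E i" for i
  proof (induction i)
    case 0 show ?case by (simp add: E_def)
  next
    case (Suc i)
    have "E (Suc i) * q + 1 = E i * q + E i * q * q ^ 2 ^ i + 1"
      by (simp add: E_def algebra_simps)
    also have "\<dots> + q ^ 2 ^ i = (E i * q + 1) * (1 + q ^ 2 ^ i)" by (simp add: algebra_simps)
    also have "\<dots> = q ^ 2 ^ Suc i + E (Suc i) + q ^ 2 ^ i"
      unfolding Suc sq by (simp add: E_def algebra_simps)
    finally show ?case by simp
  qed
  have "x ^ ?Q * x ^ e = (x ^ e) ^ q * x"
    using E_eq[of "n - 1"] unfolding e_def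
    by (metis power_add power_mult power_one_right)
  also have "\<dots> \<approx> x ^ e * x" by (intro cong_mult xe cong_refl power_closed x)
  finally have 1: "x ^ ?Q * x ^ e \<approx> x ^ e * x" .
  have xneg: "x ^ ?Q \<approx> - x" using neg[of 0 "n - 1"] z by simp
  hence "x ^ ?Q * x ^ e \<approx> - x * x ^ e" by (intro cong_mult cong_refl power_closed x)
  from cong_trans[OF cong_sym[OF this] 1] have "- x * x ^ e - x ^ e * x \<in> I"
    by (simp add: cong_def)
  hence "- (- x * x ^ e - x ^ e * x) \<in> I" by (rule ideal_uminus)
  hence "2 * x ^ Suc e \<in> I" by (simp add: cong_def algebra_simps)
  hence "2 \<in> I \<or> x \<in> I"
    using prime[of 2 "x ^ Suc e"] of_nat_closed[of 2] power_closed[OF x, of "Suc e"]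
      power_in[OF x, of "Suc e"] by auto
  \<comment> \<open>Either case makes \<open>x\<close> and \<open>- x\<close> congruent, also in characteristic 2.\<close>
  hence "- x \<approx> x"
    using ideal_uminus[OF ideal_mult_right[OF x, of 2]] ideal_uminus[OF ideal_mult[OF of_nat_closed[of 2], of x]]
    by (auto simp: cong_def algebra_simps)
  from cong_trans[OF xneg this] not_fixed show False by blast
qed

end

section \<open>Polynomials modulo a prime with finite residue field\<close>

definition coeffs_in :: "'a::zero set \<Rightarrow> 'a poly set" where
  "coeffs_in S = {p. \<forall>i. coeff p i \<in> S}"

lemma coeffs_inD: "p \<in> coeffs_in S \<Longrightarrow> coeff p i \<in> S"
  by (simp add: coeffs_in_def)

lemma (in comm_subring) coeffs_in_comm_subring: "comm_subring (coeffs_in A)"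
  by unfold_locales
     (auto simp: coeffs_in_def coeff_mult intro!: closed split: if_splits)

lemma (in subring_ideal) coeffs_in_subring_ideal: "subring_ideal (coeffs_in A) (coeffs_in I)"
proof -
  interpret P: comm_subring "coeffs_in A" by (rule coeffs_in_comm_subring)
  show ?thesis
  proof
    show "a * x \<in> coeffs_in I" if "a \<in> coeffs_in A" "x \<in> coeffs_in I" for a x
      using that by (auto simp: coeffs_in_def coeff_mult intro!: ideal_sum ideal_mult)
  qed (use ideal_sub ideal_zero ideal_diff in \<open>auto simp: coeffs_in_def\<close>)
qed

context comm_subring begin

lemma coeffs_in_pCons: "pCons a p \<in> coeffs_in A \<longleftrightarrow> a \<in> A \<and> p \<in> coeffs_in A"
  by (force simp: coeffs_in_def coeff_pCons split: nat.splits)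

lemma coeffs_in_monom: "a \<in> A \<Longrightarrow> monom a i \<in> coeffs_in A"
  by (auto simp: coeffs_in_def zero_closed)

lemma coeffs_in_pcompose:
  assumes "p \<in> coeffs_in A" "r \<in> coeffs_in A"
  shows "pcompose p r \<in> coeffs_in A"
proof -
  interpret P: comm_subring "coeffs_in A" by (rule coeffs_in_comm_subring)
  show ?thesis using assms(1)
    by (induction p)
       (auto simp: pcompose_pCons coeffs_in_pCons P.zero_closed zero_closed
         intro!: P.add_closed P.mult_closed assms(2))
qed

lemma monic_division:
  assumes g: "g \<in> coeffs_in A" "lead_coeff g = 1" and h: "h \<in> coeffs_in A"
  shows "\<exists>k\<in>coeffs_in A. h - k * g = 0 \<or> degree (h - k * g) < degree g"
  using h
proof (induction "degree h" arbitrary: h rule: less_induct)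
  case less
  interpret P: comm_subring "coeffs_in A" by (rule coeffs_in_comm_subring)
  show ?case
  proof (cases "degree h < degree g \<or> h = 0")
    case True
    thus ?thesis using P.zero_closed by (intro bexI[of _ 0]) auto
  next
    case False
    define k where "k = monom (lead_coeff h) (degree h - degree g)"
    have kA: "k \<in> coeffs_in A"
      unfolding k_def using less.prems by (intro coeffs_in_monom) (simp add: coeffs_in_def)
    define h' where "h' = h - k * g"
    have h'A: "h' \<in> coeffs_in A"
      unfolding h'_def by (intro P.diff_closed P.mult_closed kA g less.prems)
    have "degree h' \<le> degree h" unfolding h'_def
      by (intro degree_diff_le order.refl)
         (metis (no_types, lifting) False degree_monom_le degree_mult_le k_def le_add_diff_inverse2
           linorder_not_less add_right_mono order_trans)
    moreover have "coeff h' (degree h) = 0"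
      using False g(2) by (simp add: h'_def k_def coeff_monom_mult)
    ultimately consider "h' = 0" | "degree h' < degree h"
      by (metis eq_zero_or_degree_less)
    thus ?thesis
    proof cases
      case 1
      thus ?thesis using kA by (intro bexI[of _ k]) (auto simp: h'_def)
    next
      case 2
      then obtain k' where k': "k' \<in> coeffs_in A"
        "h' - k' * g = 0 \<or> degree (h' - k' * g) < degree g" using less.hyps[OF 2 h'A] by blast
      have "h' - k' * g = h - (k + k') * g" by (simp add: h'_def algebra_simps)
      thus ?thesis using k' P.add_closed[OF kA k'(1)] by (intro bexI[of _ "k + k'"]) auto
    qed
  qed
qed

end

text \<open>Reducibility of $p$ in $(A/I)[x]$, expressed by lifts.  The condition on the leading coefficients
  ensures that the lifts have the degree of the factors that they represent.\<close>

definition splits_mod :: "'a::comm_ring_1 set \<Rightarrow> 'a set \<Rightarrow> 'a poly \<Rightarrow> bool" where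
  "splits_mod A I p \<longleftrightarrow> (\<exists>b\<in>coeffs_in A. \<exists>c\<in>coeffs_in A.
     degree b > 0 \<and> degree c > 0 \<and> lead_coeff b \<notin> I \<and> lead_coeff c \<notin> I \<and> p - b * c \<in> coeffs_in I)"

context subring_ideal begin

lemma strip_leading_terms:
  assumes "p \<in> coeffs_in A" "p \<notin> coeffs_in I"
  shows "\<exists>p'\<in>coeffs_in A. lead_coeff p' \<notin> I \<and> p - p' \<in> coeffs_in I \<and> degree p' \<le> degree p"
  using assms
proof (induction "degree p" arbitrary: p rule: less_induct)
  case less
  interpret P: subring_ideal "coeffs_in A" "coeffs_in I" by (rule coeffs_in_subring_ideal)
  show ?case
  proof (cases "lead_coeff p \<in> I")
    case False
    thus ?thesis using less.prems P.ideal_zero by (intro bexI[of _ p]) auto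
  next
    case True
    define d where "d = monom (lead_coeff p) (degree p)"
    have dI: "d \<in> coeffs_in I" using True ideal_zero by (auto simp: d_def coeffs_in_def)
    define p' where "p' = p - d"
    have p'A: "p' \<in> coeffs_in A" unfolding p'_def
      by (intro P.diff_closed less.prems P.ideal_in dI)
    have p'I: "p' \<notin> coeffs_in I"
      using less.prems(2) P.ideal_add[OF _ dI, of p'] by (auto simp: p'_def)
    have "degree p' \<le> degree p" unfolding p'_def d_def
      by (intro degree_diff_le order.refl degree_monom_le)
    moreover have "coeff p' (degree p) = 0" by (simp add: p'_def d_def)
    moreover have "p' \<noteq> 0" using p'I P.ideal_zero by auto
    ultimately have deg: "degree p' < degree p" by (metis eq_zero_or_degree_less)
    obtain s where s: "s \<in> coeffs_in A" "lead_coeff s \<notin> I" "p' - s \<in> coeffs_in I"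
      "degree s \<le> degree p'" using less.hyps[OF deg p'A p'I] by blast
    have "p - s = (p' - s) + d" by (simp add: p'_def)
    hence "p - s \<in> coeffs_in I" using P.ideal_add[OF s(3) dI] by metis
    moreover have "degree s \<le> degree p" using s(4) deg by simp
    ultimately show ?thesis using s(1,2) by blast
  qed
qed

end

text \<open>A prime ideal with finite residue field, of order $q = l^r$.  It matters that $q$ is the exact number
  of residue classes and a power of the characteristic $l$: the first fact is used for counting and the
  second one for the Frobenius map.\<close>

locale finite_residue_prime = subring_prime A I
  for A I :: "'a::idom set" +
  fixes T and l r q :: nat
  assumes T: "residue_system T" and q: "q = card T" "q = l ^ r"
    and l: "prime l" "of_nat l \<in> I"
begin

lemma finite_T: "finite T" and T_in: "t \<in> T \<Longrightarrow> t \<in> A"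
  and T_cong: "a \<in> A \<Longrightarrow> \<exists>t\<in>T. a \<approx> t"
  and T_unique: "t \<in> T \<Longrightarrow> t' \<in> T \<Longrightarrow> t \<approx> t' \<Longrightarrow> t = t'"
  using T by (auto simp: residue_system_def cong_def)

lemma q_ge_2: "q \<ge> 2"
proof -
  obtain t0 t1 where t: "t0 \<in> T" "0 \<approx> t0" "t1 \<in> T" "1 \<approx> t1"
    using T_cong zero_closed one_closed by meson
  have "t0 \<noteq> t1"
  proof
    assume "t0 = t1"
    hence "1 \<approx> 0" using t cong_trans cong_sym by metis
    thus False using one_notin by (simp add: cong_def)
  qed
  hence "card {t0, t1} = 2" by simp
  thus ?thesis unfolding q(1) using card_mono[OF finite_T, of "{t0, t1}"] t by simp
qed

text \<open>Multiplication by \<open>a\<close> permutes the nonzero residue classes, so it does not change their product.\<close>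

lemma fermat_unit:
  assumes a: "a \<in> A - I"
  shows "a ^ (q - 1) \<approx> 1"
proof -
  define U where "U = {t \<in> T. t \<notin> I}"
  have UA: "t \<in> A - I" if "t \<in> U" for t using that T_in by (auto simp: U_def)
  have finU: "finite U" using finite_T by (simp add: U_def)
  obtain t0 where t0: "t0 \<in> T" "0 \<approx> t0" using T_cong zero_closed by blast
  have "T - U = {t0}"
  proof -
    have "t0 \<in> I" using t0 ideal_uminus by (fastforce simp: cong_def)
    moreover have "t = t0" if "t \<in> T" "t \<in> I" for t
      using T_unique[OF that(1) t0(1)] ideal_diff[OF that(2) \<open>t0 \<in> I\<close>] by (simp add: cong_def)
    ultimately show ?thesis using t0(1) unfolding U_def by blast
  qed
  moreover have "card (T - U) = card T - card U"
    by (rule card_Diff_subset) (use finU in \<open>auto simp: U_def\<close>)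
  moreover have "card U \<le> card T" using finite_T by (intro card_mono) (auto simp: U_def)
  ultimately have cardU: "card U = q - 1" using q by simp
  have "\<exists>s\<in>U. a * t \<approx> s" if t: "t \<in> U" for t
  proof -
    have at: "a * t \<in> A - I" by (rule outside_mult[OF a UA[OF t]])
    then obtain s where s: "s \<in> T" "a * t \<approx> s" using T_cong by blast
    have "s \<notin> I" using at ideal_add[of "a * t - s" s] s by (auto simp: cong_def)
    thus ?thesis using s by (auto simp: U_def)
  qed
  then obtain \<sigma> where \<sigma>: "\<And>t. t \<in> U \<Longrightarrow> \<sigma> t \<in> U" "\<And>t. t \<in> U \<Longrightarrow> a * t \<approx> \<sigma> t" by metis
  have inj: "inj_on \<sigma> U"
  proof (rule inj_onI)
    fix s t assume st: "s \<in> U" "t \<in> U" "\<sigma> s = \<sigma> t"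
    hence "a * s \<approx> a * t" using \<sigma>(2) cong_sym cong_trans by metis
    hence "a * (s - t) \<in> I" by (simp add: cong_def right_diff_distrib)
    hence "s - t \<in> I" using prime[of a "s - t"] a UA st diff_closed by auto
    thus "s = t" using st by (intro T_unique) (auto simp: U_def cong_def)
  qed
  have img: "\<sigma> ` U = U"
    by (rule card_subset_eq[OF finU]) (use \<sigma>(1) inj in \<open>auto simp: card_image\<close>)
  have "a ^ (q - 1) * \<Prod>U = (\<Prod>t\<in>U. a * t)" by (simp add: prod.distrib cardU)
  also have "\<dots> \<approx> (\<Prod>t\<in>U. \<sigma> t)"
    using \<sigma> a UA by (intro cong_prod) (auto intro: mult_closed)
  also have "\<dots> = \<Prod>U" using prod.reindex[OF inj, of "\<lambda>x. x"] img by simp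
  finally have "(a ^ (q - 1) - 1) * \<Prod>U \<in> I" by (simp add: cong_def left_diff_distrib)
  moreover have "\<Prod>U \<in> A - I"
    using finU UA by (induction U rule: finite_induct) (auto simp: one_closed one_notin dest: prime intro: mult_closed)
  ultimately show ?thesis
    using prime[of "a ^ (q - 1) - 1" "\<Prod>U"] a by (auto simp: cong_def closed)
qed

lemma fermat:
  assumes "a \<in> A"
  shows "a ^ q \<approx> a"
proof (cases "a \<in> I")
  case True
  thus ?thesis using q_ge_2 ideal_power[OF True, of q] by (auto simp: cong_def intro: ideal_diff)
next
  case False
  have "a * a ^ (q - 1) \<approx> a * 1"
    using assms False by (intro cong_mult fermat_unit one_closed) auto
  moreover have "a ^ q = a * a ^ (q - 1)" using q_ge_2 by (simp flip: power_Suc)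
  ultimately show ?thesis by simp
qed

lemma inverse_exists:
  assumes "a \<in> A - I"
  shows "\<exists>z\<in>A. z * a \<approx> 1"
proof -
  have "a ^ (q - 1) = a ^ (q - 2) * a" using q_ge_2
    by (metis Suc_1 Suc_diff_Suc Suc_le_lessD power_Suc2)
  thus ?thesis using fermat_unit[OF assms] assms power_closed by auto
qed

end

context finite_residue_prime begin

text \<open>The ideal of $A[x]$ generated by $I$ and $G$; modulo this ideal one computes in
  $(A/I)[x]/(G)$.\<close>

definition quot_ideal :: "'a poly \<Rightarrow> 'a poly set" where
  "quot_ideal G = {h \<in> coeffs_in A. \<exists>k\<in>coeffs_in A. h - k * G \<in> coeffs_in I}"

lemma quot_ideal_subring_ideal:
  assumes "G \<in> coeffs_in A"
  shows "subring_ideal (coeffs_in A) (quot_ideal G)"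
proof -
  interpret P: subring_ideal "coeffs_in A" "coeffs_in I" by (rule coeffs_in_subring_ideal)
  show ?thesis
  proof
    show "quot_ideal G \<subseteq> coeffs_in A" by (auto simp: quot_ideal_def)
    show "0 \<in> quot_ideal G"
      using P.zero_closed P.ideal_zero by (auto simp: quot_ideal_def intro!: bexI[of _ 0])
    show "x - y \<in> quot_ideal G" if xy: "x \<in> quot_ideal G" "y \<in> quot_ideal G" for x y
    proof -
      obtain k k' where k: "k \<in> coeffs_in A" "x - k * G \<in> coeffs_in I"
        "k' \<in> coeffs_in A" "y - k' * G \<in> coeffs_in I" using xy by (auto simp: quot_ideal_def)
      have "(x - y) - (k - k') * G = (x - k * G) - (y - k' * G)" by (simp add: algebra_simps)
      hence "(x - y) - (k - k') * G \<in> coeffs_in I" using P.ideal_diff[OF k(2,4)] by metis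
      thus ?thesis using xy k P.diff_closed unfolding quot_ideal_def by blast
    qed
    show "a * x \<in> quot_ideal G" if ax: "a \<in> coeffs_in A" "x \<in> quot_ideal G" for a x
    proof -
      obtain k where k: "k \<in> coeffs_in A" "x - k * G \<in> coeffs_in I"
        using ax by (auto simp: quot_ideal_def)
      have "a * x - (a * k) * G = a * (x - k * G)" by (simp add: algebra_simps)
      hence "a * x - (a * k) * G \<in> coeffs_in I" using P.ideal_mult[OF ax(1) k(2)] by simp
      thus ?thesis using ax k P.mult_closed unfolding quot_ideal_def by blast
    qed
  qed
qed

lemma coeffs_in_ideal_quot: "h \<in> coeffs_in I \<Longrightarrow> h \<in> quot_ideal G"
proof -
  interpret P: subring_ideal "coeffs_in A" "coeffs_in I" by (rule coeffs_in_subring_ideal)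
  show "h \<in> coeffs_in I \<Longrightarrow> h \<in> quot_ideal G"
    using P.zero_closed P.ideal_in by (auto simp: quot_ideal_def intro!: bexI[of _ 0])
qed

lemma quot_ideal_low_degree:
  assumes G: "lead_coeff G = 1" "G \<in> coeffs_in A"
    and h: "h \<in> quot_ideal G" "degree h < degree G"
  shows "h \<in> coeffs_in I"
proof -
  interpret P: subring_ideal "coeffs_in A" "coeffs_in I" by (rule coeffs_in_subring_ideal)
  obtain k where k: "k \<in> coeffs_in A" "h - k * G \<in> coeffs_in I"
    using h by (auto simp: quot_ideal_def)
  show ?thesis
  proof (cases "k \<in> coeffs_in I")
    case True
    thus ?thesis using P.ideal_add[OF k(2) P.ideal_mult_right[OF G(2) True]] by simp
  next
    case False
    then obtain k' where k': "k' \<in> coeffs_in A" "lead_coeff k' \<notin> I" "k - k' \<in> coeffs_in I"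
      using strip_leading_terms[OF k(1)] by blast
    have "(h - k * G) + (k - k') * G \<in> coeffs_in I"
      by (intro P.ideal_add k P.ideal_mult_right k' G)
    moreover have "(h - k * G) + (k - k') * G = h - k' * G" by (simp add: algebra_simps)
    ultimately have "coeff (h - k' * G) (degree k' + degree G) \<in> I" by (simp add: coeffs_in_def)
    moreover have "coeff (h - k' * G) (degree k' + degree G) = - lead_coeff k'"
      using h(2) G(1) by (simp add: coeff_eq_0 coeff_mult_degree_sum)
    ultimately have "lead_coeff k' \<in> I" using ideal_uminus by fastforce
    thus ?thesis using k'(2) by blast
  qed
qed

text \<open>An irreducible polynomial over a field is prime.  Given a product $h_1 h_2$ in the ideal and $h_2$
  not in it, let $K$ be the ideal generated by $h_1$, $G$ and $I$.  An element of $K$ of least degree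
  modulo $I$ can be made monic and then divides $h_1$ and $G$ modulo $I$.  If it is constant, then
  $h_2$ is in the ideal, as $K = A[x]$; otherwise it is an associate of $G$, which therefore divides $h_1$.\<close>

theorem quot_ideal_prime:
  assumes G: "lead_coeff G = 1" "G \<in> coeffs_in A" "degree G > 0"
    and no_split: "\<not> splits_mod A I G"
  shows "subring_prime (coeffs_in A) (quot_ideal G)"
proof -
  interpret P: subring_ideal "coeffs_in A" "coeffs_in I" by (rule coeffs_in_subring_ideal)
  interpret J: subring_ideal "coeffs_in A" "quot_ideal G" by (rule quot_ideal_subring_ideal[OF G(2)])
  have GJ: "G \<in> quot_ideal G"
    using G P.one_closed P.ideal_zero by (auto simp: quot_ideal_def intro!: bexI[of _ 1])
  show ?thesis
  proof
    show "1 \<notin> quot_ideal G"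
    proof
      assume "1 \<in> quot_ideal G"
      hence "1 \<in> coeffs_in I" using quot_ideal_low_degree[OF G(1,2)] G(3) by simp
      thus False using one_notin by (auto dest: coeffs_inD[of _ _ 0])
    qed
    fix h1 h2 assume h: "h1 \<in> coeffs_in A" "h2 \<in> coeffs_in A" "h1 * h2 \<in> quot_ideal G"
    show "h1 \<in> quot_ideal G \<or> h2 \<in> quot_ideal G"
    proof (rule disjCI)
      assume h2: "h2 \<notin> quot_ideal G"
      define K where "K = {h \<in> coeffs_in A. \<exists>a\<in>coeffs_in A. h - a * h1 \<in> quot_ideal G}"
      have K_ideal: "subring_ideal (coeffs_in A) K"
      proof
        show "K \<subseteq> coeffs_in A" by (auto simp: K_def)
        show "0 \<in> K"
          using P.zero_closed J.ideal_zero by (auto simp: K_def intro!: bexI[of _ 0])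
        show "x - y \<in> K" if xy: "x \<in> K" "y \<in> K" for x y
        proof -
          obtain a b where ab: "a \<in> coeffs_in A" "x - a * h1 \<in> quot_ideal G"
            "b \<in> coeffs_in A" "y - b * h1 \<in> quot_ideal G" using xy by (auto simp: K_def)
          have "(x - y) - (a - b) * h1 = (x - a * h1) - (y - b * h1)" by (simp add: algebra_simps)
          hence "(x - y) - (a - b) * h1 \<in> quot_ideal G" using J.ideal_diff[OF ab(2,4)] by metis
          thus ?thesis using xy ab P.diff_closed unfolding K_def by blast
        qed
        show "c * x \<in> K" if cx: "c \<in> coeffs_in A" "x \<in> K" for c x
        proof -
          obtain a where a: "a \<in> coeffs_in A" "x - a * h1 \<in> quot_ideal G"
            using cx by (auto simp: K_def)
          have "c * x - (c * a) * h1 = c * (x - a * h1)" by (simp add: algebra_simps)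
          hence "c * x - (c * a) * h1 \<in> quot_ideal G" using J.ideal_mult[OF cx(1) a(2)] by simp
          thus ?thesis using cx a P.mult_closed unfolding K_def by blast
        qed
      qed
      interpret K: subring_ideal "coeffs_in A" K by (rule K_ideal)
      have JK: "x \<in> K" if "x \<in> quot_ideal G" for x
        using that P.zero_closed J.ideal_in by (auto simp: K_def intro!: bexI[of _ 0])
      have h1K: "h1 \<in> K"
        using h(1) P.one_closed J.ideal_zero by (auto simp: K_def intro!: bexI[of _ 1])
      define good where "good g \<longleftrightarrow> g \<in> K \<and> lead_coeff g \<notin> I" for g
      define g where "g = arg_min degree good"
      have "good G" using GJ JK G one_notin by (simp add: good_def)
      hence g: "good g" and g_min: "\<And>s. good s \<Longrightarrow> degree g \<le> degree s"
        using arg_min_natI[of good G degree] arg_min_nat_le[of good _ degree]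
        unfolding g_def by auto
      have gA: "g \<in> coeffs_in A" using g K.ideal_in by (simp add: good_def)
      obtain z where z: "z \<in> A" "z * lead_coeff g \<approx> 1"
        using inverse_exists[of "lead_coeff g"] g gA by (auto simp: good_def coeffs_in_def)
      let ?e = "monom (z * lead_coeff g - 1) (degree g)"
      define g1 where "g1 = smult z g - ?e"
      have e: "?e \<in> coeffs_in I" using z ideal_zero by (auto simp: coeffs_in_def cong_def)
      have g1K: "g1 \<in> K"
      proof -
        have "[:z:] * g \<in> K"
          using z(1) g by (intro K.ideal_mult) (auto simp: good_def coeffs_in_pCons P.zero_closed)
        thus ?thesis unfolding g1_def using JK[OF coeffs_in_ideal_quot[OF e]] K.ideal_diff by simp
      qed
      have "degree g1 \<le> degree g" unfolding g1_def
        by (intro degree_diff_le degree_smult_le degree_monom_le)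
      moreover have cg1: "coeff g1 (degree g) = 1" by (simp add: g1_def)
      ultimately have deg_g1: "degree g1 = degree g" using le_degree[of g1 "degree g"] by simp
      hence lc_g1: "lead_coeff g1 = 1" using cg1 by simp
      have g1A: "g1 \<in> coeffs_in A" by (rule K.ideal_in[OF g1K])
      have divides: "\<exists>k\<in>coeffs_in A. s - k * g1 \<in> coeffs_in I" if s: "s \<in> K" for s
      proof -
        obtain k where k: "k \<in> coeffs_in A" "s - k * g1 = 0 \<or> degree (s - k * g1) < degree g1"
          using monic_division[OF g1A lc_g1 K.ideal_in[OF s]] by blast
        have rK: "s - k * g1 \<in> K" by (intro K.ideal_diff K.ideal_mult s g1K k)
        have "s - k * g1 \<in> coeffs_in I"
        proof (rule ccontr)
          assume r_notin: "\<not> ?thesis"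
          then obtain r' where r': "lead_coeff r' \<notin> I" "s - k * g1 - r' \<in> coeffs_in I"
            "degree r' \<le> degree (s - k * g1)"
            using strip_leading_terms[OF K.ideal_in[OF rK]] by blast
          have "r' \<in> K"
            using K.ideal_diff[OF rK JK[OF coeffs_in_ideal_quot[OF r'(2)]]] by simp
          hence "degree g \<le> degree r'" using r'(1) by (intro g_min) (simp add: good_def)
          moreover have "s - k * g1 \<noteq> 0" using r_notin P.ideal_zero by auto
          ultimately show False using k(2) r'(3) deg_g1 by linarith
        qed
        thus ?thesis using k(1) by blast
      qed
      obtain k where k: "k \<in> coeffs_in A" "G - k * g1 \<in> coeffs_in I"
        using divides[OF JK[OF GJ]] by blast
      have "k \<notin> coeffs_in I"
      proof
        assume "k \<in> coeffs_in I"
        from P.ideal_add[OF k(2) P.ideal_mult_right[OF g1A this]] have "G \<in> coeffs_in I" by simp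
        thus False using G(1) one_notin coeffs_inD[of G I "degree G"] by simp
      qed
      then obtain k' where k': "k' \<in> coeffs_in A" "lead_coeff k' \<notin> I" "k - k' \<in> coeffs_in I"
        using strip_leading_terms[OF k(1)] by blast
      have "G - k' * g1 = (G - k * g1) + (k - k') * g1" by (simp add: algebra_simps)
      hence G_eq: "G - k' * g1 \<in> coeffs_in I"
        using P.ideal_add[OF k(2) P.ideal_mult_right[OF g1A k'(3)]] by metis
      show "h1 \<in> quot_ideal G"
      proof (cases "degree g1 = 0")
        case True
        hence "g1 = 1" using lc_g1 by (metis degree_eq_zeroE one_pCons coeff_pCons_0)
        then obtain a where a: "a \<in> coeffs_in A" "1 - a * h1 \<in> quot_ideal G"
          using g1K by (auto simp: K_def)
        have "h2 * (1 - a * h1) + a * (h1 * h2) \<in> quot_ideal G"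
          by (intro J.ideal_add J.ideal_mult a h)
        moreover have "h2 * (1 - a * h1) + a * (h1 * h2) = h2" by (simp add: algebra_simps)
        ultimately show ?thesis using h2 by simp
      next
        case False
        have "degree k' = 0"
        proof (rule ccontr)
          assume "degree k' \<noteq> 0"
          hence "splits_mod A I G"
            unfolding splits_mod_def using k' g1A G_eq False lc_g1 one_notin by force
          thus False using no_split by blast
        qed
        then obtain c where c: "k' = [:c:]" by (metis degree_eq_zeroE)
        have cA: "c \<in> A - I" using k' by (auto simp: c coeffs_in_pCons)
        then obtain y where y: "y \<in> A" "y * c \<approx> 1" using inverse_exists by blast
        have yA: "[:y:] \<in> coeffs_in A" using y by (simp add: coeffs_in_pCons P.zero_closed)
        have "[:y * c - 1:] \<in> coeffs_in I"
          using y ideal_zero by (auto simp: coeffs_in_def coeff_pCons cong_def split: nat.split)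
        hence "[:y:] * G - [:y:] * (G - k' * g1) - [:y * c - 1:] * g1 \<in> quot_ideal G"
          by (intro J.ideal_diff J.ideal_mult J.ideal_mult_right yA g1A GJ
              coeffs_in_ideal_quot[OF G_eq] coeffs_in_ideal_quot)
        moreover have "[:y:] * G - [:y:] * (G - k' * g1) - [:y * c - 1:] * g1 = g1"
          by (simp add: c smult_diff_left smult_diff_right)
        ultimately have g1J: "g1 \<in> quot_ideal G" by simp
        obtain k1 where k1: "k1 \<in> coeffs_in A" "h1 - k1 * g1 \<in> coeffs_in I"
          using divides[OF h1K] by blast
        have "(h1 - k1 * g1) + k1 * g1 \<in> quot_ideal G"
          by (intro J.ideal_add J.ideal_mult k1 g1J coeffs_in_ideal_quot)
        thus ?thesis by simp
      qed
    qed
  qed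
qed

text \<open>A field with $q^D$ elements, generated by the class of $x$, where $D$ is the degree of $G$.  If $x$
  is fixed by the $e$-th power of Frobenius, then so are all elements, which are hence roots of
  $X^{q^e} - X$.  Because of $e < D$ this polynomial has too small a degree.\<close>

lemma frobenius_not_fixed:
  assumes G: "lead_coeff G = 1" "G \<in> coeffs_in A" "degree G > 0"
    and no_split: "\<not> splits_mod A I G" and e: "0 < e" "e < degree G"
  shows "[:0, 1:] ^ (q ^ e) - [:0, 1:] \<notin> quot_ideal G"
proof
  assume X: "[:0, 1:] ^ (q ^ e) - [:0, 1:] \<in> quot_ideal G"
  interpret J: subring_prime "coeffs_in A" "quot_ideal G"
    by (rule quot_ideal_prime[OF G no_split])
  have qe: "q ^ e = l ^ (r * e)" by (simp add: q(2) power_mult)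
  have lJ: "of_nat l \<in> quot_ideal G"
    using l(2) ideal_zero
    by (intro coeffs_in_ideal_quot) (auto simp: of_nat_poly coeffs_in_def coeff_pCons split: nat.split)
  have fixed: "J.cong (h ^ (q ^ e)) h" if "h \<in> coeffs_in A" for h
    using that
  proof (induction h)
    case 0 show ?case using q_ge_2 by (simp add: power_0_left)
  next
    case (pCons c h)
    have cA: "c \<in> A" "h \<in> coeffs_in A" using pCons.prems by (auto simp: coeffs_in_pCons)
    have c: "[:c:] \<in> coeffs_in A" using cA by (simp add: coeffs_in_pCons J.zero_closed)
    have x: "[:0, 1:] \<in> coeffs_in A"
      using zero_closed one_closed by (simp add: coeffs_in_pCons J.zero_closed)
    have split: "pCons c h = [:c:] + [:0, 1:] * h" by simp
    have "J.cong ([:c:] ^ (q ^ e)) [:c:]"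
    proof -
      have "c ^ (q ^ e) - c \<in> I" using fixed_by_power[OF cA(1) fermat[OF cA(1)]] by (simp add: cong_def)
      hence "[:c ^ (q ^ e) - c:] \<in> coeffs_in I"
        using ideal_zero by (auto simp: coeffs_in_def coeff_pCons split: nat.split)
      thus ?thesis using coeffs_in_ideal_quot by (simp add: J.cong_def poly_const_pow)
    qed
    moreover have "J.cong (([:0, 1:] * h) ^ (q ^ e)) ([:0, 1:] * h)"
      unfolding power_mult_distrib
      by (rule J.cong_mult) (use X pCons.IH[OF cA(2)] cA(2) x J.power_closed in \<open>auto simp: J.cong_def\<close>)
    ultimately have "J.cong ([:c:] ^ (q ^ e) + ([:0, 1:] * h) ^ (q ^ e)) ([:c:] + [:0, 1:] * h)"
      by (rule J.cong_add)
    thus ?case unfolding split qe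
      by (rule J.cong_trans[OF J.frobenius_add[OF l(1) lJ c J.mult_closed[OF x cA(2)]]])
  qed
  \<comment> \<open>The \<open>q ^ D\<close> polynomials of degree less than \<open>D\<close> with coefficients in \<open>T\<close> are pairwise
    incongruent.\<close>
  define D where "D = degree G"
  define C where "C = {..<D} \<rightarrow>\<^sub>E T"
  define pol where "pol c = (\<Sum>i<D. monom (c i) i)" for c :: "nat \<Rightarrow> 'a"
  have coeff_pol: "coeff (pol c) i = (if i < D then c i else 0)" for c i
    by (simp add: pol_def coeff_sum)
  have pol_A: "pol c \<in> coeffs_in A" if "c \<in> C" for c
    using that T_in zero_closed by (auto simp: coeffs_in_def coeff_pol C_def)
  have uniq: "c = c'" if c: "c \<in> C" "c' \<in> C" "pol c - pol c' \<in> quot_ideal G" for c c'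
  proof (rule PiE_ext)
    show "c \<in> {..<D} \<rightarrow>\<^sub>E T" "c' \<in> {..<D} \<rightarrow>\<^sub>E T" using c by (auto simp: C_def)
    fix i assume i: "i \<in> {..<D}"
    have "degree (pol c - pol c') \<le> D - 1"
      by (intro degree_le) (auto simp: coeff_pol)
    hence "degree (pol c - pol c') < degree G" using G(3) by (simp add: D_def)
    hence "pol c - pol c' \<in> coeffs_in I" by (rule quot_ideal_low_degree[OF G(1,2) c(3)])
    hence "c i - c' i \<in> I" using i coeffs_inD[of "pol c - pol c'" I i] by (simp add: coeff_pol)
    thus "c i = c' i" using i c(1,2)
      by (intro T_unique) (auto simp: C_def cong_def)
  qed
  define p where "p = (monom 1 (q ^ e) - [:0, 1:] :: 'a poly poly)"
  have qe1: "1 < q ^ e" using q_ge_2 e(1) by (intro one_less_power) auto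
  have p_eq: "p = monom 1 (q ^ e) - monom 1 1" by (simp add: p_def monom_altdef)
  have deg_p: "degree p = q ^ e" unfolding p_eq by (rule degree_monom_diff[OF qe1])
  have "card (pol ` C) \<le> degree p"
  proof (rule J.card_roots_le)
    show "coeff p i \<in> coeffs_in A" for i
      using J.zero_closed J.one_closed J.uminus_closed
      by (auto simp: p_eq intro!: J.diff_closed)
    show "lead_coeff p = 1" unfolding deg_p using qe1 by (simp add: p_eq)
    show "finite (pol ` C)" unfolding C_def by (intro finite_imageI finite_PiE finite_T) auto
    show "pol ` C \<subseteq> coeffs_in A" using pol_A by blast
    show "poly p s \<in> quot_ideal G" if "s \<in> pol ` C" for s
      using fixed[of s] that pol_A by (auto simp: p_eq poly_monom J.cong_def)
    show "s = t" if "s \<in> pol ` C" "t \<in> pol ` C" "s - t \<in> quot_ideal G" for s t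
      using that uniq by blast
  qed
  moreover have "card (pol ` C) = q ^ D"
  proof -
    have "inj_on pol C" using uniq J.ideal_zero by (auto intro!: inj_onI)
    hence "card (pol ` C) = card C" by (rule card_image)
    thus ?thesis by (simp add: C_def card_PiE q(1))
  qed
  moreover have "q ^ e < q ^ D" using q_ge_2 e(2) by (intro power_strict_increasing) (auto simp: D_def)
  ultimately show False using deg_p by simp
qed

theorem splits_mod_quad_iter_plus:
  assumes A: "m \<in> A" "\<gamma> \<in> A" "t \<in> A" and n: "n \<ge> 2"
    and sq: "poly (quad_iter m n) 0 + \<gamma> = t\<^sup>2"
  shows "splits_mod A I (quad_iter m n + [:\<gamma>:])"
proof (rule ccontr)
  assume no_split: "\<not> ?thesis"
  define G where "G = quad_iter m n + [:\<gamma>:]"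
  interpret P: comm_subring "coeffs_in A" by (rule coeffs_in_comm_subring)
  have const: "[:c:] \<in> coeffs_in A" if "c \<in> A" for c
    using that by (simp add: coeffs_in_pCons P.zero_closed)
  have x: "[:0, 1:] \<in> coeffs_in A" by (simp add: coeffs_in_pCons P.zero_closed zero_closed one_closed)
  have iterA: "quad_iter m k \<in> coeffs_in A" for k
  proof (induction k)
    case 0 show ?case using x by simp
  next
    case (Suc k)
    thus ?case unfolding quad_iter_Suc by (intro P.add_closed P.power_closed const A)
  qed
  have GA: "G \<in> coeffs_in A" unfolding G_def by (intro P.add_closed iterA const A)
  have degG: "degree G = 2 ^ n"
    using degree_lead_quad_iter[of m n] by (subst G_def, subst degree_add_eq_left) auto
  have "coeff G (2 ^ n) = 1"
    using degree_lead_quad_iter[of m n] by (auto simp: G_def coeff_pCons split: nat.split)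
  hence lcG: "lead_coeff G = 1" by (simp add: degG)
  have degG0: "degree G > 0" by (simp add: degG)
  interpret J: subring_prime "coeffs_in A" "quot_ideal G"
    by (rule quot_ideal_prime[OF lcG GA degG0]) (use no_split in \<open>simp add: G_def\<close>)
  have lJ: "of_nat l \<in> quot_ideal G"
    using l(2) ideal_zero
    by (intro coeffs_in_ideal_quot) (auto simp: of_nat_poly coeffs_in_def coeff_pCons split: nat.split)
  have "J.cong ([:0, 1:] ^ (q ^ 2 ^ (n - 1))) [:0, 1:]"
  proof (rule J.square_value_imp_frobenius_fixed[OF q(2) l(1) lJ x _ _ _ _ _ _ _ _ _ _ _ _ n,
        where C = "(\<lambda>c. [:c:]) ` A" and m = "[:m:]" and \<gamma> = "[:\<gamma>:]" and t = "[:t:]"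
          and z = "quad_iter m" and a = "\<lambda>k. [:poly (quad_iter m k) 0:]"])
    fix c assume "c \<in> (\<lambda>c. [:c:]) ` A"
    then obtain d where d: "c = [:d:]" "d \<in> A" by blast
    have "[:d ^ q - d:] \<in> coeffs_in I" using fermat[OF d(2)] ideal_zero
      by (auto simp: coeffs_in_def coeff_pCons cong_def split: nat.split)
    thus "c \<in> coeffs_in A \<and> J.cong (c ^ q) c"
      using coeffs_in_ideal_quot const d by (simp add: J.cong_def poly_const_pow)
  next
    show "[:m:] \<in> (\<lambda>c. [:c:]) ` A" "[:t:] \<in> (\<lambda>c. [:c:]) ` A" using A by auto
    have "- [:\<gamma>:] - [:m:] = [:- \<gamma> - m:]" by simp
    thus "- [:\<gamma>:] - [:m:] \<in> (\<lambda>c. [:c:]) ` A" using A by (auto intro!: imageI diff_closed uminus_closed)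
    have "- 1 = [:- 1:]" by (simp add: one_pCons)
    thus "- 1 \<in> (\<lambda>c. [:c:]) ` A" using one_closed uminus_closed by blast
    show "[:poly (quad_iter m k) 0:] \<in> (\<lambda>c. [:c:]) ` A" for k
      using iterA[of k] zero_closed by (intro imageI poly_closed) (auto simp: coeffs_in_def)
    show "quad_iter m 0 = [:0, 1:]" by simp
    show "quad_iter m (Suc k) = (quad_iter m k)\<^sup>2 + [:m:]" for k by (rule quad_iter_Suc)
    have "G \<in> quot_ideal G"
      using GA P.one_closed coeffs_in_subring_ideal[THEN subring_ideal.ideal_zero]
      by (auto simp: quot_ideal_def intro!: bexI[of _ 1])
    moreover have "quad_iter m n - - [:\<gamma>:] = G" by (simp add: G_def)
    ultimately show "J.cong (quad_iter m n) (- [:\<gamma>:])" unfolding J.cong_def by metis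
    show "[:poly (quad_iter m 0) 0:] = 0" by simp
    show "[:poly (quad_iter m (Suc k)) 0:] = [:poly (quad_iter m k) 0:]\<^sup>2 + [:m:]" for k
      by (simp add: quad_iter_Suc power2_eq_square)
    have "[:poly (quad_iter m n) 0:] + [:\<gamma>:] = [:t:]\<^sup>2"
      using sq by (simp add: power2_eq_square)
    thus "J.cong ([:poly (quad_iter m n) 0:] + [:\<gamma>:]) ([:t:]\<^sup>2)" by simp
  qed
  moreover have "(2::nat) ^ (n - 1) < 2 ^ n" using n by simp
  moreover have "\<not> splits_mod A I G" using no_split by (simp add: G_def)
  ultimately show False
    using frobenius_not_fixed[OF lcG GA degG0, of "2 ^ (n - 1)"] degG
    unfolding J.cong_def by simp
qed

end

section \<open>Reductions of the iterates\<close>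

lemma (in subring_ideal) coeffs_in_ideal_pcompose:
  assumes "p \<in> coeffs_in I" "r \<in> coeffs_in A"
  shows "pcompose p r \<in> coeffs_in I"
proof -
  interpret P: subring_ideal "coeffs_in A" "coeffs_in I" by (rule coeffs_in_subring_ideal)
  have "p \<in> coeffs_in I \<Longrightarrow> pcompose p r \<in> coeffs_in I"
  proof (induction p)
    case (pCons a p)
    have "a \<in> I" "p \<in> coeffs_in I"
      using coeffs_inD[OF pCons.prems, of 0] coeffs_inD[OF pCons.prems, of "Suc _"]
      by (auto simp: coeffs_in_def)
    moreover from this have "[:a:] \<in> coeffs_in I"
      using ideal_zero by (auto simp: coeffs_in_def coeff_pCons split: nat.split)
    ultimately show ?case using pCons.IH
      by (auto simp: pcompose_pCons intro!: P.ideal_add P.ideal_mult assms(2))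
  qed simp
  thus ?thesis using assms(1) by blast
qed

text \<open>Substituting a monic polynomial into both factors preserves their leading coefficients.\<close>

lemma splits_mod_pcompose:
  fixes A I :: "'a::idom set"
  assumes "subring_prime A I" and p: "splits_mod A I p"
    and h: "h \<in> coeffs_in A" "lead_coeff h = 1" "degree h > 0"
  shows "splits_mod A I (pcompose p h)"
proof -
  interpret subring_prime A I by fact
  obtain b c where bc: "b \<in> coeffs_in A" "c \<in> coeffs_in A" "degree b > 0" "degree c > 0"
    "lead_coeff b \<notin> I" "lead_coeff c \<notin> I" "p - b * c \<in> coeffs_in I"
    using p by (auto simp: splits_mod_def)
  have "pcompose (p - b * c) h \<in> coeffs_in I" by (rule coeffs_in_ideal_pcompose[OF bc(7) h(1)])
  hence "pcompose p h - pcompose b h * pcompose c h \<in> coeffs_in I"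
    by (simp add: pcompose_diff pcompose_mult)
  moreover have "lead_coeff (pcompose s h) = lead_coeff s" for s
    using h(2,3) by (simp add: lead_coeff_comp)
  moreover have "degree (pcompose s h) > 0" if "degree s > 0" for s
    using that h(3) by (simp add: degree_pcompose)
  ultimately show ?thesis
    using bc coeffs_in_pcompose[OF _ h(1)] unfolding splits_mod_def by metis
qed

text \<open>Taking residue classes of coefficients is a ring homomorphism, and it keeps the degree of the two
  factors.  As the residue ring is a domain, a polynomial of positive degree is not a unit.\<close>

lemma reducible_in_UP_if_splits_mod:
  fixes P :: "'a::field_char_0 set"
  assumes P: "nonzero_prime ring_of_integers P"
    and p: "p \<in> coeffs_in integers" and split: "splits_mod integers P p"
  shows "reducible_in (UP (ring_of_integers Quot P)) (reduce_poly P p)"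
proof -
  let ?R = "ring_of_integers :: 'a ring"
  let ?K = "?R Quot P"
  let ?red = "reduce_poly P"
  interpret R: primeideal P ?R by (rule nonzero_primeD(2)[OF P])
  interpret subring_prime integers P by (rule nonzero_primeD(3)[OF P])
  interpret Q: comm_subring "coeffs_in (integers :: 'a set)" by (rule coeffs_in_comm_subring)
  interpret K: domain ?K by (rule R.quotient_is_domain)
  interpret UP: UP_domain ?K "UP ?K" by unfold_locales
  interpret h: ring_hom_cring ?R ?K "(+>\<^bsub>?R\<^esub>) P"
    by (rule R.rcos_ring_hom_cring)
  have coset_eq: "P +>\<^bsub>?R\<^esub> x = P +>\<^bsub>?R\<^esub> y \<longleftrightarrow> x - y \<in> P"
    if "x \<in> integers" "y \<in> integers" for x y
  proof -
    have "\<ominus>\<^bsub>?R\<^esub> y = - y" using that by (intro R.minus_equality) auto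
    hence "x \<ominus>\<^bsub>?R\<^esub> y = x - y" by (simp add: a_minus_def)
    thus ?thesis using R.quotient_eq_iff_same_a_r_cos[OF R.is_ideal, of x y] that by simp
  qed
  have coset_zero: "P +>\<^bsub>?R\<^esub> x = \<zero>\<^bsub>?K\<^esub> \<longleftrightarrow> x \<in> P" if "x \<in> integers" for x
    using coset_eq[OF that zero_closed] h.hom_zero by simp
  have int_coeff: "coeff s i \<in> integers" if "s \<in> coeffs_in integers" for s :: "'a poly" and i
    using that by (rule coeffs_inD)
  have red_closed: "?red s \<in> carrier (UP ?K)" if s: "s \<in> coeffs_in integers" for s
    unfolding UP_def partial_object.select_convs
  proof (rule mem_upI)
    show "?red s n \<in> carrier ?K" for n
      using h.hom_closed int_coeff[OF s] by (simp add: reduce_poly_def)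
    have "bound \<zero>\<^bsub>?K\<^esub> (degree s) (?red s)"
      using h.hom_zero by (intro bound.intro) (simp add: reduce_poly_def coeff_eq_0)
    thus "\<exists>n. bound \<zero>\<^bsub>?K\<^esub> n (?red s)" by blast
  qed
  have coeff_red: "UnivPoly.coeff (UP ?K) (?red s) n = P +>\<^bsub>?R\<^esub> coeff s n"
    if s: "s \<in> coeffs_in integers" for s n
    using red_closed[OF s] by (simp add: UP_def reduce_poly_def)
  have fin: "finsum ?R g {..n} = sum g {..n}" if "\<And>i. g i \<in> integers" for g and n :: nat
    by (induction n) (use that in \<open>auto simp: add.commute\<close>)
  obtain b c where bc: "b \<in> coeffs_in integers" "c \<in> coeffs_in integers" "degree b > 0" "degree c > 0"
    "lead_coeff b \<notin> P" "lead_coeff c \<notin> P" "p - b * c \<in> coeffs_in P"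
    using split by (auto simp: splits_mod_def)
  have prod: "?red p = ?red b \<otimes>\<^bsub>UP ?K\<^esub> ?red c"
  proof (rule UP.up_eqI)
    show "?red p \<in> carrier (UP ?K)" "?red b \<otimes>\<^bsub>UP ?K\<^esub> ?red c \<in> carrier (UP ?K)"
      using red_closed p bc by auto
    fix n
    have prodA: "coeff b i * coeff c j \<in> integers" for i j
      by (rule mult_closed[OF int_coeff[OF bc(1)] int_coeff[OF bc(2)]])
    have "P +>\<^bsub>?R\<^esub> coeff p n = P +>\<^bsub>?R\<^esub> coeff (b * c) n"
      using coeff_eq_0 bc(7) int_coeff[OF p] int_coeff[OF Q.mult_closed[OF bc(1,2)]]
      by (subst coset_eq) (auto simp: coeffs_in_def)
    also have "coeff (b * c) n = finsum ?R (\<lambda>i. coeff b i * coeff c (n - i)) {..n}"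
      unfolding coeff_mult by (rule fin[symmetric]) (rule prodA)
    also have "P +>\<^bsub>?R\<^esub> \<dots> =
        (\<Oplus>\<^bsub>?K\<^esub> i \<in> {..n}. ((+>\<^bsub>?R\<^esub>) P \<circ> (\<lambda>i. coeff b i * coeff c (n - i))) i)"
      using prodA by (intro h.hom_finsum) auto
    also have "\<dots> = (\<Oplus>\<^bsub>?K\<^esub> i \<in> {..n}. (P +>\<^bsub>?R\<^esub> coeff b i) \<otimes>\<^bsub>?K\<^esub> (P +>\<^bsub>?R\<^esub> coeff c (n - i)))"
      using h.hom_mult h.hom_closed int_coeff[OF bc(1)] int_coeff[OF bc(2)]
      by (intro K.finsum_cong') (auto simp: Pi_def)
    also have "\<dots> = UnivPoly.coeff (UP ?K) (?red b \<otimes>\<^bsub>UP ?K\<^esub> ?red c) n"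
      using UP.coeff_mult[OF red_closed[OF bc(1)] red_closed[OF bc(2)], of n]
        coeff_red[OF bc(1)] coeff_red[OF bc(2)] by simp
    finally show "UnivPoly.coeff (UP ?K) (?red p) n = UnivPoly.coeff (UP ?K) (?red b \<otimes>\<^bsub>UP ?K\<^esub> ?red c) n"
      using coeff_red[OF p] by simp
  qed
  have deg: "?red s \<noteq> \<zero>\<^bsub>UP ?K\<^esub> \<and> deg ?K (?red s) \<ge> degree s"
    if s: "s \<in> coeffs_in integers" "lead_coeff s \<notin> P" for s
  proof
    have nz: "UnivPoly.coeff (UP ?K) (?red s) (degree s) \<noteq> \<zero>\<^bsub>?K\<^esub>"
      using coeff_red[OF s(1)] coset_zero int_coeff[OF s(1)] s(2) by simp
    thus "?red s \<noteq> \<zero>\<^bsub>UP ?K\<^esub>" by auto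
    show "deg ?K (?red s) \<ge> degree s" by (rule UP.deg_belowI) (use nz red_closed s in auto)
  qed
  have nonunit: "?red s \<in> carrier (UP ?K) - Units (UP ?K)"
    if s: "s \<in> coeffs_in integers" "lead_coeff s \<notin> P" "degree s > 0" for s
  proof -
    have "?red s \<notin> Units (UP ?K)"
    proof
      assume u: "?red s \<in> Units (UP ?K)"
      then obtain w where w: "w \<in> carrier (UP ?K)" "?red s \<otimes>\<^bsub>UP ?K\<^esub> w = \<one>\<^bsub>UP ?K\<^esub>"
        using UP.P.Units_r_inv_ex by blast
      hence "w \<noteq> \<zero>\<^bsub>UP ?K\<^esub>" using red_closed[OF s(1)] UP.P.r_null by auto
      hence "deg ?K (?red s) + deg ?K w = 0"
        using UP.deg_mult[of "?red s" w] w red_closed[OF s(1)] deg[OF s(1,2)] by simp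
      thus False using deg[OF s(1,2)] s(3) by simp
    qed
    thus ?thesis using red_closed[OF s(1)] by blast
  qed
  have "?red p \<noteq> \<zero>\<^bsub>UP ?K\<^esub>"
    unfolding prod using deg[OF bc(1,5)] deg[OF bc(2,6)] red_closed bc UP.integral_iff by auto
  thus ?thesis
    unfolding reducible_in_def using prod nonunit bc red_closed[OF p] by blast
qed

text \<open>A nonzero prime ideal contains a nonzero integer and therefore a prime number $l$, so that the
  finiteness result for residue rings applies.\<close>

lemma nonzero_prime_residue_system:
  fixes P :: "'a::field_char_0 set"
  assumes nf: "number_field TYPE('a)" and P: "nonzero_prime ring_of_integers P"
  shows "\<exists>T l r q. finite_residue_prime integers P T l r q"
proof -
  interpret subring_prime integers P by (rule nonzero_primeD(3)[OF P])
  obtain x where x: "x \<in> P" "x \<noteq> 0" using nonzero_primeD(4)[OF P] by blast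
  obtain N z where N: "N \<noteq> 0" "z \<in> integers" "of_int N = z * x"
    using integer_divides_int[OF comm_subring_axioms ideal_in[OF x(1)] x(2)] by blast
  have "of_int N \<in> P" unfolding N(3) by (rule ideal_mult[OF N(2) x(1)])
  hence "of_nat (nat \<bar>N\<bar>) \<in> P" using ideal_uminus[of "of_int N"] by (cases "N \<ge> 0") auto
  moreover have "\<exists>l. prime l \<and> of_nat l \<in> P" if "of_nat M \<in> P" "M > 0" for M :: nat
    using that
  proof (induction M rule: less_induct)
    case (less M)
    have "M \<noteq> 1" using less.prems one_notin by auto
    then obtain l where l: "prime l" "l dvd M" using prime_factor_nat by blast
    then obtain k where k: "M = l * k" by blast
    have "of_nat l \<in> P \<or> of_nat k \<in> P"
      using prime[of "of_nat l" "of_nat k"] less.prems(1) by (simp add: k)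
    moreover have "k < M" "k > 0" using k less.prems(2) prime_gt_1_nat[OF l(1)] by auto
    ultimately show ?case using l less.IH by blast
  qed
  ultimately obtain l where l: "prime l" "of_nat l \<in> P" using N(1) by (metis zero_less_abs_iff zero_less_nat_eq)
  obtain T r where "residue_system T" "card T = l ^ r"
    using residue_system_exists[OF subring_ideal_axioms nf l] by blast
  hence "finite_residue_prime integers P T l r (card T)"
    by unfold_locales (use l in auto)
  thus ?thesis by blast
qed

lemma poly_iterate_conjugate:
  fixes \<gamma> m :: "'a::comm_ring_1"
  defines "f \<equiv> [:- \<gamma>, 1:]\<^sup>2 + [:\<gamma> + m:]"
  shows "poly_iterate f i = pcompose (quad_iter m i + [:\<gamma>:]) [:- \<gamma>, 1:]"
proof (induction i)
  case 0 show ?case by (simp add: pcompose_pCons)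
next
  case (Suc i)
  have f: "pcompose f (g + [:\<gamma>:]) = g\<^sup>2 + [:m:] + [:\<gamma>:]" for g
  proof -
    have "pcompose [:- \<gamma>, 1:] (g + [:\<gamma>:]) = g" by (simp add: pcompose_pCons)
    thus ?thesis
      unfolding f_def power2_eq_square pcompose_add pcompose_mult by (simp add: add.commute)
  qed
  have "poly_iterate f (Suc i) = pcompose f (pcompose (quad_iter m i) [:- \<gamma>, 1:] + [:\<gamma>:])"
    unfolding poly_iterate_Suc Suc by (simp add: pcompose_add)
  also have "\<dots> = pcompose (quad_iter m (Suc i) + [:\<gamma>:]) [:- \<gamma>, 1:]"
    unfolding f quad_iter_Suc by (simp add: pcompose_add pcompose_mult power2_eq_square)
  finally show ?case .
qed

theorem corollary3p2:
  fixes m s \<gamma> :: "'a::field_char_0"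
    and f0 f :: "'a poly"
    and \<qq> :: "'a set"
    and n :: nat
  assumes "number_field TYPE('a)"
    and "nonzero_prime ring_of_integers \<qq>"
    and "odd (prime_valuation ring_of_integers \<qq> 2)"
    and "n \<ge> 2"
    and "m \<in> carrier ring_of_integers"
    and "f0 = [:m, 0, 1:]"
    and "s \<in> carrier ring_of_integers"
    and "\<exists>t \<in> carrier ring_of_integers. s = t ^ 2"
    and "s - (poly (poly_iterate f0 (n - 1)) 0) ^ 2 \<notin> \<qq>"
    and "\<not> (\<exists>z::'a. - (s - (poly (poly_iterate f0 (n - 1)) 0) ^ 2) = z ^ 2)"
    and "\<gamma> = s - poly (poly_iterate f0 n) 0"
    and "f = [:- \<gamma>, 1:] ^ 2 + [:\<gamma> + m:]"
  shows "\<forall>i\<ge>n. Factorial_Ring.irreducible (poly_iterate f i) \<and>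
           (\<forall>\<pp>. nonzero_prime ring_of_integers \<pp> \<longrightarrow>
              reducible_in (UP (ring_of_integers Quot \<pp>)) (reduce_poly \<pp> (poly_iterate f i)))"
proof (intro allI impI conjI)
  note nf = assms(1) and q = assms(2) and n = assms(4)
  interpret comm_subring "integers :: 'a set"
    using nonzero_primeD(3)[OF q] by (simp add: subring_prime_def subring_ideal_def)
  interpret Q: comm_subring "coeffs_in (integers :: 'a set)" by (rule coeffs_in_comm_subring)
  have m: "m \<in> integers" and s: "s \<in> integers" using assms(5,7) by auto
  obtain t where t: "t \<in> integers" "s = t\<^sup>2" using assms(8) by auto
  define u where "u = s - (poly (quad_iter m (n - 1)) 0)\<^sup>2"
  have iterA: "quad_iter m k \<in> coeffs_in integers" for k
  proof (induction k)
    case 0 show ?case by (simp add: coeffs_in_pCons Q.zero_closed)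
  next
    case (Suc k)
    thus ?case unfolding quad_iter_Suc
      by (intro Q.add_closed Q.power_closed) (use m in \<open>auto simp: coeffs_in_pCons Q.zero_closed\<close>)
  qed
  have orbitA: "poly (quad_iter m k) 0 \<in> integers" for k
    by (intro poly_closed coeffs_inD[OF iterA] zero_closed)
  have gamma: "\<gamma> \<in> integers" unfolding assms(11) assms(6) by (rule diff_closed[OF s orbitA])
  obtain k where k: "n = Suc k" using n by (cases n) auto
  have u_gamma: "u = m + \<gamma>"
    unfolding u_def assms(11) assms(6) k by (simp add: quad_iter_Suc)
  have uA: "u \<in> integers" unfolding u_gamma by (intro add_closed m gamma)
  have uq: "u \<notin> \<qq>" using assms(9) unfolding u_def assms(6) .
  have u0: "u \<noteq> 0" using uq subring_ideal.ideal_zero[of integers \<qq>] nonzero_primeD(3)[OF q]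
    by (auto simp: subring_prime_def)
  fix i assume i: "i \<ge> n"
  have f_iter: "poly_iterate f j = pcompose (quad_iter m j + [:\<gamma>:]) [:- \<gamma>, 1:]" for j
    unfolding assms(12) by (rule poly_iterate_conjugate)
  show "Factorial_Ring.irreducible (poly_iterate f i)"
  proof -
    obtain v where v: "discrete_valuation v" "v 2 > 0" "odd (v 2)"
      "\<And>x. algebraic_int x \<Longrightarrow> discrete_valuation.vge v 0 x"
      "\<And>x. algebraic_int x \<Longrightarrow> x \<notin> \<qq> \<Longrightarrow> v x = 0"
      using odd_prime_valuation_imp_valuation[OF nf q assms(3)] by blast
    interpret discrete_valuation v by fact
    obtain j where j: "i = Suc j" using i n by (cases i) auto
    have "Factorial_Ring.irreducible (quad_iter m (Suc j) + [:\<gamma>:])"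
      by (rule irreducible_quad_iter_plus[OF v(2,3) _ u0 _ u_gamma])
         (use v m uA uq assms(10) in \<open>auto simp: u_def assms(6)\<close>)
    thus ?thesis unfolding f_iter j by (rule irreducible_pcompose_shift)
  qed
  fix \<pp> :: "'a set" assume p: "nonzero_prime ring_of_integers \<pp>"
  obtain T l r q' where "finite_residue_prime integers \<pp> T l r q'"
    using nonzero_prime_residue_system[OF nf p] by blast
  then interpret p: finite_residue_prime integers \<pp> T l r q' .
  have shiftA: "[:- \<gamma>, 1:] \<in> coeffs_in integers"
    using gamma by (simp add: coeffs_in_pCons Q.zero_closed)
  have fA: "poly_iterate f j \<in> coeffs_in integers" for j
    unfolding f_iter
    by (intro coeffs_in_pcompose Q.add_closed iterA shiftA)
       (use gamma in \<open>simp add: coeffs_in_pCons Q.zero_closed\<close>)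
  have "splits_mod integers \<pp> (quad_iter m n + [:\<gamma>:])"
    by (rule p.splits_mod_quad_iter_plus[OF m gamma t(1) n])
       (simp add: assms(6,11) t(2))
  hence "splits_mod integers \<pp> (poly_iterate f n)"
    unfolding f_iter by (rule splits_mod_pcompose[OF p.subring_prime_axioms _ shiftA]) simp_all
  moreover have f_monic: "degree (poly_iterate f j) = 2 ^ j \<and> lead_coeff (poly_iterate f j) = 1" for j
  proof (induction j)
    case (Suc j)
    have f2: "f = [:\<gamma>\<^sup>2 + \<gamma> + m, - 2 * \<gamma>, 1:]" by (simp add: assms(12) power2_eq_square)
    have f_deg: "degree f = 2" "lead_coeff f = 1" by (simp_all add: f2)
    have "degree (poly_iterate f (Suc j)) = 2 ^ Suc j"
      unfolding poly_iterate_Suc degree_pcompose using Suc f_deg by simp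
    moreover have "lead_coeff (poly_iterate f (Suc j)) = 1"
      unfolding poly_iterate_Suc using Suc f_deg by (subst lead_coeff_comp) auto
    ultimately show ?case by blast
  qed simp
  ultimately have "splits_mod integers \<pp> (pcompose (poly_iterate f n) (poly_iterate f (i - n)))"
    using f_monic by (intro splits_mod_pcompose[OF p.subring_prime_axioms _ fA]) simp_all
  hence "splits_mod integers \<pp> (poly_iterate f i)"
    using i by (simp flip: poly_iterate_add)
  thus "reducible_in (UP (ring_of_integers Quot \<pp>)) (reduce_poly \<pp> (poly_iterate f i))"
    by (rule reducible_in_UP_if_splits_mod[OF p fA])
qed

end
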